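(* Let $F\in L^\infty(\mathbb T)$. Suppose that there exists $a\in\mathbb C\setminus\{0\}$ such that $\mathrm{Re}(aF(\tau))\ge0$ for almost every $\tau\in\mathbb T$. Then the Toeplitz operator $T_F$ is embeddable into a $C_0$-semigroup of operators on $H^2$.
   Context: $\mathbb T$ is the unit circle, $H^2$ the Hardy space of the unit disk, $P_+$ the Riesz projection of $L^2(\mathbb T)$ onto $H^2$, and $T_Ff=P_+(Ff)$. A $C_0$-semigroup on a Banach space $X$ is a family $(T_t)_{t>0}$ of bounded operators with $T_tT_s=T_{t+s}$ for $t,s>0$ and $\|T_tx-x\|\to0$ as $t\to0^+$ for every $x\in X$. $T$ is embeddable into a $C_0$-semigroup if there is a $C_0$-semigroup $(T_t)_{t>0}$ with $T_1=T$. *)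

theory Defs
  imports "HOL-Analysis.Analysis"
begin

section \<open>Complex Banach spaces\<close>

text \<open>HOL-Analysis only has real normed spaces, so the complex scalar action is added here.\<close>

class complex_normed_vector = real_normed_vector +
  fixes scaleC :: "complex \<Rightarrow> 'a \<Rightarrow> 'a"  (infixr "*\<^sub>C" 75)
  assumes scaleC_add_right: "c *\<^sub>C (x + y) = c *\<^sub>C x + c *\<^sub>C y"
    and scaleC_add_left: "(c + d) *\<^sub>C x = c *\<^sub>C x + d *\<^sub>C x"
    and scaleC_scaleC: "c *\<^sub>C d *\<^sub>C x = (c * d) *\<^sub>C x"
    and scaleR_scaleC: "r *\<^sub>R x = complex_of_real r *\<^sub>C x"
    and norm_scaleC: "norm (c *\<^sub>C x) = cmod c * norm x"

class complex_banach = complex_normed_vector + complete_space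

subclass (in complex_banach) banach ..

definition bounded_clinear ::
    "('a::complex_normed_vector \<Rightarrow> 'b::complex_normed_vector) \<Rightarrow> bool" where
  "bounded_clinear A \<longleftrightarrow> bounded_linear A \<and> (\<forall>c x. A (c *\<^sub>C x) = c *\<^sub>C A x)"


section \<open>Semigroups of operators\<close>

text \<open>The parameter of a semigroup ranges over the positive reals; the values of \<open>S\<close> at
  parameters \<open>t \<le> 0\<close> are irrelevant.\<close>

definition C0_semigroup :: "(real \<Rightarrow> 'a::complex_banach \<Rightarrow> 'a) \<Rightarrow> bool" where
  "C0_semigroup S \<longleftrightarrow>
     (\<forall>t>0. bounded_clinear (S t)) \<and>
     (\<forall>t>0. \<forall>s>0. S t \<circ> S s = S (t + s)) \<and>
     (\<forall>x. ((\<lambda>t. norm (S t x - x)) \<longlongrightarrow> 0) (at_right 0))"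

definition C0_embeddable :: "('a::complex_banach \<Rightarrow> 'a) \<Rightarrow> bool" where
  "C0_embeddable A \<longleftrightarrow> (\<exists>S. C0_semigroup S \<and> S 1 = A)"


section \<open>The unit circle\<close>

text \<open>Normalised arc length on the unit circle.\<close>

definition circle :: "complex measure" where
  "circle = distr (uniform_measure lborel {0..2 * pi}) (restrict_space borel (sphere 0 1)) cis"

lemma space_circle [simp]: "space circle = sphere 0 1"
  by (simp add: circle_def space_restrict_space)

lemma sets_circle [measurable_cong]: "sets circle = sets (restrict_space borel (sphere 0 1))"
  by (simp add: circle_def)

lemma measurable_cis_circle [measurable]:
  "cis \<in> uniform_measure lborel {0..2 * pi} \<rightarrow>\<^sub>M restrict_space borel (sphere 0 1)"
proof (rule measurable_restrict_space2)
  show "cis \<in> uniform_measure lborel {0..2 * pi} \<rightarrow>\<^sub>M borel"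
    by (subst measurable_cong_sets[OF sets_uniform_measure refl])
       (simp add: borel_measurable_continuous_onI continuous_on_cis)
qed simp

lemma emeasure_circle: "emeasure circle (space circle) = 1"
proof -
  have "emeasure circle (space circle) =
      emeasure (uniform_measure lborel {0..2 * pi}) (cis -` sphere 0 1 \<inter> UNIV)"
    unfolding circle_def by (subst emeasure_distr) (auto simp: space_restrict_space sets_restrict_space)
  also have "cis -` sphere 0 1 \<inter> UNIV = UNIV" by auto
  also have "emeasure (uniform_measure lborel {0..2 * pi}) UNIV = 1"
    by (subst emeasure_uniform_measure) (auto simp: ennreal_divide_self)
  finally show ?thesis .
qed

interpretation circle: finite_measure circle
  by standard (use emeasure_circle in simp)

lemma measure_circle [simp]: "measure circle (sphere 0 1) = 1"
  using emeasure_circle by (simp add: measure_def)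

lemma borel_measurable_circle_continuous:
  "continuous_on (sphere 0 1) f \<Longrightarrow> f \<in> borel_measurable circle"
  using borel_measurable_continuous_on_restrict
  by (subst measurable_cong_sets[OF sets_circle refl]) blast

lemma integral_circle_powi:
  "integral\<^sup>L circle (\<lambda>\<tau>. \<tau> powi n) = (if n = 0 then 1 else 0)"
proof (cases "n = 0")
  case True
  then show ?thesis by simp
next
  case False
  have meas: "(\<lambda>\<tau>::complex. \<tau> powi n) \<in> borel_measurable (restrict_space borel (sphere 0 1))"
    by (intro borel_measurable_continuous_on_restrict continuous_intros) auto
  let ?g = "\<lambda>t. cis (of_int n * t)"
  let ?G = "\<lambda>t. cis (of_int n * t) / (\<i> * of_int n)"
  have m2: "?g \<in> borel_measurable lborel"
    by (simp add: borel_measurable_continuous_onI continuous_intros)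
  have "integral\<^sup>L circle (\<lambda>\<tau>. \<tau> powi n) = integral\<^sup>L (uniform_measure lborel {0..2 * pi}) ?g"
    unfolding circle_def using meas
    by (subst integral_distr) (auto simp: cis_power_int)
  also have "\<dots> = integral\<^sup>L lborel (\<lambda>t. (indicator {0..2 * pi} t / (2 * pi)) *\<^sub>R ?g t)"
  proof -
    have "uniform_measure lborel {0..2 * pi} =
        density lborel (\<lambda>t. ennreal (indicator {0..2 * pi} t / (2 * pi)))"
      unfolding uniform_measure_def
      by (intro density_cong) (auto simp: divide_ennreal[symmetric] indicator_def split: if_splits)
    then show ?thesis using m2
      by (simp add: integral_density)
  qed
  also have "\<dots> = integral\<^sup>L lborel (\<lambda>t. indicator {0..2 * pi} t *\<^sub>R (?g t / (2 * pi)))"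
    by (intro Bochner_Integration.integral_cong) (auto simp: indicator_def scaleR_conv_of_real)
  also have "\<dots> = ?G (2 * pi) / (2 * pi) - ?G 0 / (2 * pi)"
  proof (rule integral_FTC_atLeastAtMost)
    show "((\<lambda>t. ?G t / (2 * pi)) has_vector_derivative ?g t / (2 * pi)) (at t within {0..2 * pi})" for t
      unfolding cis_conv_exp using False
      by (auto intro!: derivative_eq_intros has_vector_derivative_real_field simp: field_simps)
  qed (auto intro!: continuous_intros)
  also have "?G (2 * pi) = ?G 0"
  proof -
    have "cis (of_int n * (2 * pi)) = 1"
      by (rule complex_eqI) (simp_all add: mult.commute[of "of_int n"] cos_int_2pin sin_int_2pin)
    then show ?thesis by simp
  qed
  finally show ?thesis using False by simp
qed


section \<open>The space \<open>L\<^sup>2\<close> of the circle\<close>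

definition square_integrable :: "(complex \<Rightarrow> complex) \<Rightarrow> bool" where
  "square_integrable f \<longleftrightarrow>
     f \<in> borel_measurable circle \<and> integrable circle (\<lambda>\<tau>. (cmod (f \<tau>))\<^sup>2)"

lemma square_integrable_measurable [measurable_dest]:
  "square_integrable f \<Longrightarrow> f \<in> borel_measurable circle"
  by (simp add: square_integrable_def)

lemma square_integrable_dominated:
  assumes "f \<in> borel_measurable circle" "square_integrable g"
    and "AE \<tau> in circle. cmod (f \<tau>) \<le> C * cmod (g \<tau>)"
  shows "square_integrable f"
  unfolding square_integrable_def
proof (intro conjI assms(1))
  have "integrable circle (\<lambda>\<tau>. C\<^sup>2 * (cmod (g \<tau>))\<^sup>2)"
    using assms(2) by (auto simp: square_integrable_def)
  then show "integrable circle (\<lambda>\<tau>. (cmod (f \<tau>))\<^sup>2)"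
  proof (rule Bochner_Integration.integrable_bound)
    show "(\<lambda>\<tau>. (cmod (f \<tau>))\<^sup>2) \<in> borel_measurable circle" using assms(1) by measurable
    show "AE \<tau> in circle. norm ((cmod (f \<tau>))\<^sup>2) \<le> norm (C\<^sup>2 * (cmod (g \<tau>))\<^sup>2)"
      using assms(3)
    proof eventually_elim
      case (elim \<tau>)
      then have "(cmod (f \<tau>))\<^sup>2 \<le> (C * cmod (g \<tau>))\<^sup>2" by (intro power_mono) auto
      then show ?case by (simp add: power_mult_distrib)
    qed
  qed
qed

lemma square_integrable_bounded:
  assumes "f \<in> borel_measurable circle" "AE \<tau> in circle. cmod (f \<tau>) \<le> C"
  shows "square_integrable f"
  by (rule square_integrable_dominated[where g="\<lambda>_. 1" and C=C])
     (use assms in \<open>auto simp: square_integrable_def\<close>)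

lemma square_integrable_0 [simp]: "square_integrable (\<lambda>_. 0)"
  by (simp add: square_integrable_def)

lemma square_integrable_add:
  assumes f: "square_integrable f" and g: "square_integrable g"
  shows "square_integrable (\<lambda>\<tau>. f \<tau> + g \<tau>)"
  unfolding square_integrable_def
proof
  show [measurable]: "(\<lambda>\<tau>. f \<tau> + g \<tau>) \<in> borel_measurable circle"
    using f g by (auto simp: square_integrable_def)
  have "integrable circle (\<lambda>\<tau>. 2 * (cmod (f \<tau>))\<^sup>2 + 2 * (cmod (g \<tau>))\<^sup>2)"
    using f g by (auto simp: square_integrable_def)
  then show "integrable circle (\<lambda>\<tau>. (cmod (f \<tau> + g \<tau>))\<^sup>2)"
  proof (rule Bochner_Integration.integrable_bound)
    show "(\<lambda>\<tau>. (cmod (f \<tau> + g \<tau>))\<^sup>2) \<in> borel_measurable circle" by measurable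
    have "(cmod (a + b))\<^sup>2 \<le> 2 * (cmod a)\<^sup>2 + 2 * (cmod b)\<^sup>2" for a b
    proof -
      have "(cmod (a + b))\<^sup>2 \<le> (cmod a + cmod b)\<^sup>2"
        by (intro power_mono norm_triangle_ineq) auto
      also have "\<dots> \<le> 2 * (cmod a)\<^sup>2 + 2 * (cmod b)\<^sup>2"
        using zero_le_power2[of "cmod a - cmod b"]
        unfolding power2_sum power2_diff by linarith
      finally show ?thesis .
    qed
    then show "AE \<tau> in circle. norm ((cmod (f \<tau> + g \<tau>))\<^sup>2)
        \<le> norm (2 * (cmod (f \<tau>))\<^sup>2 + 2 * (cmod (g \<tau>))\<^sup>2)"
      by (auto intro!: AE_I2)
  qed
qed

lemma square_integrable_cmult:
  "square_integrable f \<Longrightarrow> square_integrable (\<lambda>\<tau>. c * f \<tau>)"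
  by (auto simp: square_integrable_def norm_mult power_mult_distrib)

lemma square_integrable_uminus:
  "square_integrable f \<Longrightarrow> square_integrable (\<lambda>\<tau>. - f \<tau>)"
  by (auto simp: square_integrable_def)

lemma square_integrable_diff:
  "square_integrable f \<Longrightarrow> square_integrable g \<Longrightarrow> square_integrable (\<lambda>\<tau>. f \<tau> - g \<tau>)"
  using square_integrable_add[OF _ square_integrable_uminus, of f g] by simp

lemma integrable_mult_cnj:
  assumes f: "square_integrable f" and g: "square_integrable g"
  shows "integrable circle (\<lambda>\<tau>. f \<tau> * cnj (g \<tau>))"
proof -
  have "integrable circle (\<lambda>\<tau>. (cmod (f \<tau>))\<^sup>2 + (cmod (g \<tau>))\<^sup>2)"
    using f g by (auto simp: square_integrable_def)
  then show ?thesis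
  proof (rule Bochner_Integration.integrable_bound)
    have [measurable]: "f \<in> borel_measurable circle" "g \<in> borel_measurable circle"
      using f g by (auto simp: square_integrable_def)
    have [measurable]: "(\<lambda>\<tau>. cnj (g \<tau>)) \<in> borel_measurable circle"
      by (rule measurable_compose[OF _ borel_measurable_continuous_onI])
         (auto intro!: continuous_intros)
    show "(\<lambda>\<tau>. f \<tau> * cnj (g \<tau>)) \<in> borel_measurable circle" by measurable
    have "cmod a * cmod b \<le> (cmod a)\<^sup>2 + (cmod b)\<^sup>2" for a b
    proof -
      have "2 * (cmod a * cmod b) \<le> (cmod a)\<^sup>2 + (cmod b)\<^sup>2"
        using zero_le_power2[of "cmod a - cmod b"] unfolding power2_diff by linarith
      moreover have "0 \<le> cmod a * cmod b" by simp
      ultimately show ?thesis by linarith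
    qed
    then show "AE \<tau> in circle. norm (f \<tau> * cnj (g \<tau>)) \<le> norm ((cmod (f \<tau>))\<^sup>2 + (cmod (g \<tau>))\<^sup>2)"
      by (auto intro!: AE_I2 simp: norm_mult)
  qed
qed

lemma integrable_square_integrable:
  assumes "square_integrable f"
  shows "integrable circle f"
proof -
  have "square_integrable (\<lambda>_. 1)" by (simp add: square_integrable_def)
  from integrable_mult_cnj[OF assms this] show ?thesis by simp
qed

text \<open>The space \<open>L\<^sup>2\<close> consists of the square integrable functions up to equality almost
  everywhere. Its real inner product is the real part of the usual complex one.\<close>

definition L2_eq :: "(complex \<Rightarrow> complex) \<Rightarrow> (complex \<Rightarrow> complex) \<Rightarrow> bool" where
  "L2_eq f g \<longleftrightarrow> square_integrable f \<and> square_integrable g \<and> (AE \<tau> in circle. f \<tau> = g \<tau>)"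

quotient_type circle_L2 = "complex \<Rightarrow> complex" / partial: L2_eq
proof (rule part_equivpI)
  show "\<exists>f. L2_eq f f" by (intro exI[of _ "\<lambda>_. 0"]) (simp add: L2_eq_def)
  show "symp L2_eq" by (auto simp: symp_def L2_eq_def)
  show "transp L2_eq" by (auto simp: transp_def L2_eq_def)
qed

instantiation circle_L2 :: real_inner
begin

lift_definition zero_circle_L2 :: circle_L2 is "\<lambda>_. 0"
  by (simp add: L2_eq_def)

lift_definition plus_circle_L2 :: "circle_L2 \<Rightarrow> circle_L2 \<Rightarrow> circle_L2"
  is "\<lambda>f g \<tau>. f \<tau> + g \<tau>"
  by (auto simp: L2_eq_def square_integrable_add)

lift_definition uminus_circle_L2 :: "circle_L2 \<Rightarrow> circle_L2" is "\<lambda>f \<tau>. - f \<tau>"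
  by (auto simp: L2_eq_def square_integrable_uminus)

lift_definition minus_circle_L2 :: "circle_L2 \<Rightarrow> circle_L2 \<Rightarrow> circle_L2"
  is "\<lambda>f g \<tau>. f \<tau> - g \<tau>"
  by (auto simp: L2_eq_def square_integrable_diff)

lift_definition scaleR_circle_L2 :: "real \<Rightarrow> circle_L2 \<Rightarrow> circle_L2"
  is "\<lambda>r f \<tau>. complex_of_real r * f \<tau>"
  by (auto simp: L2_eq_def square_integrable_cmult)

lift_definition inner_circle_L2 :: "circle_L2 \<Rightarrow> circle_L2 \<Rightarrow> real"
  is "\<lambda>f g. Re (integral\<^sup>L circle (\<lambda>\<tau>. f \<tau> * cnj (g \<tau>)))"
proof -
  fix f f' g g'
  assume *: "L2_eq f f'" "L2_eq g g'"
  have "integral\<^sup>L circle (\<lambda>\<tau>. f \<tau> * cnj (g \<tau>)) = integral\<^sup>L circle (\<lambda>\<tau>. f' \<tau> * cnj (g' \<tau>))"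
  proof (rule integral_cong_AE)
    show "(\<lambda>\<tau>. f \<tau> * cnj (g \<tau>)) \<in> borel_measurable circle"
      "(\<lambda>\<tau>. f' \<tau> * cnj (g' \<tau>)) \<in> borel_measurable circle"
      using * integrable_mult_cnj by (auto simp: L2_eq_def)
    show "AE \<tau> in circle. f \<tau> * cnj (g \<tau>) = f' \<tau> * cnj (g' \<tau>)"
      using * by (auto simp: L2_eq_def)
  qed
  then show "Re (integral\<^sup>L circle (\<lambda>\<tau>. f \<tau> * cnj (g \<tau>))) =
      Re (integral\<^sup>L circle (\<lambda>\<tau>. f' \<tau> * cnj (g' \<tau>)))" by simp
qed

definition norm_circle_L2 :: "circle_L2 \<Rightarrow> real" where
  "norm_circle_L2 f = sqrt (inner f f)"

definition dist_circle_L2 :: "circle_L2 \<Rightarrow> circle_L2 \<Rightarrow> real" where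
  "dist_circle_L2 f g = norm (f - g)"

definition sgn_circle_L2 :: "circle_L2 \<Rightarrow> circle_L2" where
  "sgn_circle_L2 f = inverse (norm f) *\<^sub>R f"

definition uniformity_circle_L2 :: "(circle_L2 \<times> circle_L2) filter" where
  "uniformity_circle_L2 = (INF e\<in>{0<..}. principal {(f, g). dist f g < e})"

definition open_circle_L2 :: "circle_L2 set \<Rightarrow> bool" where
  "open_circle_L2 U \<longleftrightarrow> (\<forall>f\<in>U. eventually (\<lambda>(f', g). f' = f \<longrightarrow> g \<in> U) uniformity)"

instance
proof
  fix f g h :: circle_L2 and r s :: real
  note sq = L2_eq_def square_integrable_add square_integrable_cmult square_integrable_uminus
    square_integrable_diff
  show "f + g + h = f + (g + h)" by transfer (simp add: sq add.assoc)
  show "f + g = g + f" by transfer (simp add: sq add.commute)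
  show "0 + f = f" by transfer simp
  show "- f + f = 0" by transfer (simp add: sq)
  show "f - g = f + - g" by transfer (simp add: sq)
  show "r *\<^sub>R (f + g) = r *\<^sub>R f + r *\<^sub>R g" by transfer (simp add: sq ring_distribs)
  show "(r + s) *\<^sub>R f = r *\<^sub>R f + s *\<^sub>R f" by transfer (simp add: sq ring_distribs)
  show "r *\<^sub>R s *\<^sub>R f = (r * s) *\<^sub>R f" by transfer (simp add: sq mult.assoc)
  show "1 *\<^sub>R f = f" by transfer simp
  show "inner f g = inner g f"
  proof transfer
    fix f g
    show "Re (integral\<^sup>L circle (\<lambda>\<tau>. f \<tau> * cnj (g \<tau>))) =
        Re (integral\<^sup>L circle (\<lambda>\<tau>. g \<tau> * cnj (f \<tau>)))"
      using Bochner_Integration.integral_cnj[of circle "\<lambda>\<tau>. g \<tau> * cnj (f \<tau>)"]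
      by (simp add: mult.commute)
  qed
  show "inner (f + g) h = inner f h + inner g h"
    by transfer (simp add: L2_eq_def ring_distribs integrable_mult_cnj)
  show "inner (r *\<^sub>R f) g = r * inner f g"
    by transfer (simp add: mult.assoc)
  have Re_sq: "Re (integral\<^sup>L circle (\<lambda>\<tau>. f \<tau> * cnj (f \<tau>))) = integral\<^sup>L circle (\<lambda>\<tau>. (cmod (f \<tau>))\<^sup>2)"
    for f :: "complex \<Rightarrow> complex"
    by (simp flip: complex_norm_square of_real_power)
  show "0 \<le> inner f f"
    by transfer (simp add: Re_sq)
  show "inner f f = 0 \<longleftrightarrow> f = 0"
  proof transfer
    fix f assume "L2_eq f f"
    then have "integrable circle (\<lambda>\<tau>. (cmod (f \<tau>))\<^sup>2)" "square_integrable f"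
      by (auto simp: L2_eq_def square_integrable_def)
    then show "Re (integral\<^sup>L circle (\<lambda>\<tau>. f \<tau> * cnj (f \<tau>))) = 0 \<longleftrightarrow> L2_eq f (\<lambda>_. 0)"
      by (simp add: Re_sq integral_nonneg_eq_0_iff_AE L2_eq_def)
  qed
qed (simp_all add: norm_circle_L2_def dist_circle_L2_def sgn_circle_L2_def
      uniformity_circle_L2_def open_circle_L2_def)

end

lemma norm_circle_L2:
  assumes "square_integrable f"
  shows "norm (abs_circle_L2 f) = sqrt (integral\<^sup>L circle (\<lambda>\<tau>. (cmod (f \<tau>))\<^sup>2))"
proof -
  have "L2_eq f f" using assms by (simp add: L2_eq_def)
  then show ?thesis
    unfolding norm_circle_L2_def
    by (simp add: inner_circle_L2.abs_eq flip: complex_norm_square of_real_power)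
qed

lemma abs_circle_L2_cases:
  obtains f where "square_integrable f" "F = abs_circle_L2 f"
  by (metis L2_eq_def Quotient3_abs_rep Quotient3_circle_L2 Quotient3_rep_reflp)

lemma abs_circle_L2_diff:
  assumes "square_integrable f" "square_integrable g"
  shows "abs_circle_L2 f - abs_circle_L2 g = abs_circle_L2 (\<lambda>\<tau>. f \<tau> - g \<tau>)"
  using assms by (intro minus_circle_L2.abs_eq) (auto simp: L2_eq_def)

lemma L1_le_L2:
  assumes f: "square_integrable f"
  shows "integral\<^sup>L circle (\<lambda>\<tau>. cmod (f \<tau>)) \<le> norm (abs_circle_L2 f)"
proof -
  define m where "m = integral\<^sup>L circle (\<lambda>\<tau>. cmod (f \<tau>))"
  have i1: "integrable circle (\<lambda>\<tau>. cmod (f \<tau>))"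
    using integrable_square_integrable[OF f] by simp
  have i2: "integrable circle (\<lambda>\<tau>. (cmod (f \<tau>))\<^sup>2)"
    using f by (simp add: square_integrable_def)
  have "0 \<le> integral\<^sup>L circle (\<lambda>\<tau>. (cmod (f \<tau>) - m)\<^sup>2)"
    by simp
  also have "\<dots> = integral\<^sup>L circle (\<lambda>\<tau>. (cmod (f \<tau>))\<^sup>2 + m\<^sup>2 - 2 * m * cmod (f \<tau>))"
    by (simp add: power2_diff mult_ac)
  also have "\<dots> = integral\<^sup>L circle (\<lambda>\<tau>. (cmod (f \<tau>))\<^sup>2) + m\<^sup>2 - 2 * m * m"
    using i1 i2 by (simp add: m_def)
  finally have "m\<^sup>2 \<le> integral\<^sup>L circle (\<lambda>\<tau>. (cmod (f \<tau>))\<^sup>2)"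
    by (simp add: power2_eq_square)
  then show ?thesis
    unfolding norm_circle_L2[OF f] m_def by (rule real_le_rsqrt)
qed

instantiation circle_L2 :: complex_banach
begin

lift_definition scaleC_circle_L2 :: "complex \<Rightarrow> circle_L2 \<Rightarrow> circle_L2"
  is "\<lambda>c f \<tau>. c * f \<tau>"
  by (auto simp: L2_eq_def square_integrable_cmult)

instance
proof
  fix f g :: circle_L2 and c d :: complex and r :: real
  note sq = L2_eq_def square_integrable_add square_integrable_cmult
  show "c *\<^sub>C (f + g) = c *\<^sub>C f + c *\<^sub>C g" by transfer (simp add: sq ring_distribs)
  show "(c + d) *\<^sub>C f = c *\<^sub>C f + d *\<^sub>C f" by transfer (simp add: sq ring_distribs)
  show "c *\<^sub>C d *\<^sub>C f = (c * d) *\<^sub>C f" by transfer (simp add: sq mult.assoc)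
  show "r *\<^sub>R f = complex_of_real r *\<^sub>C f" by transfer (simp add: sq)
  show "norm (c *\<^sub>C f) = cmod c * norm f"
  proof (cases f rule: abs_circle_L2_cases)
    case (1 h)
    then have "c *\<^sub>C f = abs_circle_L2 (\<lambda>\<tau>. c * h \<tau>)"
      by (simp add: scaleC_circle_L2.abs_eq L2_eq_def)
    then show ?thesis
      using 1 by (simp add: norm_circle_L2 square_integrable_cmult norm_mult power_mult_distrib
          real_sqrt_mult)
  qed
next
  fix X :: "nat \<Rightarrow> circle_L2"
  assume X: "Cauchy X"
  have "\<exists>N. \<forall>m\<ge>N. \<forall>n\<ge>N. norm (X m - X n) < (1/2) ^ k" for k
    using CauchyD[OF X, of "(1/2) ^ k"] by simp
  then obtain N where N: "\<And>k m n. m \<ge> N k \<Longrightarrow> n \<ge> N k \<Longrightarrow> norm (X m - X n) < (1/2) ^ k"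
    by metis
  define r where "r = rec_nat (N 0) (\<lambda>k m. max (Suc m) (N (Suc k)))"
  have r_Suc: "r (Suc k) = max (Suc (r k)) (N (Suc k))" for k
    by (simp add: r_def)
  have r_mono: "strict_mono r"
    by (rule strict_monoI_Suc) (simp add: r_Suc)
  have r_N: "r k \<ge> N k" for k
    by (cases k) (auto simp: r_Suc, simp add: r_def)
  have r: "norm (X (r m) - X (r k)) \<le> (1/2) ^ k" if "m \<ge> k" for m k
    using N[of k "r m" "r k"] r_N[of k] strict_mono_leD[OF r_mono that] by simp
  have "\<forall>k. \<exists>h. square_integrable h \<and> X (r k) = abs_circle_L2 h"
    using abs_circle_L2_cases by metis
  then obtain g where g: "\<And>k. square_integrable (g k)" and Xg: "\<And>k. X (r k) = abs_circle_L2 (g k)"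
    by metis
  have [measurable]: "g k \<in> borel_measurable circle" for k
    using g by (simp add: square_integrable_def)
  have gd: "square_integrable (\<lambda>\<tau>. g m \<tau> - g k \<tau>)" for m k
    using g by (simp add: square_integrable_diff)
  have norm_gd: "X (r m) - X (r k) = abs_circle_L2 (\<lambda>\<tau>. g m \<tau> - g k \<tau>)" for m k
    by (simp add: Xg abs_circle_L2_diff g)

  have "(\<integral>\<^sup>+\<tau>. (\<Sum>k. ennreal (cmod (g (Suc k) \<tau> - g k \<tau>))) \<partial>circle)
      = (\<Sum>k. \<integral>\<^sup>+\<tau>. ennreal (cmod (g (Suc k) \<tau> - g k \<tau>)) \<partial>circle)"
    by (rule nn_integral_suminf) simp
  also have "\<dots> \<le> (\<Sum>k. ennreal ((1/2) ^ k))"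
  proof (intro suminf_le summableI)
    fix k
    have "(\<integral>\<^sup>+\<tau>. ennreal (cmod (g (Suc k) \<tau> - g k \<tau>)) \<partial>circle)
        = ennreal (integral\<^sup>L circle (\<lambda>\<tau>. cmod (g (Suc k) \<tau> - g k \<tau>)))"
      using integrable_square_integrable[OF gd] by (intro nn_integral_eq_integral) auto
    also have "\<dots> \<le> ennreal ((1/2) ^ k)"
      using L1_le_L2[OF gd, of "Suc k" k] r[of k "Suc k"] norm_gd[of "Suc k" k]
      by (intro ennreal_leI) simp
    finally show "(\<integral>\<^sup>+\<tau>. ennreal (cmod (g (Suc k) \<tau> - g k \<tau>)) \<partial>circle) \<le> ennreal ((1/2) ^ k)" .
  qed
  also have "\<dots> < \<infinity>"
    by (subst suminf_ennreal2) auto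
  finally have "AE \<tau> in circle. (\<Sum>k. ennreal (cmod (g (Suc k) \<tau> - g k \<tau>))) \<noteq> \<infinity>"
    by (intro nn_integral_PInf_AE) auto
  then have conv: "AE \<tau> in circle. convergent (\<lambda>k. g k \<tau>)"
  proof eventually_elim
    case (elim \<tau>)
    then have "summable (\<lambda>k. cmod (g (Suc k) \<tau> - g k \<tau>))"
      by (intro summable_suminf_not_top) auto
    then have "summable (\<lambda>k. g (Suc k) \<tau> - g k \<tau>)"
      by (rule summable_norm_cancel)
    then have "convergent (\<lambda>n. \<Sum>k<n. g (Suc k) \<tau> - g k \<tau>)"
      by (simp add: summable_iff_convergent)
    then have "convergent (\<lambda>n. g n \<tau> - g 0 \<tau>)"
      by (simp add: sum_lessThan_telescope[of "\<lambda>k. g k \<tau>"])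
    from convergent_add[OF this convergent_const[of "g 0 \<tau>"]] show ?case by simp
  qed

  define f where "f \<tau> = lim (\<lambda>k. g k \<tau>)" for \<tau>
  have f_meas [measurable]: "f \<in> borel_measurable circle"
    unfolding f_def by measurable
  have bound: "(\<integral>\<^sup>+\<tau>. ennreal ((cmod (f \<tau> - g k \<tau>))\<^sup>2) \<partial>circle) \<le> ennreal (((1/2) ^ k)\<^sup>2)" for k
  proof -
    have "(\<integral>\<^sup>+\<tau>. ennreal ((cmod (f \<tau> - g k \<tau>))\<^sup>2) \<partial>circle)
        = (\<integral>\<^sup>+\<tau>. liminf (\<lambda>m. ennreal ((cmod (g m \<tau> - g k \<tau>))\<^sup>2)) \<partial>circle)"
    proof (rule nn_integral_cong_AE, use conv in eventually_elim)
      case (elim \<tau>)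
      then have "(\<lambda>m. g m \<tau>) \<longlonglongrightarrow> f \<tau>"
        unfolding f_def by (simp add: convergent_LIMSEQ_iff)
      then have "(\<lambda>m. ennreal ((cmod (g m \<tau> - g k \<tau>))\<^sup>2)) \<longlonglongrightarrow> ennreal ((cmod (f \<tau> - g k \<tau>))\<^sup>2)"
        by (intro tendsto_intros)
      then show ?case
        using lim_imp_Liminf[OF trivial_limit_sequentially] by force
    qed
    also have "\<dots> \<le> liminf (\<lambda>m. \<integral>\<^sup>+\<tau>. ennreal ((cmod (g m \<tau> - g k \<tau>))\<^sup>2) \<partial>circle)"
      by (rule nn_integral_liminf) simp
    also have "\<dots> \<le> ennreal (((1/2) ^ k)\<^sup>2)"
    proof (rule Liminf_le)
      show "\<forall>\<^sub>F m in sequentially.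
          (\<integral>\<^sup>+\<tau>. ennreal ((cmod (g m \<tau> - g k \<tau>))\<^sup>2) \<partial>circle) \<le> ennreal (((1/2) ^ k)\<^sup>2)"
        using eventually_ge_at_top[of k]
      proof eventually_elim
        case (elim m)
        have "(\<integral>\<^sup>+\<tau>. ennreal ((cmod (g m \<tau> - g k \<tau>))\<^sup>2) \<partial>circle)
            = ennreal (integral\<^sup>L circle (\<lambda>\<tau>. (cmod (g m \<tau> - g k \<tau>))\<^sup>2))"
          using gd[of m k] by (intro nn_integral_eq_integral) (auto simp: square_integrable_def)
        also have "integral\<^sup>L circle (\<lambda>\<tau>. (cmod (g m \<tau> - g k \<tau>))\<^sup>2) = (norm (X (r m) - X (r k)))\<^sup>2"
          by (simp add: norm_gd norm_circle_L2[OF gd])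
        also have "ennreal \<dots> \<le> ennreal (((1/2) ^ k)\<^sup>2)"
          using r[OF elim] by (intro ennreal_leI power_mono) auto
        finally show ?case .
      qed
    qed simp
    finally show ?thesis .
  qed
  have fg: "square_integrable (\<lambda>\<tau>. f \<tau> - g k \<tau>)" for k
    unfolding square_integrable_def
  proof
    show "integrable circle (\<lambda>\<tau>. (cmod (f \<tau> - g k \<tau>))\<^sup>2)"
      by (rule integrableI_nonneg) (use bound[of k] le_less_trans[OF _ ennreal_less_top] in auto)
  qed simp
  have f: "square_integrable f"
    using square_integrable_add[OF fg[of 0] g[of 0]] by simp
  have "norm ((X \<circ> r) k - abs_circle_L2 f) \<le> (1/2) ^ k" for k
  proof -
    have "norm ((X \<circ> r) k - abs_circle_L2 f) = norm (abs_circle_L2 (\<lambda>\<tau>. f \<tau> - g k \<tau>))"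
      by (subst norm_minus_commute) (simp add: Xg f g abs_circle_L2_diff)
    also have "\<dots> = sqrt (integral\<^sup>L circle (\<lambda>\<tau>. (cmod (f \<tau> - g k \<tau>))\<^sup>2))"
      by (rule norm_circle_L2[OF fg])
    also have "\<dots> \<le> sqrt (((1/2) ^ k)\<^sup>2)"
    proof (rule real_sqrt_le_mono)
      have "ennreal (integral\<^sup>L circle (\<lambda>\<tau>. (cmod (f \<tau> - g k \<tau>))\<^sup>2))
          = (\<integral>\<^sup>+\<tau>. ennreal ((cmod (f \<tau> - g k \<tau>))\<^sup>2) \<partial>circle)"
        using fg[of k] by (intro nn_integral_eq_integral[symmetric]) (auto simp: square_integrable_def)
      also note bound
      finally show "integral\<^sup>L circle (\<lambda>\<tau>. (cmod (f \<tau> - g k \<tau>))\<^sup>2) \<le> ((1/2) ^ k)\<^sup>2"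
        by (subst (asm) ennreal_le_iff) auto
    qed
    finally show ?thesis by simp
  qed
  then have "(\<lambda>k. (X \<circ> r) k - abs_circle_L2 f) \<longlonglongrightarrow> 0"
    by (intro Lim_null_comparison[OF _ LIMSEQ_power_zero[of "1/2 :: real"]] always_eventually) auto
  then have "(X \<circ> r) \<longlonglongrightarrow> abs_circle_L2 f"
    by (rule LIM_zero_cancel)
  then show "convergent X"
    using Cauchy_converges_subseq[OF X r_mono] by (auto simp: o_def intro: convergentI)
qed

end


section \<open>The Hardy space and the Riesz projection\<close>

lemma borel_measurable_circle_powi [measurable]:
  "(\<lambda>\<tau>. \<tau> powi n) \<in> borel_measurable circle"
  by (intro borel_measurable_circle_continuous continuous_intros) auto

lift_definition fourier_coeff :: "circle_L2 \<Rightarrow> int \<Rightarrow> complex"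
  is "\<lambda>f n. integral\<^sup>L circle (\<lambda>\<tau>. f \<tau> * \<tau> powi (-n))"
proof -
  fix f g assume "L2_eq f g"
  then have fg: "f \<in> borel_measurable circle" "g \<in> borel_measurable circle" "AE \<tau> in circle. f \<tau> = g \<tau>"
    by (auto simp: L2_eq_def square_integrable_def)
  then show "(\<lambda>n. integral\<^sup>L circle (\<lambda>\<tau>. f \<tau> * \<tau> powi (-n))) =
      (\<lambda>n. integral\<^sup>L circle (\<lambda>\<tau>. g \<tau> * \<tau> powi (-n)))"
    by (intro ext integral_cong_AE) (auto simp del: power_int_minus)
qed

lemma integrable_fourier:
  assumes "square_integrable f"
  shows "integrable circle (\<lambda>\<tau>. f \<tau> * \<tau> powi n)"
  by (rule Bochner_Integration.integrable_bound[OF integrable_square_integrable[OF assms]])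
     (use assms in \<open>auto simp: square_integrable_def norm_mult norm_power_int intro!: AE_I2\<close>)

lemma fourier_coeff_abs:
  "square_integrable f \<Longrightarrow>
    fourier_coeff (abs_circle_L2 f) n = integral\<^sup>L circle (\<lambda>\<tau>. f \<tau> * \<tau> powi (-n))"
  by (simp add: fourier_coeff.abs_eq L2_eq_def)

lemma fourier_coeff_add: "fourier_coeff (f + g) n = fourier_coeff f n + fourier_coeff g n"
  by transfer (simp add: L2_eq_def ring_distribs integrable_fourier)

lemma fourier_coeff_scaleC: "fourier_coeff (c *\<^sub>C f) n = c * fourier_coeff f n"
  by transfer (simp add: mult.assoc)

lemma fourier_coeff_scaleR: "fourier_coeff (r *\<^sub>R f) n = r *\<^sub>R fourier_coeff f n"
  by (simp add: scaleR_scaleC fourier_coeff_scaleC scaleR_conv_of_real)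

lemma cmod_fourier_coeff_le: "cmod (fourier_coeff f n) \<le> norm f"
proof (cases f rule: abs_circle_L2_cases)
  case (1 h)
  have "cmod (fourier_coeff f n) \<le> integral\<^sup>L circle (\<lambda>\<tau>. cmod (h \<tau> * \<tau> powi (-n)))"
    unfolding 1(2) fourier_coeff_abs[OF 1(1)] by (rule integral_norm_bound)
  also have "\<dots> = integral\<^sup>L circle (\<lambda>\<tau>. cmod (h \<tau>))"
    by (intro Bochner_Integration.integral_cong) (auto simp: norm_mult norm_power_int)
  also have "\<dots> \<le> norm f"
    unfolding 1(2) by (rule L1_le_L2[OF 1(1)])
  finally show ?thesis .
qed

lemma bounded_linear_fourier_coeff: "bounded_linear (\<lambda>f. fourier_coeff f n)"
  by (rule bounded_linear_intro[where K=1])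
     (simp_all add: fourier_coeff_add fourier_coeff_scaleR cmod_fourier_coeff_le)

lemma square_integrable_monomial: "square_integrable (\<lambda>\<tau>. \<tau> ^ n)"
  by (rule square_integrable_bounded[where C=1])
     (auto intro!: borel_measurable_circle_continuous continuous_intros AE_I2 simp: norm_power)

lift_definition monomial_L2 :: "nat \<Rightarrow> circle_L2" is "\<lambda>n \<tau>. \<tau> ^ n"
  by (simp add: L2_eq_def square_integrable_monomial)

lemma fourier_coeff_monomial: "fourier_coeff (monomial_L2 k) n = (if n = int k then 1 else 0)"
proof -
  have "fourier_coeff (monomial_L2 k) n = integral\<^sup>L circle (\<lambda>\<tau>. \<tau> ^ k * \<tau> powi (-n))"
    by transfer simp
  also have "\<dots> = integral\<^sup>L circle (\<lambda>\<tau>. \<tau> powi (int k - n))"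
  proof (intro Bochner_Integration.integral_cong refl)
    fix \<tau> :: complex assume "\<tau> \<in> space circle"
    then have "\<tau> \<noteq> 0" by auto
    then show "\<tau> ^ k * \<tau> powi (-n) = \<tau> powi (int k - n)"
      by (simp add: power_int_diff power_int_minus divide_inverse)
  qed
  also have "\<dots> = (if n = int k then 1 else 0)"
    by (auto simp: integral_circle_powi)
  finally show ?thesis .
qed

lemma inner_monomial: "inner f (c *\<^sub>C monomial_L2 k) = Re (cnj c * fourier_coeff f (int k))"
proof transfer
  fix f c k
  have "integral\<^sup>L circle (\<lambda>\<tau>. f \<tau> * cnj (c * \<tau> ^ k)) =
      integral\<^sup>L circle (\<lambda>\<tau>. cnj c * (f \<tau> * \<tau> powi (- int k)))"
  proof (intro Bochner_Integration.integral_cong refl)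
    fix \<tau> :: complex assume "\<tau> \<in> space circle"
    then have "cnj \<tau> = inverse \<tau>"
      using divide_conv_cnj[of \<tau> 1] by (simp add: inverse_eq_divide)
    then show "f \<tau> * cnj (c * \<tau> ^ k) = cnj c * (f \<tau> * \<tau> powi (- int k))"
      by (simp add: power_int_minus power_inverse)
  qed
  then show "Re (integral\<^sup>L circle (\<lambda>\<tau>. f \<tau> * cnj (c * \<tau> ^ k))) =
      Re (cnj c * integral\<^sup>L circle (\<lambda>\<tau>. f \<tau> * \<tau> powi (- int k)))" by simp
qed

text \<open>The Riesz projection cuts the Fourier series of \<open>f\<close> off below the index 0; the series
  converges in the norm of \<open>L\<^sup>2\<close> by Bessel's inequality.\<close>

definition riesz_sum :: "circle_L2 \<Rightarrow> circle_L2" where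
  "riesz_sum f = (\<Sum>n. fourier_coeff f (int n) *\<^sub>C monomial_L2 n)"

lemma Re_cnj_mult_self: "Re c * Re c + Im c * Im c = (cmod c)\<^sup>2"
  unfolding cmod_power2 by (simp add: power2_eq_square)

lemma bessel: "(\<Sum>k<n. (cmod (fourier_coeff f (int k)))\<^sup>2) \<le> (norm f)\<^sup>2"
proof -
  define e where "e k = fourier_coeff f (int k) *\<^sub>C monomial_L2 k" for k
  have ip: "inner (e j) (e k) = (if j = k then (cmod (fourier_coeff f (int k)))\<^sup>2 else 0)" for j k
    unfolding e_def inner_monomial fourier_coeff_scaleC fourier_coeff_monomial
    by (auto simp: Re_cnj_mult_self)
  have fe: "inner f (e k) = (cmod (fourier_coeff f (int k)))\<^sup>2" for k
    unfolding e_def inner_monomial by (auto simp: Re_cnj_mult_self)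
  have "0 \<le> inner (f - sum e {..<n}) (f - sum e {..<n})"
    by simp
  also have "\<dots> = inner f f - 2 * inner f (sum e {..<n}) + inner (sum e {..<n}) (sum e {..<n})"
    by (simp add: inner_diff_left inner_diff_right inner_commute)
  also have "inner f (sum e {..<n}) = (\<Sum>k<n. (cmod (fourier_coeff f (int k)))\<^sup>2)"
    by (simp add: inner_sum_right fe)
  also have "inner (sum e {..<n}) (sum e {..<n}) = (\<Sum>k<n. (cmod (fourier_coeff f (int k)))\<^sup>2)"
    by (simp add: inner_sum_left inner_sum_right ip)
  finally show ?thesis
    by (simp add: power2_norm_eq_inner)
qed

lemma summable_riesz: "summable (\<lambda>n. fourier_coeff f (int n) *\<^sub>C monomial_L2 n)"
proof -
  define e where "e k = fourier_coeff f (int k) *\<^sub>C monomial_L2 k" for k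
  let ?a = "\<lambda>k. (cmod (fourier_coeff f (int k)))\<^sup>2"
  have ip: "inner (e j) (e k) = (if j = k then ?a k else 0)" for j k
    unfolding e_def inner_monomial fourier_coeff_scaleC fourier_coeff_monomial
    by (auto simp: Re_cnj_mult_self)
  have sq: "(norm (sum e A))\<^sup>2 = sum ?a A" if "finite A" for A
    using that by (simp add: power2_norm_eq_inner inner_sum_left inner_sum_right ip)
  have "summable ?a"
    by (rule summableI_nonneg_bounded[OF _ bessel]) simp
  have "summable e"
    unfolding summable_Cauchy
  proof (intro allI impI)
    fix \<epsilon> :: real assume "\<epsilon> > 0"
    then have "\<epsilon>\<^sup>2 > 0" by simp
    with \<open>summable ?a\<close> obtain N where N: "\<And>m n. m \<ge> N \<Longrightarrow> norm (sum ?a {m..<n}) < \<epsilon>\<^sup>2"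
      unfolding summable_Cauchy by meson
    have "norm (sum e {m..<n}) < \<epsilon>" if "m \<ge> N" for m n
    proof (rule power_less_imp_less_base)
      show "(norm (sum e {m..<n}))\<^sup>2 < \<epsilon>\<^sup>2"
        using N[OF that, of n] by (simp add: sq)
    qed (use \<open>\<epsilon> > 0\<close> in simp)
    then show "\<exists>N. \<forall>m\<ge>N. \<forall>n. norm (sum e {m..<n}) < \<epsilon>" by blast
  qed
  then show ?thesis by (simp add: e_def[abs_def])
qed

lemma fourier_coeff_riesz_sum:
  "fourier_coeff (riesz_sum f) n = (if n \<ge> 0 then fourier_coeff f n else 0)"
proof -
  have "fourier_coeff (riesz_sum f) n
      = (\<Sum>k. fourier_coeff (fourier_coeff f (int k) *\<^sub>C monomial_L2 k) n)"
    unfolding riesz_sum_def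
    by (rule bounded_linear.suminf[OF bounded_linear_fourier_coeff summable_riesz])
  also have "\<dots> = (\<Sum>k. if k = nat n \<and> n \<ge> 0 then fourier_coeff f n else 0)"
    by (intro suminf_cong) (auto simp: fourier_coeff_scaleC fourier_coeff_monomial)
  also have "\<dots> = (if n \<ge> 0 then fourier_coeff f n else 0)"
    using suminf_finite[of "{nat n}" "\<lambda>k. if k = nat n \<and> n \<ge> 0 then fourier_coeff f n else 0"]
    by auto
  finally show ?thesis .
qed

text \<open>The Hardy space, identified through boundary values with the closed subspace of \<open>L\<^sup>2\<close>
  of the functions whose Fourier coefficients of negative index vanish.\<close>

typedef hardy2 = "{f :: circle_L2. \<forall>n<0. fourier_coeff f n = 0}"
proof
  show "0 \<in> {f :: circle_L2. \<forall>n<0. fourier_coeff f n = 0}"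
    using bounded_linear.linear[OF bounded_linear_fourier_coeff, THEN linear_0] by simp
qed

setup_lifting type_definition_hardy2

instantiation hardy2 :: real_inner
begin

lift_definition zero_hardy2 :: hardy2 is 0
  using bounded_linear.linear[OF bounded_linear_fourier_coeff, THEN linear_0] by simp

lift_definition plus_hardy2 :: "hardy2 \<Rightarrow> hardy2 \<Rightarrow> hardy2" is "(+)"
  by (simp add: fourier_coeff_add)

lift_definition uminus_hardy2 :: "hardy2 \<Rightarrow> hardy2" is uminus
  by (simp add: linear_neg[OF bounded_linear.linear[OF bounded_linear_fourier_coeff]])

lift_definition minus_hardy2 :: "hardy2 \<Rightarrow> hardy2 \<Rightarrow> hardy2" is "(-)"
  by (simp add: linear_diff[OF bounded_linear.linear[OF bounded_linear_fourier_coeff]])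

lift_definition scaleR_hardy2 :: "real \<Rightarrow> hardy2 \<Rightarrow> hardy2" is "(*\<^sub>R)"
  by (simp add: fourier_coeff_scaleR)

lift_definition inner_hardy2 :: "hardy2 \<Rightarrow> hardy2 \<Rightarrow> real" is inner .

lift_definition norm_hardy2 :: "hardy2 \<Rightarrow> real" is norm .

lift_definition dist_hardy2 :: "hardy2 \<Rightarrow> hardy2 \<Rightarrow> real" is dist .

definition sgn_hardy2 :: "hardy2 \<Rightarrow> hardy2" where
  "sgn_hardy2 f = inverse (norm f) *\<^sub>R f"

definition uniformity_hardy2 :: "(hardy2 \<times> hardy2) filter" where
  "uniformity_hardy2 = (INF e\<in>{0<..}. principal {(f, g). dist f g < e})"

definition open_hardy2 :: "hardy2 set \<Rightarrow> bool" where
  "open_hardy2 U \<longleftrightarrow> (\<forall>f\<in>U. eventually (\<lambda>(f', g). f' = f \<longrightarrow> g \<in> U) uniformity)"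

instance
proof
  fix f g h :: hardy2 and r s :: real
  show "f + g + h = f + (g + h)" by transfer (simp add: add.assoc)
  show "f + g = g + f" by transfer (simp add: add.commute)
  show "0 + f = f" by transfer simp
  show "- f + f = 0" by transfer simp
  show "f - g = f + - g" by transfer simp
  show "r *\<^sub>R (f + g) = r *\<^sub>R f + r *\<^sub>R g" by transfer (simp add: scaleR_add_right)
  show "(r + s) *\<^sub>R f = r *\<^sub>R f + s *\<^sub>R f" by transfer (simp add: scaleR_add_left)
  show "r *\<^sub>R s *\<^sub>R f = (r * s) *\<^sub>R f" by transfer simp
  show "1 *\<^sub>R f = f" by transfer simp
  show "dist f g = norm (f - g)" by transfer (rule dist_norm)
  show "inner f g = inner g f" by transfer (rule inner_commute)
  show "inner (f + g) h = inner f h + inner g h" by transfer (rule inner_add_left)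
  show "inner (r *\<^sub>R f) g = r * inner f g" by transfer simp
  show "0 \<le> inner f f" by transfer simp
  show "inner f f = 0 \<longleftrightarrow> f = 0" by transfer simp
  show "norm f = sqrt (inner f f)" by transfer (rule norm_eq_sqrt_inner)
qed (simp_all add: sgn_hardy2_def uniformity_hardy2_def open_hardy2_def)

end

instantiation hardy2 :: complex_banach
begin

lift_definition scaleC_hardy2 :: "complex \<Rightarrow> hardy2 \<Rightarrow> hardy2" is "(*\<^sub>C)"
  by (simp add: fourier_coeff_scaleC)

instance
proof
  fix f g :: hardy2 and c d :: complex and r :: real
  show "c *\<^sub>C (f + g) = c *\<^sub>C f + c *\<^sub>C g" by transfer (rule scaleC_add_right)
  show "(c + d) *\<^sub>C f = c *\<^sub>C f + d *\<^sub>C f" by transfer (rule scaleC_add_left)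
  show "c *\<^sub>C d *\<^sub>C f = (c * d) *\<^sub>C f" by transfer (rule scaleC_scaleC)
  show "r *\<^sub>R f = complex_of_real r *\<^sub>C f" by transfer (rule scaleR_scaleC)
  show "norm (c *\<^sub>C f) = cmod c * norm f" by transfer (rule norm_scaleC)
next
  fix X :: "nat \<Rightarrow> hardy2"
  assume "Cauchy X"
  then have "Cauchy (\<lambda>n. Rep_hardy2 (X n))"
    unfolding Cauchy_def dist_hardy2.rep_eq .
  then obtain f where f: "(\<lambda>n. Rep_hardy2 (X n)) \<longlonglongrightarrow> f"
    using Cauchy_convergent convergentD by blast
  have "fourier_coeff f n = 0" if "n < 0" for n
  proof -
    have "(\<lambda>k. fourier_coeff (Rep_hardy2 (X k)) n) \<longlonglongrightarrow> fourier_coeff f n"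
      by (rule bounded_linear.tendsto[OF bounded_linear_fourier_coeff f])
    moreover have "fourier_coeff (Rep_hardy2 (X k)) n = 0" for k
      using Rep_hardy2[of "X k"] that by simp
    ultimately show ?thesis by (simp add: LIMSEQ_const_iff)
  qed
  then have "Rep_hardy2 (Abs_hardy2 f) = f"
    by (intro Abs_hardy2_inverse) simp
  with f have "X \<longlonglongrightarrow> Abs_hardy2 f"
    by (simp add: tendsto_dist_iff[of X] tendsto_dist_iff[of _ f] dist_hardy2.rep_eq)
  then show "convergent X" by (rule convergentI)
qed

end

lift_definition riesz_proj :: "circle_L2 \<Rightarrow> hardy2" is riesz_sum
  by (simp add: fourier_coeff_riesz_sum)


section \<open>Toeplitz operators\<close>

definition circle_Linf :: "(complex \<Rightarrow> complex) set" where
  "circle_Linf =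
     {F. F \<in> borel_measurable circle \<and> (\<exists>C. AE \<tau> in circle. cmod (F \<tau>) \<le> C)}"

text \<open>For \<open>F\<close> in \<open>L\<^sup>\<infinity>\<close> the product does not depend on the chosen representative of \<open>f\<close>; see
  \<open>mult_L2_abs\<close>.\<close>

definition mult_L2 :: "(complex \<Rightarrow> complex) \<Rightarrow> circle_L2 \<Rightarrow> circle_L2" where
  "mult_L2 F f = abs_circle_L2 (\<lambda>\<tau>. F \<tau> * rep_circle_L2 f \<tau>)"

lemma square_integrable_mult:
  assumes "F \<in> circle_Linf" "square_integrable f"
  shows "square_integrable (\<lambda>\<tau>. F \<tau> * f \<tau>)"
proof -
  have [measurable]: "F \<in> borel_measurable circle" "f \<in> borel_measurable circle"
    using assms by (auto simp: circle_Linf_def square_integrable_def)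
  obtain C where "AE \<tau> in circle. cmod (F \<tau>) \<le> C"
    using assms(1) by (auto simp: circle_Linf_def)
  then have "AE \<tau> in circle. cmod (F \<tau> * f \<tau>) \<le> C * cmod (f \<tau>)"
    by eventually_elim (simp add: norm_mult mult_right_mono)
  then show ?thesis
    by (intro square_integrable_dominated[OF _ assms(2)]) simp_all
qed

lemma mult_L2_abs:
  assumes F: "F \<in> circle_Linf" and f: "square_integrable f"
  shows "mult_L2 F (abs_circle_L2 f) = abs_circle_L2 (\<lambda>\<tau>. F \<tau> * f \<tau>)"
proof -
  have "L2_eq (rep_circle_L2 (abs_circle_L2 f)) f"
    using f by (intro Quotient3_rep_abs[OF Quotient3_circle_L2]) (simp add: L2_eq_def)
  then have "L2_eq (\<lambda>\<tau>. F \<tau> * rep_circle_L2 (abs_circle_L2 f) \<tau>) (\<lambda>\<tau>. F \<tau> * f \<tau>)"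
    using square_integrable_mult[OF F] by (auto simp: L2_eq_def)
  then show ?thesis
    unfolding mult_L2_def by (rule Quotient3_rel_abs[OF Quotient3_circle_L2])
qed

definition toeplitz :: "(complex \<Rightarrow> complex) \<Rightarrow> hardy2 \<Rightarrow> hardy2" where
  "toeplitz F f = riesz_proj (mult_L2 F (Rep_hardy2 f))"

end

theory Submission
  imports Defs
begin

text \<open>
  Multiplying \<open>F\<close> by a nonzero constant multiplies \<open>T\<^sub>F\<close> by it, and a semigroup can be multiplied by
  \<open>t \<mapsto> c\<^sup>t\<close> for any branch of the power. So \<open>Re F \<ge> 0\<close> may be assumed, and then \<open>T = T\<^sub>F\<close> is accretive:
  \<open>Re \<langle>T f, f\<rangle>\<close> is the integral of \<open>Re F \<bar>f\<bar>\<^sup>2\<close>. The semigroup consists of the fractional powers of \<open>T\<close>.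

  A bounded accretive operator on a Hilbert space has the Cayley transform \<open>V = (1 - T) (1 + T)\<^sup>-\<^sup>1\<close>, a
  contraction, and \<open>T = (1 - V) (1 + V)\<^sup>-\<^sup>1\<close>, where \<open>1 + V\<close> is invertible. For \<open>t > 0\<close> the binomial series of
  \<open>(1 - z)\<^sup>t\<close> has absolutely summable coefficients, so \<open>(1 - V)\<^sup>t\<close> and \<open>(1 + V)\<^sup>t\<close> are given by norm convergent
  power series, and Vandermonde's identity is their semigroup law. Put \<open>T\<^sup>t = (1 - V)\<^sup>t (1 + V)\<^sup>-\<^sup>t\<close>. The factors
  are bounded uniformly for small \<open>t\<close>, and strong continuity at 0 holds on the range of \<open>1 - V\<close>, which is the
  range of \<open>T\<close>; hence it holds everywhere once \<open>T\<close> has dense range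
  (\<open>accretive_C0_embeddable\<close>).

  For an accretive operator a vector \<open>u\<close> orthogonal to the range is also in the kernel. For a Toeplitz
  operator these two conditions, tested against \<open>z\<^sup>n u\<close> with \<open>n \<ge> 0\<close>, say that all Fourier coefficients of
  \<open>F \<bar>u\<bar>\<^sup>2\<close> vanish, so that \<open>F \<bar>u\<bar>\<^sup>2 = 0\<close> almost everywhere. A nonzero function in the Hardy space vanishes
  only on a null set (\<open>hardy_nonzero_AE\<close>), so \<open>u = 0\<close> unless \<open>F = 0\<close> almost everywhere
  (\<open>toeplitz_kernel\<close>).

  There remains \<open>T\<^sub>F = 0\<close>. The zero operator is embedded in a nilpotent semigroup: the shift on the
  square integrable functions of the angle in \<open>[0, 2\<pi>)\<close>, run at such a speed that nothing is left
  at time 1. A bijection between the natural numbers and the integers, applied to the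
  indices of Fourier coefficients, carries this semigroup to the Hardy space
  (\<open>C0_embeddable_zero_hardy2\<close>).
\<close>

section \<open>Closed subspaces of Hilbert space and strong limits\<close>

text \<open>A minimising sequence for the distance from \<open>x\<close> to \<open>M\<close> is Cauchy by the parallelogram law, and
  minimality of the distance at its limit forces orthogonality.\<close>

lemma orthogonal_projection_exists:
  fixes M :: "'a::{real_inner, complete_space} set"
  assumes M: "subspace M" "closed M"
  obtains g where "g \<in> M" "\<And>y. y \<in> M \<Longrightarrow> inner (x - g) y = 0"
proof -
  define d where "d = Inf ((\<lambda>m. (norm (x - m))\<^sup>2) ` M)"
  have ne: "M \<noteq> {}" using subspace_0[OF M(1)] by auto
  have bdd: "bdd_below ((\<lambda>m. (norm (x - m))\<^sup>2) ` M)"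
    by (rule bdd_belowI[of _ 0]) auto
  have dle: "d \<le> (norm (x - m))\<^sup>2" if "m \<in> M" for m
    unfolding d_def using that bdd by (intro cInf_lower) auto
  have "\<exists>m\<in>M. (norm (x - m))\<^sup>2 < d + 1 / real (Suc n)" for n
    using cInf_lessD[of "(\<lambda>m. (norm (x - m))\<^sup>2) ` M" "d + 1 / real (Suc n)"] ne
    by (auto simp: d_def)
  then obtain m where mM: "\<And>n. m n \<in> M" and m: "\<And>n. (norm (x - m n))\<^sup>2 < d + 1 / real (Suc n)"
    by metis
  have par: "(norm (m i - m j))\<^sup>2 \<le> 2 / real (Suc i) + 2 / real (Suc j)" for i j
  proof -
    have "(1/2) *\<^sub>R (m i + m j) \<in> M"
      using mM M(1) by (simp add: subspace_add subspace_scale)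
    from dle[OF this] have "4 * d \<le> 4 * (norm (x - (1/2) *\<^sub>R (m i + m j)))\<^sup>2" by simp
    also have "\<dots> = 2 * (norm (x - m i))\<^sup>2 + 2 * (norm (x - m j))\<^sup>2 - (norm (m i - m j))\<^sup>2"
      by (simp add: power2_norm_eq_inner inner_diff_left inner_diff_right inner_add_left
          inner_add_right inner_commute field_simps)
    finally show ?thesis using m[of i] m[of j] by linarith
  qed
  have "Cauchy m"
  proof (rule metric_CauchyI)
    fix e :: real assume "e > 0"
    then have "e\<^sup>2 / 4 > 0" by simp
    then obtain N where N: "1 / real (Suc N) < e\<^sup>2 / 4"
      using nat_approx_posE by blast
    have small: "1 / real (Suc i) < e\<^sup>2 / 4" if "i \<ge> N" for i
    proof -
      have "1 / real (Suc i) \<le> 1 / real (Suc N)" using that by (simp add: field_simps)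
      with N show ?thesis by simp
    qed
    have "dist (m i) (m j) < e" if "i \<ge> N" "j \<ge> N" for i j
    proof -
      have "(norm (m i - m j))\<^sup>2 < e\<^sup>2"
        using par[of i j] small[OF that(1)] small[OF that(2)] by simp
      then show ?thesis
        unfolding dist_norm using \<open>e > 0\<close> by (simp add: power2_less_imp_less)
    qed
    then show "\<exists>N. \<forall>i\<ge>N. \<forall>j\<ge>N. dist (m i) (m j) < e" by blast
  qed
  then obtain g where g: "m \<longlonglongrightarrow> g"
    using Cauchy_convergent convergentD by blast
  have gM: "g \<in> M"
    using closed_sequentially[OF M(2) mM g] .
  have "(norm (x - g))\<^sup>2 \<le> d"
  proof (rule LIMSEQ_le)
    show "(\<lambda>n. (norm (x - m n))\<^sup>2) \<longlonglongrightarrow> (norm (x - g))\<^sup>2"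
      by (intro tendsto_intros g)
    show "(\<lambda>n. d + 1 / real (Suc n)) \<longlonglongrightarrow> d"
      using tendsto_add[OF tendsto_const[of d] LIMSEQ_inverse_real_of_nat]
      by (simp add: inverse_eq_divide)
    show "\<exists>N. \<forall>n\<ge>N. (norm (x - m n))\<^sup>2 \<le> d + 1 / real (Suc n)"
      using m less_imp_le by blast
  qed
  then have min: "(norm (x - g))\<^sup>2 \<le> (norm (x - z))\<^sup>2" if "z \<in> M" for z
    using dle[OF that] by linarith
  have "inner (x - g) y = 0" if y: "y \<in> M" for y
  proof (cases "y = 0")
    case False
    define s where "s = inner (x - g) y / inner y y"
    have yy: "inner y y > 0" using False by simp
    have "g + s *\<^sub>R y \<in> M" using gM y M(1) by (simp add: subspace_add subspace_scale)
    from min[OF this] have "0 \<le> s\<^sup>2 * inner y y - 2 * s * inner (x - g) y"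
      unfolding power2_norm_eq_inner
      by (simp add: inner_diff_left inner_diff_right inner_add_left
          inner_add_right inner_commute power2_eq_square algebra_simps)
    also have "\<dots> = - ((inner (x - g) y)\<^sup>2 / inner y y)"
      using yy by (simp add: s_def power2_eq_square field_simps)
    finally have "(inner (x - g) y)\<^sup>2 / inner y y \<le> 0" by simp
    then show ?thesis
      using yy by (simp add: divide_le_0_iff)
  qed simp
  with gM that show ?thesis by blast
qed

lemma subspace_closure:
  fixes M :: "'a::real_normed_vector set"
  assumes M: "subspace M"
  shows "subspace (closure M)"
proof (rule subspaceI)
  show "0 \<in> closure M" using subspace_0[OF M] closure_subset by blast
next
  fix x y assume "x \<in> closure M" "y \<in> closure M"
  then obtain u v where "\<And>n. u n \<in> M" "u \<longlonglongrightarrow> x" "\<And>n. v n \<in> M" "v \<longlonglongrightarrow> y"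
    unfolding closure_sequential by blast
  then show "x + y \<in> closure M"
    unfolding closure_sequential using tendsto_add[of u x sequentially v y] subspace_add[OF M]
    by (intro exI[of _ "\<lambda>n. u n + v n"]) simp
next
  fix c x assume "x \<in> closure M"
  then obtain u where "\<And>n. u n \<in> M" "u \<longlonglongrightarrow> x"
    unfolding closure_sequential by blast
  then show "c *\<^sub>R x \<in> closure M"
    unfolding closure_sequential using tendsto_scaleR[OF tendsto_const, of u x sequentially c] subspace_scale[OF M]
    by (intro exI[of _ "\<lambda>n. c *\<^sub>R u n"]) simp
qed

text \<open>A Lipschitz bound that is uniform in the parameter lets strong convergence pass to limits, so that
  strong continuity at 0 has to be checked on a dense set only.\<close>

lemma closed_strong_convergence:
  fixes A :: "real \<Rightarrow> 'a::real_normed_vector \<Rightarrow> 'a"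
  assumes lip: "\<And>t x y. 0 < t \<Longrightarrow> t \<le> 1 \<Longrightarrow> norm (A t x - A t y) \<le> K * norm (x - y)"
  shows "closed {x. ((\<lambda>t. norm (A t x - x)) \<longlongrightarrow> 0) (at_right 0)}" (is "closed ?D")
proof -
  have "x \<in> ?D" if x: "x \<in> closure ?D" for x
  proof -
    have "((\<lambda>t. norm (A t x - x)) \<longlongrightarrow> 0) (at_right 0)"
    proof (rule tendstoI)
      fix e :: real assume e: "e > 0"
      define k where "k = max K 0 + 1"
      have k: "k > 0" "K \<le> k" by (auto simp: k_def)
      have "e / (2 * (k + 1)) > 0" using e k by simp
      then obtain y where y: "y \<in> ?D" "dist y x < e / (2 * (k + 1))"
        using x unfolding closure_approachable by blast
      then have small: "(k + 1) * norm (x - y) < e / 2"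
        using k by (simp add: dist_norm norm_minus_commute field_simps)
      have "((\<lambda>t. norm (A t y - y)) \<longlongrightarrow> 0) (at_right 0)" using y(1) by blast
      then have "\<forall>\<^sub>F t in at_right 0. dist (norm (A t y - y)) 0 < e / 2"
        by (rule tendstoD) (use e in simp)
      moreover have "\<forall>\<^sub>F t::real in at_right 0. 0 < t \<and> t \<le> 1"
        unfolding eventually_at_right_field using zero_less_one less_imp_le by blast
      ultimately show "\<forall>\<^sub>F t in at_right 0. dist (norm (A t x - x)) 0 < e"
      proof eventually_elim
        case (elim t)
        have "norm (A t x - A t y) \<le> K * norm (x - y)" using elim by (intro lip) auto
        also have "\<dots> \<le> k * norm (x - y)" using k by (intro mult_right_mono) auto
        finally have 1: "norm (A t x - A t y) \<le> k * norm (x - y)" .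
        have "norm (A t x - x) = norm ((A t x - A t y) + (A t y - y) - (x - y))"
          by simp
        also have "\<dots> \<le> norm (A t x - A t y) + norm (A t y - y) + norm (x - y)"
          by (intro order_trans[OF norm_triangle_ineq4] add_right_mono norm_triangle_ineq)
        finally show ?case using 1 small elim by (simp add: distrib_right)
      qed
    qed
    then show ?thesis by blast
  qed
  then show ?thesis
    using closure_subset_eq by blast
qed

section \<open>Binomial coefficients\<close>

text \<open>The coefficients of the power series of \<open>(1 - z)\<^sup>t\<close>.\<close>

definition binom_coeff :: "real \<Rightarrow> nat \<Rightarrow> real" where
  "binom_coeff t n = (-1) ^ n * (t gchoose n)"

lemma binom_coeff_0 [simp]: "binom_coeff t 0 = 1"
  by (simp add: binom_coeff_def)

lemma binom_coeff_Suc: "binom_coeff t (Suc n) = binom_coeff t n * ((real n - t) / real (Suc n))"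
  by (simp add: binom_coeff_def gbinomial_prod_rev field_simps)

lemma sum_binom_coeff: "(\<Sum>k\<le>n. binom_coeff t k) = binom_coeff (t - 1) n"
  using gbinomial_sum_lower_neg[of t n] by (simp add: binom_coeff_def mult.commute)

lemma binom_coeff_convolution:
  "(\<Sum>i\<le>n. binom_coeff s i * binom_coeff t (n - i)) = binom_coeff (s + t) n"
proof -
  have "(\<Sum>i\<le>n. binom_coeff s i * binom_coeff t (n - i))
      = (\<Sum>i\<le>n. (-1) ^ n * ((s gchoose i) * (t gchoose (n - i))))"
  proof (rule sum.cong[OF refl])
    fix i assume "i \<in> {..n}"
    then have "(-1::real) ^ n = (-1) ^ i * (-1) ^ (n - i)"
      by (simp flip: power_add)
    then show "binom_coeff s i * binom_coeff t (n - i)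
        = (-1) ^ n * ((s gchoose i) * (t gchoose (n - i)))"
      by (simp add: binom_coeff_def)
  qed
  then show ?thesis
    using gbinomial_Vandermonde[of s t n]
    by (simp add: binom_coeff_def atLeast0AtMost flip: sum_distrib_left)
qed

lemma binom_coeff_1: "binom_coeff 1 n = (if n = 0 then 1 else if n = 1 then -1 else 0)"
proof (induction n)
  case (Suc n)
  then show ?case by (auto simp: binom_coeff_Suc)
qed simp

lemma binom_coeff_nonneg: "t \<le> 0 \<Longrightarrow> 0 \<le> binom_coeff t n"
  by (induction n) (auto simp: binom_coeff_Suc)

lemma binom_coeff_nonpos:
  assumes "0 \<le> t" "t \<le> 1"
  shows "binom_coeff t (Suc n) \<le> 0"
proof (induction n)
  case (Suc n)
  then show ?case 
    using assms by (subst binom_coeff_Suc) (intro mult_nonpos_nonneg, auto)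
qed (use assms in \<open>simp add: binom_coeff_Suc\<close>)

text \<open>All coefficients but the first are nonpositive, so the sum of the absolute values is 2 minus the
  plain partial sum, and that partial sum is a coefficient for the exponent \<open>t - 1 \<le> 0\<close>, hence nonnegative.\<close>

lemma sum_abs_binom_coeff:
  assumes "0 \<le> t" "t \<le> 1"
  shows "(\<Sum>k\<le>n. \<bar>binom_coeff t k\<bar>) \<le> 2"
proof -
  have "(\<Sum>k\<le>n. \<bar>binom_coeff t k\<bar>) = 2 - (\<Sum>k\<le>n. binom_coeff t k)"
    using binom_coeff_nonpos[OF assms] by (induction n) auto
  also have "\<dots> \<le> 2"
    using binom_coeff_nonneg[of "t - 1" n] assms by (simp add: sum_binom_coeff)
  finally show ?thesis .
qed

text \<open>In \<open>(1 - z)\<^bsup>1 + t\<^esup> - (1 - z)\<close> no coefficient but that of \<open>z\<close> can be negative; it equals \<open>- t\<close>, and the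
  partial sums of the later ones are at most \<open>t\<close>. This is what makes \<open>(1 - V)\<^sup>t\<close> close to the identity on
  the range of \<open>1 - V\<close>.\<close>

lemma sum_abs_binom_coeff_diff:
  assumes "0 \<le> t" "t \<le> 1"
  shows "(\<Sum>k\<le>n. \<bar>binom_coeff (1 + t) k - binom_coeff 1 k\<bar>) \<le> 2 * t"
proof -
  have pos: "0 \<le> binom_coeff (1 + t) (Suc (Suc k))" for k
  proof (induction k)
    case 0
    have "binom_coeff (1 + t) (Suc (Suc 0)) = (1 + t) * t / 2"
      by (simp add: binom_coeff_Suc field_simps)
    then show ?case using assms mult_nonneg_nonneg[of "1 + t" t] by linarith
  next
    case (Suc k)
    then show ?case
      using assms by (subst binom_coeff_Suc) (intro mult_nonneg_nonneg, auto)
  qed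
  have eq: "(\<Sum>k\<le>Suc n. \<bar>binom_coeff (1 + t) k - binom_coeff 1 k\<bar>)
      = 2 * t + (\<Sum>k\<le>Suc n. binom_coeff (1 + t) k)" for n
  proof (induction n)
    case 0
    then show ?case using assms by (simp add: binom_coeff_Suc)
  next
    case (Suc n)
    have "(\<Sum>k\<le>Suc (Suc n). \<bar>binom_coeff (1 + t) k - binom_coeff 1 k\<bar>)
      = 2 * t + (\<Sum>k\<le>Suc n. binom_coeff (1 + t) k) + \<bar>binom_coeff (1 + t) (Suc (Suc n)) - 0\<bar>"
      using Suc by (simp add: binom_coeff_1)
    then show ?case using pos[of n] by simp
  qed
  show ?thesis
  proof (cases n)
    case (Suc m)
    then show ?thesis
      using eq[of m] sum_binom_coeff[of "1 + t" "Suc m"] binom_coeff_nonpos[OF assms, of m] by simp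
  qed (use assms in simp)
qed

section \<open>Power series of a contraction\<close>

text \<open>An unordered sum, so that products of two series can be rearranged freely.\<close>

definition op_series :: "(nat \<Rightarrow> real) \<Rightarrow> ('a \<Rightarrow> 'a) \<Rightarrow> 'a::banach \<Rightarrow> 'a" where
  "op_series c V x = (\<Sum>\<^sub>\<infinity>n. c n *\<^sub>R (V ^^ n) x)"

abbreviation l1 :: "(nat \<Rightarrow> real) \<Rightarrow> bool" where
  "l1 c \<equiv> Infinite_Sum.abs_summable_on c UNIV"

lemma l1_bounded_partial_sums:
  assumes "\<And>n. (\<Sum>k\<le>n. \<bar>c k\<bar>) \<le> B"
  shows "l1 c" "infsum (\<lambda>k. \<bar>c k\<bar>) UNIV \<le> B"
proof -
  have le: "(\<Sum>k<n. \<bar>c k\<bar>) \<le> B" for n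
    by (rule order_trans[OF sum_mono2 assms[of n]]) auto
  have s: "summable (\<lambda>k. \<bar>c k\<bar>)"
    by (rule summableI_nonneg_bounded[OF _ le]) simp
  then show l: "l1 c"
    by (simp add: norm_summable_imp_summable_on)
  have "infsum (\<lambda>k. \<bar>c k\<bar>) UNIV = (\<Sum>k. \<bar>c k\<bar>)"
    using norm_summable_imp_has_sum[of "\<lambda>k. \<bar>c k\<bar>"] s summable_sums infsumI by fastforce
  also have "\<dots> \<le> B"
    by (rule suminf_le_const[OF s le])
  finally show "infsum (\<lambda>k. \<bar>c k\<bar>) UNIV \<le> B" .
qed

text \<open>The Cauchy product with vector coefficients: both sides of the second claim sum
  \<open>(c m * d n) *\<^sub>R w (m + n)\<close> over all pairs, once along rows and once along antidiagonals.\<close>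

lemma abs_summable_l1_convolution:
  fixes w :: "nat \<Rightarrow> 'a::banach"
  assumes c: "l1 c" and d: "l1 d" and w: "\<And>n. norm (w n) \<le> B"
  shows "Infinite_Sum.abs_summable_on (\<lambda>n. (\<Sum>i\<le>n. c i * d (n - i)) *\<^sub>R w n) UNIV"
    and "(\<Sum>\<^sub>\<infinity>m. c m *\<^sub>R (\<Sum>\<^sub>\<infinity>n. d n *\<^sub>R w (m + n))) = (\<Sum>\<^sub>\<infinity>n. (\<Sum>i\<le>n. c i * d (n - i)) *\<^sub>R w n)"
proof -
  define f where "f = (\<lambda>(m, n). (c m * d n) *\<^sub>R w (m + n))"
  have B: "0 \<le> B" using order_trans[OF norm_ge_zero w] .
  have inner: "Infinite_Sum.abs_summable_on (\<lambda>n. d n *\<^sub>R w (m + n)) UNIV" for m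
  proof (rule Infinite_Sum.abs_summable_on_comparison_test')
    show "(\<lambda>n. B * \<bar>d n\<bar>) summable_on UNIV"
      using d by (intro summable_on_cmult_right) auto
    show "norm (d n *\<^sub>R w (m + n)) \<le> B * \<bar>d n\<bar>" for n
      using mult_left_mono[OF w[of "m + n"], of "\<bar>d n\<bar>"] by (simp add: mult.commute)
  qed
  have f: "Infinite_Sum.abs_summable_on f (UNIV \<times> UNIV)"
  proof (rule Infinite_Sum.abs_summable_on_comparison_test')
    have "Infinite_Sum.abs_summable_on (\<lambda>(m, n). c m * d n) (UNIV \<times> UNIV)"
      unfolding Infinite_Sum.abs_summable_on_Sigma_iff using c d
      by (auto simp: abs_mult infsum_cmult_right intro!: summable_on_cmult_right summable_on_cmult_left)
    then have "(\<lambda>p. B * norm ((\<lambda>(m, n). c m * d n) p)) summable_on UNIV \<times> UNIV"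
      by (rule summable_on_cmult_right)
    then show "(\<lambda>p. B * \<bar>c (fst p) * d (snd p)\<bar>) summable_on UNIV \<times> UNIV"
      by (simp add: case_prod_unfold)
    show "norm (f p) \<le> B * \<bar>c (fst p) * d (snd p)\<bar>" for p
      using mult_left_mono[OF w[of "fst p + snd p"], of "\<bar>c (fst p) * d (snd p)\<bar>"]
      by (simp add: f_def case_prod_unfold mult.commute)
  qed
  have bij: "bij_betw (\<lambda>(n, i). (i, n - i)) (Sigma UNIV (\<lambda>n::nat. {..n})) (UNIV \<times> UNIV)"
    by (rule bij_betwI[where g = "\<lambda>(m, n). (m + n, m)"]) auto
  define g where "g = (\<lambda>p. f ((\<lambda>(n, i). (i, n - i)) p))"
  have g_eq: "g (n, i) = (c i * d (n - i)) *\<^sub>R w n" if "i \<le> n" for n i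
    using that by (simp add: g_def f_def)
  have "(\<lambda>p. norm (g p)) summable_on Sigma UNIV (\<lambda>n::nat. {..n})"
    unfolding g_def using f summable_on_reindex_bij_betw[OF bij, of "\<lambda>p. norm (f p)"] by simp
  then have g: "Infinite_Sum.abs_summable_on g (Sigma UNIV (\<lambda>n::nat. {..n}))" .
  have gsum: "infsum (\<lambda>i. g (n, i)) {..n} = (\<Sum>i\<le>n. c i * d (n - i)) *\<^sub>R w n" for n
    by (simp add: g_eq scaleR_sum_left)
  show "Infinite_Sum.abs_summable_on (\<lambda>n. (\<Sum>i\<le>n. c i * d (n - i)) *\<^sub>R w n) UNIV"
  proof (rule Infinite_Sum.abs_summable_on_comparison_test')
    show "(\<lambda>n. infsum (\<lambda>i. norm (g (n, i))) {..n}) summable_on UNIV"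
      using g Infinite_Sum.abs_summable_on_Sigma_iff[of g UNIV "\<lambda>n. {..n}"]
      by (simp add: abs_of_nonneg[OF sum_nonneg])
    show "norm ((\<Sum>i\<le>n. c i * d (n - i)) *\<^sub>R w n) \<le> infsum (\<lambda>i. norm (g (n, i))) {..n}" for n
      unfolding gsum[symmetric] by (simp add: norm_sum)
  qed
  have "(\<Sum>\<^sub>\<infinity>m. c m *\<^sub>R (\<Sum>\<^sub>\<infinity>n. d n *\<^sub>R w (m + n))) = (\<Sum>\<^sub>\<infinity>m. \<Sum>\<^sub>\<infinity>n. f (m, n))"
    using inner by (simp add: f_def abs_summable_summable flip: infsum_scaleR_right)
  also have "\<dots> = infsum f (UNIV \<times> UNIV)"
    using f by (intro infsum_Sigma_banach) (rule abs_summable_summable)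
  also have "\<dots> = infsum g (Sigma UNIV (\<lambda>n::nat. {..n}))"
    unfolding g_def by (rule infsum_reindex_bij_betw[OF bij, symmetric])
  also have "\<dots> = (\<Sum>\<^sub>\<infinity>n. infsum (\<lambda>i. g (n, i)) {..n})"
    using g by (intro infsum_Sigma_banach[symmetric]) (rule abs_summable_summable)
  finally show "(\<Sum>\<^sub>\<infinity>m. c m *\<^sub>R (\<Sum>\<^sub>\<infinity>n. d n *\<^sub>R w (m + n))) = (\<Sum>\<^sub>\<infinity>n. (\<Sum>i\<le>n. c i * d (n - i)) *\<^sub>R w n)"
    by (simp add: gsum)
qed

lemma l1_convolution:
  assumes "l1 c" "l1 d"
  shows "l1 (\<lambda>n. \<Sum>i\<le>n. c i * d (n - i))"
  using abs_summable_l1_convolution(1)[OF assms, of "\<lambda>_. 1::real" 1] by simp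

text \<open>Exponents above 1 are reached by convolving the coefficients for half the exponent with
  themselves.\<close>

lemma l1_binom_coeff:
  assumes "t > 0" shows "l1 (binom_coeff t)"
proof -
  have "l1 (binom_coeff t)" if "0 < t" "t \<le> real n + 1" for n t
    using that
  proof (induction n arbitrary: t)
    case 0
    then show ?case using l1_bounded_partial_sums(1)[OF sum_abs_binom_coeff] by simp
  next
    case (Suc n)
    then have "l1 (binom_coeff (t / 2))" using Suc.IH[of "t / 2"] by simp
    from l1_convolution[OF this this] show ?case by (simp add: binom_coeff_convolution)
  qed
  from this[of t "nat \<lceil>t\<rceil>"] assms show ?thesis
    by (metis ceiling_divide_upper le_add_same_cancel1 of_nat_ceiling order_trans zero_le_one)
qed

lemma bounded_linear_infsum:
  assumes "bounded_linear h" "f summable_on A"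
  shows "h (infsum f A) = (\<Sum>\<^sub>\<infinity>x\<in>A. h (f x))"
  by (rule infsumI[symmetric]) (rule has_sum_bounded_linear[OF assms(1) has_sum_infsum[OF assms(2)]])

locale contraction =
  fixes V :: "'a::banach \<Rightarrow> 'a"
  assumes bounded_linear: "bounded_linear V"
    and norm_le: "norm (V x) \<le> norm x"
begin

lemma norm_funpow_le: "norm ((V ^^ n) x) \<le> norm x"
  by (induction n) (auto intro: order_trans[OF norm_le])

lemma bounded_linear_funpow: "bounded_linear (V ^^ n)"
proof (induction n)
  case (Suc n)
  then show ?case
    using bounded_linear_compose[OF bounded_linear] by (simp add: o_def)
qed (simp add: id_def bounded_linear_ident)

lemma abs_summable_op_series:
  assumes "l1 c"
  shows "Infinite_Sum.abs_summable_on (\<lambda>n. c n *\<^sub>R (V ^^ n) x) UNIV"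
proof (rule Infinite_Sum.abs_summable_on_comparison_test')
  show "(\<lambda>n. norm x * \<bar>c n\<bar>) summable_on UNIV"
    using assms by (intro summable_on_cmult_right) auto
  show "norm (c n *\<^sub>R (V ^^ n) x) \<le> norm x * \<bar>c n\<bar>" for n
    using mult_left_mono[OF norm_funpow_le[of n x], of "\<bar>c n\<bar>"] by (simp add: mult.commute)
qed

lemma summable_op_series:
  "l1 c \<Longrightarrow> (\<lambda>n. c n *\<^sub>R (V ^^ n) x) summable_on UNIV"
  by (rule abs_summable_summable[OF abs_summable_op_series])

lemma norm_op_series_le:
  assumes c: "\<And>n. (\<Sum>k\<le>n. \<bar>c k\<bar>) \<le> B"
  shows "norm (op_series c V x) \<le> B * norm x"
proof -
  note l1 = l1_bounded_partial_sums[OF c]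
  have "norm (op_series c V x) \<le> (\<Sum>\<^sub>\<infinity>n. norm (c n *\<^sub>R (V ^^ n) x))"
    unfolding op_series_def by (rule norm_infsum_bound[OF abs_summable_op_series[OF l1(1)]])
  also have "\<dots> \<le> (\<Sum>\<^sub>\<infinity>n. \<bar>c n\<bar> * norm x)"
  proof (rule infsum_mono[OF abs_summable_op_series[OF l1(1)]])
    show "(\<lambda>n. \<bar>c n\<bar> * norm x) summable_on UNIV"
      using l1(1) by (intro summable_on_cmult_left) auto
    show "norm (c n *\<^sub>R (V ^^ n) x) \<le> \<bar>c n\<bar> * norm x" for n
      using mult_left_mono[OF norm_funpow_le[of n x], of "\<bar>c n\<bar>"] by simp
  qed
  also have "\<dots> = (\<Sum>\<^sub>\<infinity>n. \<bar>c n\<bar>) * norm x"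
    using l1(1) by (intro infsum_cmult_left) auto
  also have "\<dots> \<le> B * norm x"
    using l1(2) by (intro mult_right_mono) auto
  finally show ?thesis .
qed

lemma op_series_linear:
  assumes "l1 c"
  shows "linear (op_series c V)"
proof (rule linearI)
  interpret pow: bounded_linear "V ^^ n" for n by (rule bounded_linear_funpow)
  show "op_series c V (x + y) = op_series c V x + op_series c V y" for x y
    unfolding op_series_def
    by (simp add: pow.add scaleR_add_right infsum_add summable_op_series[OF assms])
  show "op_series c V (r *\<^sub>R x) = r *\<^sub>R op_series c V x" for r x
    unfolding op_series_def infsum_scaleR_right[symmetric]
    by (simp add: pow.scaleR mult.commute)
qed

lemma op_series_diff:
  assumes "l1 c" "l1 d"
  shows "op_series c V x - op_series d V x = op_series (\<lambda>n. c n - d n) V x"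
proof -
  have "((\<lambda>n. - (d n *\<^sub>R (V ^^ n) x)) has_sum - op_series d V x) UNIV"
    unfolding has_sum_uminus op_series_def minus_minus
    by (rule has_sum_infsum[OF summable_op_series[OF assms(2)]])
  from has_sum_add[OF has_sum_infsum[OF summable_op_series[OF assms(1), of x]] this]
  show ?thesis
    unfolding op_series_def scaleR_diff_left by (simp add: infsumI op_series_def)
qed

lemma op_series_commute:
  assumes c: "l1 c" and A: "bounded_linear A" and AV: "\<And>x. A (V x) = V (A x)"
  shows "A (op_series c V x) = op_series c V (A x)"
proof -
  interpret A: bounded_linear A by (rule A)
  have pow: "A ((V ^^ n) y) = (V ^^ n) (A y)" for n y
    by (induction n) (auto simp: AV)
  show ?thesis
    unfolding op_series_def
    by (simp add: bounded_linear_infsum[OF A summable_op_series[OF c]] A.scaleR pow o_def)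
qed

lemma op_series_op_series:
  assumes c: "l1 c" and d: "l1 d"
  shows "op_series c V (op_series d V x) = op_series (\<lambda>n. \<Sum>i\<le>n. c i * d (n - i)) V x"
proof -
  have "(V ^^ m) (op_series d V x) = (\<Sum>\<^sub>\<infinity>n. d n *\<^sub>R (V ^^ (m + n)) x)" for m
  proof -
    interpret pow: bounded_linear "V ^^ m" by (rule bounded_linear_funpow)
    show ?thesis unfolding op_series_def
      by (simp add: bounded_linear_infsum[OF bounded_linear_funpow summable_op_series[OF d]]
          pow.scaleR funpow_add o_def)
  qed
  then show ?thesis
    using abs_summable_l1_convolution(2)[OF c d, of "\<lambda>n. (V ^^ n) x" "norm x"] norm_funpow_le
    by (simp add: op_series_def)
qed

text \<open>The operator \<open>(1 - V)\<^sup>t\<close>.\<close>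

definition frac_power :: "real \<Rightarrow> 'a \<Rightarrow> 'a" where
  "frac_power t = op_series (binom_coeff t) V"

lemma frac_power_1: "frac_power 1 x = x - V x"
proof -
  have "frac_power 1 x = infsum (\<lambda>n. binom_coeff 1 n *\<^sub>R (V ^^ n) x) {0, 1}"
    unfolding frac_power_def op_series_def
    by (rule infsum_cong_neutral) (auto simp: binom_coeff_1)
  then show ?thesis by (simp add: binom_coeff_1)
qed

lemma frac_power_add:
  "s > 0 \<Longrightarrow> t > 0 \<Longrightarrow> frac_power s (frac_power t x) = frac_power (s + t) x"
  unfolding frac_power_def
  using op_series_op_series[OF l1_binom_coeff l1_binom_coeff, of s t]
  by (simp add: binom_coeff_convolution)

lemma norm_frac_power_le: "0 < t \<Longrightarrow> t \<le> 1 \<Longrightarrow> norm (frac_power t x) \<le> 2 * norm x"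
  unfolding frac_power_def by (rule norm_op_series_le[OF sum_abs_binom_coeff]) auto

lemma bounded_linear_frac_power:
  assumes "t > 0"
  shows "bounded_linear (frac_power t)"
proof -
  interpret linear "frac_power t"
    unfolding frac_power_def by (rule op_series_linear[OF l1_binom_coeff[OF assms]])
  have l: "l1 (binom_coeff t)" by (rule l1_binom_coeff[OF assms])
  show ?thesis
  proof (rule bounded_linear_intro)
    show "norm (frac_power t x) \<le> norm x * infsum (\<lambda>k. \<bar>binom_coeff t k\<bar>) UNIV" for x
    proof -
      have "(\<Sum>k\<le>n. \<bar>binom_coeff t k\<bar>) \<le> infsum (\<lambda>k. \<bar>binom_coeff t k\<bar>) UNIV" for n
        using l by (intro finite_sum_le_infsum) auto
      from norm_op_series_le[OF this] show ?thesis
        by (simp add: frac_power_def mult.commute)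
    qed
  qed (auto simp: add scale)
qed

lemma frac_power_commute:
  "t > 0 \<Longrightarrow> bounded_linear A \<Longrightarrow> (\<And>x. A (V x) = V (A x)) \<Longrightarrow>
    A (frac_power t x) = frac_power t (A x)"
  unfolding frac_power_def by (rule op_series_commute[OF l1_binom_coeff])

text \<open>On vectors \<open>(1 - V) y\<close> the operator \<open>(1 - V)\<^sup>t - 1\<close> acts as \<open>(1 - V)\<^bsup>1 + t\<^esup> - (1 - V)\<close> does on \<open>y\<close>,
  and the coefficients of that difference have absolute sum at most \<open>2 t\<close>.\<close>

lemma frac_power_tendsto:
  assumes dense: "closure (range (\<lambda>x. x - V x)) = UNIV"
  shows "((\<lambda>t. norm (frac_power t x - x)) \<longlongrightarrow> 0) (at_right 0)"
proof -
  define D where "D = {x. ((\<lambda>t. norm (frac_power t x - x)) \<longlongrightarrow> 0) (at_right 0)}"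
  have "closed D"
    unfolding D_def
  proof (rule closed_strong_convergence[where K=2])
    show "norm (frac_power t x - frac_power t y) \<le> 2 * norm (x - y)" if "0 < t" "t \<le> 1" for t x y
    proof -
      interpret P: bounded_linear "frac_power t" by (rule bounded_linear_frac_power[OF that(1)])
      show ?thesis using norm_frac_power_le[OF that, of "x - y"] by (simp add: P.diff)
    qed
  qed
  moreover have "range (\<lambda>x. x - V x) \<subseteq> D"
  proof (rule image_subsetI)
    fix y
    have bound: "norm (frac_power t (y - V y) - (y - V y)) \<le> 2 * t * norm y"
      if t: "0 < t" "t \<le> 1" for t
    proof -
      have "frac_power t (y - V y) - (y - V y) = frac_power (1 + t) y - frac_power 1 y"
        using frac_power_add[OF t(1) zero_less_one, of y] by (simp add: frac_power_1 add.commute)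
      also have "norm \<dots> \<le> 2 * t * norm y"
      proof -
        have l: "l1 (binom_coeff (1 + t))" "l1 (binom_coeff 1)"
          using t(1) by (intro l1_binom_coeff; simp)+
        show ?thesis
          unfolding frac_power_def op_series_diff[OF l]
          using t by (intro norm_op_series_le sum_abs_binom_coeff_diff) simp_all
      qed
      finally show ?thesis .
    qed
    have L: "((\<lambda>t. 2 * t * norm y) \<longlongrightarrow> 0) (at_right 0)"
      by (auto intro!: tendsto_eq_intros)
    have "\<forall>\<^sub>F t in at_right 0. norm (frac_power t (y - V y) - (y - V y)) \<le> 2 * t * norm y"
      unfolding eventually_at_right_field using bound zero_less_one less_imp_le by blast
    then show "y - V y \<in> D"
      unfolding D_def mem_Collect_eq by (intro tendsto_sandwich[OF _ _ tendsto_const L]) simp_all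
  qed
  ultimately have "closure (range (\<lambda>x. x - V x)) \<subseteq> D" by (rule closure_minimal[rotated])
  then show ?thesis using dense by (auto simp: D_def)
qed

end

section \<open>Accretive operators\<close>

text \<open>Solving \<open>x + T x = y\<close> is finding a fixed point of \<open>x \<mapsto> x - (x + T x - y) / M\<close>. For large \<open>M\<close> this
  map is a strict contraction, because \<open>inner (x + T x) x \<ge> (norm x)\<^sup>2\<close>.\<close>

lemma accretive_resolvent:
  fixes T :: "'a::{real_inner, complete_space} \<Rightarrow> 'a"
  assumes T: "bounded_linear T" and acc: "\<And>x. 0 \<le> inner (T x) x"
  obtains R where "bounded_linear R" "\<And>x. R x + T (R x) = x" "\<And>x. R (x + T x) = x"
proof -
  interpret T: bounded_linear T by (rule T)
  obtain K where K: "K > 0" "\<And>x. norm (T x) \<le> norm x * K"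
    using T.pos_bounded by blast
  have ge: "norm x \<le> norm (x + T x)" for x
  proof -
    have "(norm x)\<^sup>2 \<le> inner (x + T x) x"
      using acc[of x] by (simp add: inner_add_left power2_norm_eq_inner)
    also have "\<dots> \<le> norm (x + T x) * norm x" by (rule norm_cauchy_schwarz)
    finally show ?thesis by (cases "x = 0") (simp_all add: power2_eq_square)
  qed
  have inj: "x = y" if "x + T x = y + T y" for x y
  proof -
    have "x - y + T (x - y) = (x + T x) - (y + T y)" by (simp add: T.diff)
    then show ?thesis using ge[of "x - y"] that by simp
  qed
  \<comment> \<open>Since \<open>M\<close> bounds the square of the norm of \<open>1 + T\<close>, expanding the square gives
    the factor \<open>1 - 2 / M + M / M\<^sup>2 = 1 - 1 / M\<close>.\<close>
  define M where "M = (1 + K)\<^sup>2"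
  have M1: "M \<ge> 1" using K by (simp add: M_def one_le_power)
  define q where "q = sqrt (1 - 1 / M)"
  have q: "0 \<le> q" "q < 1" using M1 by (auto simp: q_def)
  have contr: "norm (x - (1 / M) *\<^sub>R (x + T x)) \<le> q * norm x" for x
  proof (rule power2_le_imp_le)
    have "norm (x + T x) \<le> (1 + K) * norm x"
      using norm_triangle_ineq[of x "T x"] K(2)[of x] by (simp add: algebra_simps)
    then have "(norm (x + T x))\<^sup>2 \<le> M * (norm x)\<^sup>2"
      unfolding M_def power_mult_distrib[symmetric] by (intro power_mono) auto
    then have 1: "(1 / M)\<^sup>2 * (norm (x + T x))\<^sup>2 \<le> (1 / M)\<^sup>2 * (M * (norm x)\<^sup>2)"
      by (intro mult_left_mono) auto
    have "(norm (x - (1 / M) *\<^sub>R (x + T x)))\<^sup>2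
        = (norm x)\<^sup>2 - 2 * (1 / M) * inner (x + T x) x + (1 / M)\<^sup>2 * (norm (x + T x))\<^sup>2"
      unfolding power2_norm_eq_inner
      by (simp add: inner_diff_left inner_diff_right inner_commute power2_eq_square)
    also have "\<dots> \<le> (norm x)\<^sup>2 - 2 * (1 / M) * (norm x)\<^sup>2 + (1 / M)\<^sup>2 * (M * (norm x)\<^sup>2)"
      using acc[of x] M1 1
      by (intro add_mono diff_left_mono mult_left_mono)
         (auto simp: inner_add_left power2_norm_eq_inner)
    also have "\<dots> = (q * norm x)\<^sup>2"
      using M1 by (simp add: q_def power_mult_distrib power2_eq_square field_simps)
    finally show "(norm (x - (1 / M) *\<^sub>R (x + T x)))\<^sup>2 \<le> (q * norm x)\<^sup>2" .
  qed (use q in simp)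
  have surj: "\<exists>x. x + T x = y" for y
  proof -
    define \<phi> where "\<phi> x = x - (1 / M) *\<^sub>R (x + T x - y)" for x
    have "dist (\<phi> u) (\<phi> v) \<le> q * dist u v" for u v
    proof -
      have "\<phi> u - \<phi> v = (u - v) - (1 / M) *\<^sub>R ((u - v) + T (u - v))"
        by (simp add: \<phi>_def T.diff scaleR_diff_right scaleR_add_right)
      with contr[of "u - v"] show ?thesis by (simp add: dist_norm)
    qed
    then obtain x where "\<phi> x = x"
      using banach_fix_type[OF q, of \<phi>] by blast
    then show ?thesis using M1 by (auto simp: \<phi>_def)
  qed
  define R where "R y = (SOME x. x + T x = y)" for y
  have R: "R y + T (R y) = y" for y
    unfolding R_def by (rule someI_ex[OF surj])
  have "bounded_linear R"
  proof (rule bounded_linear_intro[where K=1])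
    show "R (x + y) = R x + R y" for x y
    proof (rule inj)
      have "(R x + R y) + T (R x + R y) = (R x + T (R x)) + (R y + T (R y))"
        by (simp add: T.add)
      then show "R (x + y) + T (R (x + y)) = (R x + R y) + T (R x + R y)"
        by (simp add: R)
    qed
    show "R (r *\<^sub>R x) = r *\<^sub>R R x" for r x
    proof (rule inj)
      have "r *\<^sub>R R x + T (r *\<^sub>R R x) = r *\<^sub>R (R x + T (R x))"
        by (simp add: T.scaleR scaleR_add_right)
      then show "R (r *\<^sub>R x) + T (R (r *\<^sub>R x)) = r *\<^sub>R R x + T (r *\<^sub>R R x)"
        by (simp add: R)
    qed
    show "norm (R x) \<le> norm x * 1" for x
      using ge[of "R x"] R[of x] by simp
  qed
  moreover have "R (x + T x) = x" for x
    by (rule inj) (rule R)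
  ultimately show ?thesis using that R by blast
qed

lemma bounded_linear_scaleC: "bounded_linear (\<lambda>x::'a::complex_normed_vector. c *\<^sub>C x)"
proof (rule bounded_linear_intro[where K="cmod c"])
  show "c *\<^sub>C r *\<^sub>R x = r *\<^sub>R c *\<^sub>C x" for r and x :: 'a
    by (simp add: scaleR_scaleC scaleC_scaleC mult.commute)
qed (simp_all add: scaleC_add_right norm_scaleC mult.commute)

text \<open>The fractional powers are constructed over the real scalars. Complex linearity is recovered
  afterwards, from the fact that the powers commute with whatever commutes with \<open>T\<close>.\<close>

locale accretive_operator =
  fixes T :: "'a::{real_inner, banach} \<Rightarrow> 'a"
  assumes bounded_linear: "bounded_linear T"
    and accretive: "0 \<le> inner (T x) x"
begin

sublocale T: bounded_linear T by (rule bounded_linear)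

definition resolvent :: "'a \<Rightarrow> 'a" where
  "resolvent = (SOME R. bounded_linear R \<and> (\<forall>x. R x + T (R x) = x) \<and> (\<forall>x. R (x + T x) = x))"

lemma resolvent:
  "bounded_linear resolvent" "resolvent x + T (resolvent x) = x" "resolvent (x + T x) = x"
proof -
  have "\<exists>R. bounded_linear R \<and> (\<forall>x. R x + T (R x) = x) \<and> (\<forall>x. R (x + T x) = x)"
    by (rule accretive_resolvent[OF bounded_linear accretive]) blast
  then have "bounded_linear resolvent \<and> (\<forall>x. resolvent x + T (resolvent x) = x)
      \<and> (\<forall>x. resolvent (x + T x) = x)"
    unfolding resolvent_def by (rule someI_ex)
  then show "bounded_linear resolvent" "resolvent x + T (resolvent x) = x" "resolvent (x + T x) = x"
    by blast+
qed

sublocale R: bounded_linear resolvent by (rule resolvent)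

text \<open>The Cayley transform \<open>V = (1 - T) (1 + T)\<^sup>-\<^sup>1\<close>, in the form \<open>2 (1 + T)\<^sup>-\<^sup>1 - 1\<close>. It replaces \<open>T\<close> by a
  contraction: the binomial series of \<open>(1 - (1 - T))\<^sup>t\<close> is of no use, since \<open>1 - T\<close> may have norm
  above 1 even after rescaling \<open>T\<close>, for instance when \<open>i T\<close> is self-adjoint and nonzero.\<close>

definition cayley :: "'a \<Rightarrow> 'a" where
  "cayley x = 2 *\<^sub>R resolvent x - x"

lemma bounded_linear_cayley: "bounded_linear cayley"
  unfolding cayley_def
  by (intro bounded_linear_sub bounded_linear_ident
      bounded_linear_compose[OF bounded_linear_scaleR_right resolvent(1)])

text \<open>If \<open>x = y + T y\<close>, then \<open>V x = y - T y\<close>, and the squares of the two norms differ by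
  \<open>4 * inner (T y) y\<close>.\<close>

lemma norm_cayley_le: "norm (cayley x) \<le> norm x"
proof -
  define y where "y = resolvent x"
  have x: "x = y + T y" by (simp add: y_def resolvent)
  have V: "cayley x = y - T y"
    unfolding cayley_def y_def[symmetric] scaleR_2 by (subst x) simp
  have "(norm (y - T y))\<^sup>2 = (norm (y + T y))\<^sup>2 - 4 * inner (T y) y"
    unfolding power2_norm_eq_inner
    by (simp add: inner_diff_left inner_diff_right inner_add_left inner_add_right inner_commute)
  then have "(norm (y - T y))\<^sup>2 \<le> (norm (y + T y))\<^sup>2" using accretive[of y] by simp
  then have "norm (y - T y) \<le> norm (y + T y)" by (rule power2_le_imp_le) simp
  then show ?thesis unfolding V using x by metis
qed

text \<open>Thus \<open>P.frac_power t\<close> is \<open>(1 - V)\<^sup>t\<close>, and \<open>E.frac_power t\<close> is \<open>(1 + V)\<^sup>t\<close>.\<close>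

sublocale P: contraction cayley
  by (rule contraction.intro[OF bounded_linear_cayley norm_cayley_le])

sublocale E: contraction "\<lambda>x. - cayley x"
  by (rule contraction.intro[OF bounded_linear_minus[OF bounded_linear_cayley]])
     (simp add: norm_cayley_le)

text \<open>The inverse of \<open>1 + V\<close>.\<close>

definition half_shift :: "'a \<Rightarrow> 'a" where
  "half_shift x = (1/2) *\<^sub>R (x + T x)"

lemma bounded_linear_half_shift: "bounded_linear half_shift"
  unfolding half_shift_def
  by (intro bounded_linear_compose[OF bounded_linear_scaleR_right] bounded_linear_add
      bounded_linear_ident bounded_linear)

sublocale J: bounded_linear half_shift by (rule bounded_linear_half_shift)

lemma E_1: "E.frac_power 1 x = 2 *\<^sub>R resolvent x"
  unfolding E.frac_power_1 by (simp add: cayley_def)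

lemma half_shift_E: "half_shift (E.frac_power 1 x) = x"
proof -
  have "half_shift (E.frac_power 1 x) = resolvent x + T (resolvent x)"
    by (simp add: half_shift_def E_1 T.scaleR scaleR_add_right)
  then show ?thesis by (simp add: resolvent)
qed

lemma E_half_shift: "E.frac_power 1 (half_shift x) = x"
  by (simp add: half_shift_def E_1 R.scaleR resolvent)

lemma cayley_half_shift: "half_shift x + cayley (half_shift x) = x"
  using E_half_shift[of x] by (simp add: E.frac_power_1)

lemma P_half_shift: "P.frac_power 1 (half_shift x) = T x"
proof -
  have "P.frac_power 1 (half_shift x) = 2 *\<^sub>R half_shift x - x"
    unfolding P.frac_power_1 using cayley_half_shift[of x] by (simp add: scaleR_2 algebra_simps)
  then show ?thesis by (simp add: half_shift_def)
qed

lemma half_shift_funpow_E: "(half_shift ^^ Suc n) (E.frac_power (real (Suc n)) x) = x"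
proof (induction n arbitrary: x)
  case (Suc n)
  have "E.frac_power (real (Suc (Suc n))) x = E.frac_power 1 (E.frac_power (real (Suc n)) x)"
    by (subst E.frac_power_add) (simp_all add: add_ac)
  then show ?case
    using Suc half_shift_E by (simp only: funpow_Suc_right[of "Suc n"] o_apply)
qed (simp add: half_shift_E)

lemma E_half_shift_funpow: "E.frac_power (real (Suc n)) ((half_shift ^^ Suc n) x) = x"
proof (induction n arbitrary: x)
  case (Suc n)
  have "E.frac_power (real (Suc (Suc n))) y = E.frac_power (real (Suc n)) (E.frac_power 1 y)" for y
    by (subst E.frac_power_add) (simp_all add: add_ac)
  then show ?case
    using Suc by (simp only: funpow.simps(2)[of "Suc n"] o_apply E_half_shift)
qed (simp add: E_half_shift)

lemma bounded_linear_half_shift_funpow: "bounded_linear (half_shift ^^ n)"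
proof (induction n)
  case (Suc n)
  then show ?case
    using bounded_linear_compose[OF bounded_linear_half_shift] by (simp add: o_def)
qed (simp add: id_def bounded_linear_ident)

text \<open>The inverse of \<open>(1 + V)\<^sup>t\<close>, written as \<open>(1 + V)\<^bsup>n - t\<^esup> (1 + V)\<^bsup>- n\<^esup>\<close> for the least integer \<open>n > t\<close>, so that
  only positive powers of \<open>1 + V\<close> and its bounded inverse occur.\<close>

definition inv_power :: "real \<Rightarrow> 'a \<Rightarrow> 'a" where
  "inv_power t x = E.frac_power (real (Suc (nat \<lfloor>t\<rfloor>)) - t) ((half_shift ^^ Suc (nat \<lfloor>t\<rfloor>)) x)"

lemma Suc_floor_diff_pos: "t > 0 \<Longrightarrow> real (Suc (nat \<lfloor>t\<rfloor>)) - t > 0"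
  by linarith

lemma bounded_linear_inv_power:
  assumes "t > 0" shows "bounded_linear (inv_power t)"
  unfolding inv_power_def[abs_def]
  by (rule bounded_linear_compose[OF E.bounded_linear_frac_power[OF Suc_floor_diff_pos[OF assms]]
        bounded_linear_half_shift_funpow])

lemma E_inv_power:
  assumes "t > 0" shows "E.frac_power t (inv_power t x) = x"
  unfolding inv_power_def E.frac_power_add[OF assms Suc_floor_diff_pos[OF assms]]
  using E_half_shift_funpow[of "nat \<lfloor>t\<rfloor>" x] by (simp only: add_diff_cancel_left' add_diff_eq)

lemma E_inj:
  assumes t: "t > 0" and eq: "E.frac_power t x = E.frac_power t y"
  shows "x = y"
proof -
  define n where "n = nat \<lfloor>t\<rfloor>"
  have "E.frac_power (real (Suc n)) z = E.frac_power (real (Suc n) - t) (E.frac_power t z)" for z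
    using E.frac_power_add[OF Suc_floor_diff_pos[OF t] t] by (simp add: n_def)
  from this[of x] this[of y] half_shift_funpow_E[of n x] half_shift_funpow_E[of n y] eq
  show ?thesis by metis
qed

lemma inv_power_E: "t > 0 \<Longrightarrow> inv_power t (E.frac_power t x) = x"
  by (rule E_inj[where t = t]) (assumption, rule E_inv_power)

lemma inv_power_add:
  assumes "t > 0" "s > 0"
  shows "inv_power t (inv_power s x) = inv_power (t + s) x"
proof (rule E_inj[of "s + t"])
  show "E.frac_power (s + t) (inv_power t (inv_power s x)) = E.frac_power (s + t) (inv_power (t + s) x)"
    using assms E_inv_power[of "t + s"]
    by (simp add: E_inv_power add.commute[of t s] flip: E.frac_power_add)
qed (use assms in simp)

lemma inv_power_commute:
  assumes t: "t > 0" and A: "bounded_linear A" and AV: "\<And>x. A (cayley x) = cayley (A x)"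
  shows "A (inv_power t x) = inv_power t (A x)"
proof (rule E_inj[OF t])
  interpret A: bounded_linear A by (rule A)
  have "E.frac_power t (A (inv_power t x)) = A (E.frac_power t (inv_power t x))"
    by (rule E.frac_power_commute[OF t A, symmetric]) (simp add: A.neg AV)
  then show "E.frac_power t (A (inv_power t x)) = E.frac_power t (inv_power t (A x))"
    by (simp add: E_inv_power[OF t])
qed

text \<open>The operator \<open>T\<^sup>t = (1 - V)\<^sup>t (1 + V)\<^bsup>- t\<^esup>\<close>.\<close>

definition accretive_power :: "real \<Rightarrow> 'a \<Rightarrow> 'a" where
  "accretive_power t x = P.frac_power t (inv_power t x)"

lemma bounded_linear_accretive_power: "t > 0 \<Longrightarrow> bounded_linear (accretive_power t)"
  unfolding accretive_power_def[abs_def]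
  by (rule bounded_linear_compose[OF P.bounded_linear_frac_power bounded_linear_inv_power])

lemma accretive_power_add:
  assumes t: "t > 0" and s: "s > 0"
  shows "accretive_power t (accretive_power s x) = accretive_power (t + s) x"
proof -
  have "P.frac_power s (cayley x) = cayley (P.frac_power s x)" for x
    by (rule P.frac_power_commute[OF s bounded_linear_cayley, symmetric]) simp
  from inv_power_commute[OF t P.bounded_linear_frac_power[OF s] this]
  have "accretive_power t (accretive_power s x)
      = P.frac_power t (P.frac_power s (inv_power t (inv_power s x)))"
    by (simp add: accretive_power_def)
  then show ?thesis
    using t s by (simp add: accretive_power_def inv_power_add P.frac_power_add)
qed

lemma accretive_power_1: "accretive_power 1 x = T x"
proof -
  have "inv_power 1 x = half_shift x"
    by (rule E_inj[of 1]) (simp_all add: E_inv_power E_half_shift)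
  then show ?thesis by (simp add: accretive_power_def P_half_shift)
qed

lemma accretive_power_commute:
  assumes t: "t > 0" and A: "bounded_linear A" and AT: "\<And>x. A (T x) = T (A x)"
  shows "A (accretive_power t x) = accretive_power t (A x)"
proof -
  interpret A: bounded_linear A by (rule A)
  have "A (resolvent x) = resolvent (A x)" for x
  proof -
    have "resolvent (A (resolvent x + T (resolvent x))) = A (resolvent x)"
      using resolvent(3)[of "A (resolvent x)"] by (simp add: A.add AT)
    then show ?thesis by (simp add: resolvent(2))
  qed
  then have AV: "A (cayley x) = cayley (A x)" for x
    by (simp add: cayley_def A.diff A.scaleR)
  show ?thesis
    unfolding accretive_power_def
    by (simp only: P.frac_power_commute[OF t A AV] inv_power_commute[OF t A AV])
qed

lemma range_one_minus_cayley: "range (\<lambda>x. x - cayley x) = range T"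
proof -
  have 1: "x - cayley x = T (2 *\<^sub>R resolvent x)" for x
  proof -
    have "half_shift (2 *\<^sub>R resolvent x) = x"
      using half_shift_E[of x] by (simp only: E_1)
    then show ?thesis
      using P.frac_power_1[of x] P_half_shift[of "2 *\<^sub>R resolvent x"] by simp
  qed
  have 2: "T x = half_shift x - cayley (half_shift x)" for x
    using P_half_shift[of x] by (simp add: P.frac_power_1)
  show ?thesis
    by (intro equalityI image_subsetI) (subst 1, rule rangeI, subst 2, rule rangeI)
qed

text \<open>Accretivity at \<open>y + r z\<close> reads \<open>0 \<le> r * inner (T y) z + r\<^sup>2 * inner (T z) z\<close> for all real \<open>r\<close>, so the
  coefficient of the linear term vanishes.\<close>

lemma orthogonal_range_imp_kernel:
  assumes orth: "\<And>z. inner (T z) y = 0"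
  shows "T y = 0"
proof -
  have "inner (T y) z = 0" for z
  proof (rule ccontr)
    assume nz: "inner (T y) z \<noteq> 0"
    define b where "b = inner (T y) z"
    define a where "a = inner (T z) z"
    have ge: "0 \<le> r * b + r\<^sup>2 * a" for r
      using accretive[of "y + r *\<^sub>R z"] orth[of y] orth[of z]
      by (simp add: T.add T.scaleR inner_add_left inner_add_right a_def b_def
          power2_eq_square algebra_simps)
    have a: "a \<ge> 0" by (simp add: a_def accretive)
    \<comment> \<open>Adding 1 keeps the denominator positive when \<open>a = 0\<close>.\<close>
    define r where "r = - b / (a + 1)"
    have "r * b + r\<^sup>2 * a = - (b\<^sup>2 / (a + 1)\<^sup>2)"
      using a by (simp add: r_def power2_eq_square divide_simps) (simp add: algebra_simps)
    moreover have "b\<^sup>2 / (a + 1)\<^sup>2 > 0" using nz a by (simp add: b_def)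
    ultimately show False using ge[of r] by simp
  qed
  then show "T y = 0" using inner_eq_zero_iff by blast
qed

lemma dense_range:
  assumes inj: "\<And>y. T y = 0 \<Longrightarrow> (\<And>x. inner (T x) y = 0) \<Longrightarrow> y = 0"
  shows "closure (range T) = UNIV"
proof (rule ccontr)
  assume "closure (range T) \<noteq> UNIV"
  then obtain x where x: "x \<notin> closure (range T)" by blast
  have "subspace (range T)"
    by (rule linear_subspace_image[OF T.linear_axioms subspace_UNIV])
  then have "subspace (closure (range T))" by (rule subspace_closure)
  then obtain g where g: "g \<in> closure (range T)"
    "\<And>y. y \<in> closure (range T) \<Longrightarrow> inner (x - g) y = 0"
    by (rule orthogonal_projection_exists[of "closure (range T)" x]) auto
  define y where "y = x - g"
  have "x \<noteq> g" using x g(1) by metis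
  then have "y \<noteq> 0" by (simp add: y_def)
  have orth: "inner (T z) y = 0" for z
  proof -
    have "T z \<in> closure (range T)" using closure_subset[of "range T"] by (rule subsetD) (rule rangeI)
    from g(2)[OF this] show ?thesis by (simp add: y_def inner_commute)
  qed
  have "T y = 0" by (rule orthogonal_range_imp_kernel[OF orth])
  then have "y = 0" using orth by (rule inj)
  with \<open>y \<noteq> 0\<close> show False ..
qed

lemma E_tendsto: "((\<lambda>t. norm (E.frac_power t x - x)) \<longlongrightarrow> 0) (at_right 0)"
proof -
  have "y \<in> range (\<lambda>x. x + cayley x)" for y
    using cayley_half_shift[of y] by (metis rangeI)
  then have "range (\<lambda>x. x + cayley x) = UNIV" by blast
  then show ?thesis by (intro E.frac_power_tendsto) simp
qed

lemma norm_inv_power_le: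
  obtains K where "\<And>t x. 0 < t \<Longrightarrow> t < 1 \<Longrightarrow> norm (inv_power t x) \<le> K * norm x"
proof -
  obtain K where K: "\<And>x. norm (half_shift x) \<le> norm x * K"
    using J.nonneg_bounded by blast
  have "norm (inv_power t x) \<le> 2 * K * norm x" if "0 < t" "t < 1" for t x
  proof -
    have "nat \<lfloor>t\<rfloor> = 0" using that by linarith
    then have "norm (inv_power t x) \<le> 2 * norm (half_shift x)"
      unfolding inv_power_def using that E.norm_frac_power_le[of "1 - t" "half_shift x"] by simp
    also have "\<dots> \<le> 2 * (norm x * K)" using K by simp
    finally show ?thesis by (simp add: mult_ac)
  qed
  then show ?thesis by (rule that)
qed

text \<open>Decompose \<open>T\<^sup>t - 1 = (1 - V)\<^sup>t (1 + V)\<^bsup>- t\<^esup> (1 - (1 + V)\<^sup>t) + ((1 - V)\<^sup>t - 1)\<close>. The operators in front are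
  bounded uniformly for \<open>t < 1\<close>, and the two differences tend to 0 strongly.\<close>

lemma accretive_power_tendsto:
  assumes dense: "closure (range T) = UNIV"
  shows "((\<lambda>t. norm (accretive_power t x - x)) \<longlongrightarrow> 0) (at_right 0)"
proof -
  obtain K where K: "\<And>t x. 0 < t \<Longrightarrow> t < 1 \<Longrightarrow> norm (inv_power t x) \<le> K * norm x"
    using norm_inv_power_le by blast
  have P: "((\<lambda>t. norm (P.frac_power t x - x)) \<longlongrightarrow> 0) (at_right 0)"
    by (rule P.frac_power_tendsto) (simp add: range_one_minus_cayley dense)
  have L: "((\<lambda>t. 2 * K * norm (E.frac_power t x - x) + norm (P.frac_power t x - x)) \<longlongrightarrow> 0) (at_right 0)"
    using tendsto_add[OF tendsto_mult[OF tendsto_const[of "2 * K"] E_tendsto] P] by simp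
  have "norm (accretive_power t x - x)
      \<le> 2 * K * norm (E.frac_power t x - x) + norm (P.frac_power t x - x)"
    if t: "0 < t" "t < 1" for t
  proof -
    interpret Pt: bounded_linear "P.frac_power t" by (rule P.bounded_linear_frac_power[OF t(1)])
    interpret Qt: bounded_linear "inv_power t" by (rule bounded_linear_inv_power[OF t(1)])
    have "accretive_power t x - x
        = P.frac_power t (inv_power t (x - E.frac_power t x)) + (P.frac_power t x - x)"
      by (simp add: accretive_power_def Pt.diff Qt.diff inv_power_E[OF t(1)])
    also have "norm \<dots> \<le> norm (P.frac_power t (inv_power t (x - E.frac_power t x)))
        + norm (P.frac_power t x - x)"
      by (rule norm_triangle_ineq)
    also have "norm (P.frac_power t (inv_power t (x - E.frac_power t x)))
        \<le> 2 * norm (inv_power t (x - E.frac_power t x))"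
      using t by (intro P.norm_frac_power_le) auto
    also have "norm (inv_power t (x - E.frac_power t x)) \<le> K * norm (E.frac_power t x - x)"
      using K[OF t, of "x - E.frac_power t x"] by (simp add: norm_minus_commute)
    finally show ?thesis by simp
  qed
  then have "\<forall>\<^sub>F t in at_right 0. norm (accretive_power t x - x)
      \<le> 2 * K * norm (E.frac_power t x - x) + norm (P.frac_power t x - x)"
    unfolding eventually_at_right_field using zero_less_one by blast
  then show ?thesis
    by (intro tendsto_sandwich[OF _ _ tendsto_const L]) simp_all
qed

end

text \<open>For accretive \<open>T\<close> the last hypothesis amounts to dense range.\<close>

theorem accretive_C0_embeddable:
  fixes T :: "'a::{complex_banach, real_inner} \<Rightarrow> 'a"
  assumes T: "bounded_clinear T" and acc: "\<And>x. 0 \<le> inner (T x) x"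
    and inj: "\<And>y. T y = 0 \<Longrightarrow> (\<And>x. inner (T x) y = 0) \<Longrightarrow> y = 0"
  shows "C0_embeddable T"
proof -
  interpret accretive_operator T
    by (rule accretive_operator.intro) (use T acc in \<open>simp_all add: bounded_clinear_def\<close>)
  have "c *\<^sub>C accretive_power t x = accretive_power t (c *\<^sub>C x)" if "t > 0" for t c x
    by (rule accretive_power_commute[OF that bounded_linear_scaleC])
       (use T in \<open>simp add: bounded_clinear_def\<close>)
  moreover have "closure (range T) = UNIV" by (rule dense_range[OF inj])
  ultimately have "C0_semigroup accretive_power"
    unfolding C0_semigroup_def bounded_clinear_def
    using bounded_linear_accretive_power accretive_power_add accretive_power_tendsto
    by (auto simp: fun_eq_iff)
  moreover have "accretive_power 1 = T" by (rule ext) (rule accretive_power_1)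
  ultimately show ?thesis unfolding C0_embeddable_def by blast
qed

text \<open>The given semigroup is multiplied by \<open>t \<mapsto> c\<^sup>t = exp (t b)\<close>, where \<open>b\<close> is a logarithm of \<open>c\<close>.\<close>

lemma C0_embeddable_scaleC:
  fixes T :: "'a::complex_banach \<Rightarrow> 'a"
  assumes T: "C0_embeddable T" and c: "c \<noteq> 0"
  shows "C0_embeddable (\<lambda>x. c *\<^sub>C T x)"
proof -
  obtain S where S: "C0_semigroup S" "S 1 = T" using T by (auto simp: C0_embeddable_def)
  obtain b where b: "exp b = c" using exp_Ln[OF c] by blast
  define S' where "S' t x = exp (of_real t * b) *\<^sub>C S t x" for t x
  have bcl: "bounded_clinear (S t)" if "t > 0" for t
    using S(1) that unfolding C0_semigroup_def by blast
  have lin: "bounded_linear (S t)" and S_C: "\<And>d x. S t (d *\<^sub>C x) = d *\<^sub>C S t x" if "t > 0" for t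
    using bcl[OF that] unfolding bounded_clinear_def by blast+
  have S_comp: "S t \<circ> S s = S (t + s)" if "t > 0" "s > 0" for t s
    using S(1) that unfolding C0_semigroup_def by blast
  have S_add: "S t (S s x) = S (t + s) x" if "t > 0" "s > 0" for t s x
    using fun_cong[OF S_comp[OF that], of x] by simp
  have lim: "((\<lambda>t. norm (S t x - x)) \<longlongrightarrow> 0) (at_right 0)" for x
    using S(1) unfolding C0_semigroup_def by blast
  have "C0_semigroup S'"
    unfolding C0_semigroup_def
  proof (intro conjI allI impI)
    fix t :: real assume t: "t > 0"
    show "bounded_clinear (S' t)"
      unfolding bounded_clinear_def S'_def
      using bounded_linear_compose[OF bounded_linear_scaleC lin[OF t]]
      by (simp add: S_C[OF t] scaleC_scaleC mult.commute)
    fix s :: real assume s: "s > 0"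
    show "S' t \<circ> S' s = S' (t + s)"
      by (simp add: fun_eq_iff S'_def S_C[OF t] scaleC_scaleC S_add[OF t s] distrib_right exp_add)
  next
    fix x
    have "((\<lambda>t::real. cmod (exp (of_real t * b)) * norm (S t x - x) + cmod (exp (of_real t * b) - 1) * norm x)
        \<longlongrightarrow> cmod (exp (of_real 0 * b)) * 0 + cmod (exp (of_real 0 * b) - 1) * norm x) (at_right 0)"
      by (intro tendsto_intros lim)
    then have L: "((\<lambda>t::real. cmod (exp (of_real t * b)) * norm (S t x - x) + cmod (exp (of_real t * b) - 1) * norm x)
        \<longlongrightarrow> 0) (at_right 0)" by simp
    show "((\<lambda>t. norm (S' t x - x)) \<longlongrightarrow> 0) (at_right 0)"
    proof (rule tendsto_sandwich[OF _ _ tendsto_const L])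
      have "norm (S' t x - x) \<le> cmod (exp (of_real t * b)) * norm (S t x - x)
          + cmod (exp (of_real t * b) - 1) * norm x" for t
      proof -
        interpret C: bounded_linear "\<lambda>x::'a. exp (of_real t * b) *\<^sub>C x" by (rule bounded_linear_scaleC)
        have 1: "1 *\<^sub>C x = x" using scaleR_scaleC[of 1 x] by simp
        have "exp (of_real t * b) *\<^sub>C x = (exp (of_real t * b) - 1) *\<^sub>C x + x"
          using scaleC_add_left[of "exp (of_real t * b) - 1" 1 x] by (simp add: 1)
        then have "S' t x - x = exp (of_real t * b) *\<^sub>C (S t x - x) + (exp (of_real t * b) - 1) *\<^sub>C x"
          by (simp add: S'_def C.diff)
        then show ?thesis
          using norm_triangle_ineq[of "exp (of_real t * b) *\<^sub>C (S t x - x)" "(exp (of_real t * b) - 1) *\<^sub>C x"]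
          by (simp add: norm_scaleC)
      qed
      then show "\<forall>\<^sub>F t in at_right 0. norm (S' t x - x)
          \<le> cmod (exp (of_real t * b)) * norm (S t x - x) + cmod (exp (of_real t * b) - 1) * norm x"
        by simp
    qed simp
  qed
  moreover have "S' 1 = (\<lambda>x. c *\<^sub>C T x)" by (simp add: S'_def S(2) b fun_eq_iff)
  ultimately show ?thesis unfolding C0_embeddable_def by blast
qed

section \<open>Uniqueness of Fourier coefficients\<close>

definition fourier_null :: "(complex \<Rightarrow> complex) \<Rightarrow> bool" where
  "fourier_null f \<longleftrightarrow> integrable circle f \<and> (\<forall>n. integral\<^sup>L circle (\<lambda>\<tau>. f \<tau> * \<tau> powi n) = 0)"

lemma integrable_circle_mult_bounded:
  fixes f g :: "complex \<Rightarrow> complex"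
  assumes f: "integrable circle f" and g: "g \<in> borel_measurable circle"
    and le: "\<And>\<tau>. cmod \<tau> = 1 \<Longrightarrow> cmod (g \<tau>) \<le> C"
  shows "integrable circle (\<lambda>\<tau>. f \<tau> * g \<tau>)"
proof (rule Bochner_Integration.integrable_bound)
  show "integrable circle (\<lambda>\<tau>. C * cmod (f \<tau>))" using f by simp
  show "(\<lambda>\<tau>. f \<tau> * g \<tau>) \<in> borel_measurable circle"
    using f g by (intro borel_measurable_times) auto
  show "AE \<tau> in circle. cmod (f \<tau> * g \<tau>) \<le> norm (C * cmod (f \<tau>))"
  proof (rule AE_I2)
    fix \<tau> assume "\<tau> \<in> space circle"
    then have t: "cmod (g \<tau>) \<le> C" by (intro le) simp
    then have "0 \<le> C" using norm_ge_zero order_trans by blast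
    with mult_right_mono[OF t norm_ge_zero[of "f \<tau>"]]
    show "cmod (f \<tau> * g \<tau>) \<le> norm (C * cmod (f \<tau>))"
      by (simp add: norm_mult mult.commute)
  qed
qed

lemma integrable_circle_powi:
  assumes "integrable circle f"
  shows "integrable circle (\<lambda>\<tau>. f \<tau> * \<tau> powi n)"
  by (rule integrable_circle_mult_bounded[OF assms, where C=1]) (auto simp: norm_power_int)

lemma circle_nonzero: "cmod \<tau> = 1 \<Longrightarrow> \<tau> \<noteq> 0"
  by auto

lemma cnj_circle: "cmod \<tau> = 1 \<Longrightarrow> cnj \<tau> = inverse \<tau>"
  using divide_conv_cnj[of \<tau> 1] by (simp add: inverse_eq_divide)

lemma fourier_null_cong:
  assumes "fourier_null f" "\<And>\<tau>. cmod \<tau> = 1 \<Longrightarrow> f \<tau> = g \<tau>"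
  shows "fourier_null g"
proof -
  have "integrable circle f \<longleftrightarrow> integrable circle g"
    using assms(2) by (intro Bochner_Integration.integrable_cong) auto
  moreover have "integral\<^sup>L circle (\<lambda>\<tau>. f \<tau> * \<tau> powi n) = integral\<^sup>L circle (\<lambda>\<tau>. g \<tau> * \<tau> powi n)" for n
    using assms(2) by (intro Bochner_Integration.integral_cong) auto
  ultimately show ?thesis using assms(1) by (simp add: fourier_null_def)
qed

lemma fourier_null_cmult:
  assumes "fourier_null f" shows "fourier_null (\<lambda>\<tau>. f \<tau> * c)"
proof -
  have eq: "f \<tau> * c * \<tau> powi n = f \<tau> * \<tau> powi n * c" for \<tau> n
    by (simp add: ac_simps)
  show ?thesis
    using assms unfolding fourier_null_def eq by simp
qed

lemma fourier_null_add:
  "fourier_null f \<Longrightarrow> fourier_null g \<Longrightarrow> fourier_null (\<lambda>\<tau>. f \<tau> + g \<tau>)"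
  by (simp add: fourier_null_def distrib_right integrable_circle_powi)

lemma fourier_null_shift:
  assumes "fourier_null f"
  shows "fourier_null (\<lambda>\<tau>. f \<tau> * \<tau> powi k)"
  unfolding fourier_null_def
proof (intro conjI allI)
  show "integrable circle (\<lambda>\<tau>. f \<tau> * \<tau> powi k)"
    using assms by (simp add: fourier_null_def integrable_circle_powi)
  fix n
  have "integral\<^sup>L circle (\<lambda>\<tau>. f \<tau> * \<tau> powi k * \<tau> powi n)
      = integral\<^sup>L circle (\<lambda>\<tau>. f \<tau> * \<tau> powi (k + n))"
    by (intro Bochner_Integration.integral_cong) (auto simp: power_int_add circle_nonzero)
  then show "integral\<^sup>L circle (\<lambda>\<tau>. f \<tau> * \<tau> powi k * \<tau> powi n) = 0"
    using assms by (simp add: fourier_null_def)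
qed

text \<open>On the circle the real and imaginary parts of \<open>\<tau>\<close> are combinations of \<open>\<tau>\<close> and \<open>1 / \<tau>\<close>, and multiplying
  by these only shifts the coefficients. Products of polynomials are handled one factor at a time,
  so the induction has to run over all \<open>f\<close> at once.\<close>

lemma fourier_null_real_polynomial:
  assumes "real_polynomial_function p" "fourier_null f"
  shows "fourier_null (\<lambda>\<tau>. f \<tau> * complex_of_real (p \<tau>))"
  using assms
proof (induction arbitrary: f rule: real_polynomial_function.induct)
  case (linear l)
  interpret l: bounded_linear l by (rule linear)
  define a where "a = (of_real (l 1) - \<i> * of_real (l \<i>)) / 2"
  define b where "b = (of_real (l 1) + \<i> * of_real (l \<i>)) / 2"
  have "f \<tau> * complex_of_real (l \<tau>) = f \<tau> * \<tau> powi 1 * a + f \<tau> * \<tau> powi (-1) * b"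
    if "cmod \<tau> = 1" for \<tau>
  proof -
    have "\<tau> = Re \<tau> *\<^sub>R 1 + Im \<tau> *\<^sub>R \<i>"
      by (simp add: complex_eq_iff)
    then have "l \<tau> = Re \<tau> * l 1 + Im \<tau> * l \<i>"
      by (metis l.add l.scaleR real_scaleR_def)
    then have "complex_of_real (l \<tau>) = \<tau> * a + cnj \<tau> * b"
      by (simp add: a_def b_def complex_eq_iff field_simps)
    then show ?thesis
      using cnj_circle[OF that] by (simp add: power_int_minus algebra_simps)
  qed
  moreover have "fourier_null (\<lambda>\<tau>. f \<tau> * \<tau> powi 1 * a + f \<tau> * \<tau> powi (-1) * b)"
    by (intro fourier_null_add fourier_null_cmult fourier_null_shift linear)
  ultimately show ?case
    using fourier_null_cong by (metis (no_types, lifting))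
next
  case (add p q)
  then show ?case
    using fourier_null_add[of "\<lambda>\<tau>. f \<tau> * complex_of_real (p \<tau>)" "\<lambda>\<tau>. f \<tau> * complex_of_real (q \<tau>)"]
    by (simp add: distrib_left)
next
  case (mult p q)
  then have "fourier_null (\<lambda>\<tau>. f \<tau> * complex_of_real (p \<tau>) * complex_of_real (q \<tau>))" by blast
  then show ?case by (simp add: mult.assoc)
qed (rule fourier_null_cmult)

text \<open>Real polynomials are uniformly dense in the continuous functions, by Stone--Weierstrass.\<close>

lemma fourier_null_continuous:
  fixes g :: "complex \<Rightarrow> real"
  assumes f: "fourier_null f" and g: "continuous_on (sphere 0 1) g"
  shows "integral\<^sup>L circle (\<lambda>\<tau>. f \<tau> * complex_of_real (g \<tau>)) = 0"
proof -
  have int: "integrable circle f" using f by (simp add: fourier_null_def)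
  define K where "K = integral\<^sup>L circle (\<lambda>\<tau>. cmod (f \<tau>))"
  have K: "K \<ge> 0" by (simp add: K_def)
  have bound: "cmod (integral\<^sup>L circle (\<lambda>\<tau>. f \<tau> * complex_of_real (g \<tau>))) \<le> e * K" if "e > 0" for e
  proof -
    obtain p where p: "real_polynomial_function p" "\<And>\<tau>. \<tau> \<in> sphere 0 1 \<Longrightarrow> \<bar>g \<tau> - p \<tau>\<bar> < e"
      using Stone_Weierstrass_real_polynomial_function[OF compact_sphere g \<open>e > 0\<close>] by blast
    have "continuous_on (sphere 0 1) p"
      using p(1) by (metis continuous_on_polymonial_function real_polynomial_function_eq)
    with g have meas: "(\<lambda>\<tau>. complex_of_real (g \<tau> - p \<tau>)) \<in> borel_measurable circle"
      by (intro borel_measurable_circle_continuous continuous_intros)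
    have le: "cmod (complex_of_real (g \<tau> - p \<tau>)) \<le> e" if "cmod \<tau> = 1" for \<tau>
      using p(2)[of \<tau>] that unfolding norm_of_real by simp
    have p0: "integrable circle (\<lambda>\<tau>. f \<tau> * complex_of_real (p \<tau>))"
      "integral\<^sup>L circle (\<lambda>\<tau>. f \<tau> * complex_of_real (p \<tau>)) = 0"
      using fourier_null_real_polynomial[OF p(1) f]
      by (auto simp: fourier_null_def dest: spec[of _ 0])
    have i: "integrable circle (\<lambda>\<tau>. f \<tau> * complex_of_real (g \<tau> - p \<tau>))"
      by (rule integrable_circle_mult_bounded[OF int meas le])
    have "integral\<^sup>L circle (\<lambda>\<tau>. f \<tau> * complex_of_real (g \<tau>))
        = integral\<^sup>L circle (\<lambda>\<tau>. f \<tau> * complex_of_real (g \<tau> - p \<tau>) + f \<tau> * complex_of_real (p \<tau>))"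
      by (simp add: algebra_simps)
    also have "\<dots> = integral\<^sup>L circle (\<lambda>\<tau>. f \<tau> * complex_of_real (g \<tau> - p \<tau>))"
      by (subst Bochner_Integration.integral_add[OF i p0(1)]) (simp only: p0(2) add_0_right)
    also have "cmod \<dots> \<le> integral\<^sup>L circle (\<lambda>\<tau>. cmod (f \<tau> * complex_of_real (g \<tau> - p \<tau>)))"
      by (rule integral_norm_bound)
    also have "\<dots> \<le> integral\<^sup>L circle (\<lambda>\<tau>. e * cmod (f \<tau>))"
    proof (rule integral_mono)
      show "integrable circle (\<lambda>\<tau>. cmod (f \<tau> * complex_of_real (g \<tau> - p \<tau>)))"
        using i by (rule integrable_norm)
      show "integrable circle (\<lambda>\<tau>. e * cmod (f \<tau>))" using int by simp
      fix \<tau> assume "\<tau> \<in> space circle"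
      then have "cmod (complex_of_real (g \<tau> - p \<tau>)) \<le> e" by (intro le) simp
      from mult_left_mono[OF this norm_ge_zero[of "f \<tau>"]]
      show "cmod (f \<tau> * complex_of_real (g \<tau> - p \<tau>)) \<le> e * cmod (f \<tau>)"
        by (simp only: norm_mult mult.commute)
    qed
    also have "\<dots> = e * K" by (simp add: K_def)
    finally show ?thesis .
  qed
  have "cmod (integral\<^sup>L circle (\<lambda>\<tau>. f \<tau> * complex_of_real (g \<tau>))) \<le> 0"
  proof (rule field_le_epsilon)
    fix e :: real assume "e > 0"
    then have "e / (K + 1) > 0" using K by simp
    from bound[OF this] have "cmod (integral\<^sup>L circle (\<lambda>\<tau>. f \<tau> * complex_of_real (g \<tau>))) \<le> e / (K + 1) * K" .
    also have "\<dots> \<le> e" using K \<open>e > 0\<close> by (simp add: field_simps)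
    finally show "cmod (integral\<^sup>L circle (\<lambda>\<tau>. f \<tau> * complex_of_real (g \<tau>))) \<le> 0 + e" by simp
  qed
  then show ?thesis by simp
qed

text \<open>The indicator of a closed set is a bounded pointwise limit of continuous functions.\<close>

lemma fourier_null_closed:
  assumes f: "fourier_null f" and C: "closed C"
  shows "integral\<^sup>L circle (\<lambda>\<tau>. indicator C \<tau> *\<^sub>R f \<tau>) = 0"
proof (cases "C = {}")
  case False
  have int: "integrable circle f" using f by (simp add: fourier_null_def)
  then have fm [measurable]: "f \<in> borel_measurable circle" by simp
  define g where "g n \<tau> = max 0 (1 - real n * infdist \<tau> C)" for n \<tau>
  have gc: "continuous_on S (g n)" for S n
    unfolding g_def by (intro continuous_intros)
  have g1: "\<bar>g n \<tau>\<bar> \<le> 1" for n \<tau>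
    using mult_nonneg_nonneg[OF of_nat_0_le_iff infdist_nonneg, of n \<tau> C] by (simp add: g_def)
  have lim: "(\<lambda>n. g n \<tau>) \<longlonglongrightarrow> indicator C \<tau>" for \<tau>
  proof (cases "\<tau> \<in> C")
    case True
    then show ?thesis by (simp add: g_def)
  next
    case notin: False
    then have d: "infdist \<tau> C > 0"
      using in_closed_iff_infdist_zero[OF C False] infdist_nonneg[of \<tau> C] by (simp add: less_le)
    obtain N where N: "1 < real N * infdist \<tau> C"
      using reals_Archimedean3[OF d] by blast
    have "g n \<tau> = 0" if "n \<ge> N" for n
    proof -
      have "real N * infdist \<tau> C \<le> real n * infdist \<tau> C"
        using that d by (intro mult_right_mono) auto
      then have "1 - real n * infdist \<tau> C \<le> 0" using N by linarith
      then show ?thesis by (simp only: g_def max_absorb1)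
    qed
    then have "\<forall>\<^sub>F n in sequentially. g n \<tau> = indicator C \<tau>"
      using notin unfolding eventually_sequentially by auto
    then show ?thesis by (rule tendsto_eventually)
  qed
  have meas: "(\<lambda>\<tau>. complex_of_real (g n \<tau>)) \<in> borel_measurable circle" for n
    by (intro borel_measurable_circle_continuous continuous_on_of_real gc)
  have "(\<lambda>n. integral\<^sup>L circle (\<lambda>\<tau>. f \<tau> * complex_of_real (g n \<tau>)))
      \<longlonglongrightarrow> integral\<^sup>L circle (\<lambda>\<tau>. indicator C \<tau> *\<^sub>R f \<tau>)"
  proof (rule integral_dominated_convergence[where w = "\<lambda>\<tau>. cmod (f \<tau>)"])
    have "C \<in> sets borel" using C by simp
    then have "(indicator C :: complex \<Rightarrow> real) \<in> borel_measurable circle"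
      by (subst measurable_cong_sets[OF sets_circle refl])
         (intro measurable_restrict_space1 borel_measurable_indicator)
    then show "(\<lambda>\<tau>. indicator C \<tau> *\<^sub>R f \<tau>) \<in> borel_measurable circle"
      by (intro borel_measurable_scaleR fm)
    show "(\<lambda>\<tau>. f \<tau> * complex_of_real (g n \<tau>)) \<in> borel_measurable circle" for n
      by (intro borel_measurable_times fm meas)
    show "AE \<tau> in circle. (\<lambda>n. f \<tau> * complex_of_real (g n \<tau>)) \<longlonglongrightarrow> indicator C \<tau> *\<^sub>R f \<tau>"
    proof (rule AE_I2)
      fix \<tau>
      have "(\<lambda>n. f \<tau> * complex_of_real (g n \<tau>)) \<longlonglongrightarrow> f \<tau> * complex_of_real (indicator C \<tau>)"
        by (intro tendsto_intros lim)
      then show "(\<lambda>n. f \<tau> * complex_of_real (g n \<tau>)) \<longlonglongrightarrow> indicator C \<tau> *\<^sub>R f \<tau>"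
        by (simp add: scaleR_conv_of_real mult.commute)
    qed
    show "AE \<tau> in circle. norm (f \<tau> * complex_of_real (g n \<tau>)) \<le> cmod (f \<tau>)" for n
      using g1 by (auto simp: norm_mult mult_left_le)
  qed (use int in simp)
  moreover have "integral\<^sup>L circle (\<lambda>\<tau>. f \<tau> * complex_of_real (g n \<tau>)) = 0" for n
    by (rule fourier_null_continuous[OF f gc])
  ultimately show ?thesis by (simp add: LIMSEQ_const_iff)
qed simp

text \<open>The closed sets are stable under intersection and generate the Borel sets, so \<open>f\<close> has integral 0 over
  every Borel set.\<close>

theorem fourier_null_imp_AE_0:
  assumes f: "fourier_null f"
  shows "AE \<tau> in circle. f \<tau> = 0"
proof (rule circle.density_zero)
  show int: "integrable circle f" using f by (simp add: fourier_null_def)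
  fix A assume "A \<in> sets circle"
  then obtain B where B: "B \<in> sets borel" "A = sphere 0 1 \<inter> B"
    by (auto simp: sets_circle sets_restrict_space)
  have sets: "sphere 0 1 \<inter> X \<in> sets circle" if "X \<in> sigma_sets UNIV (Collect closed)" for X
    using that by (auto simp: sets_circle sets_restrict_space borel_eq_closed)
  have int_on: "set_integrable circle X f" if "X \<in> sets circle" for X
    unfolding set_integrable_def by (rule integrable_mult_indicator[OF that int])
  have "B \<in> sigma_sets UNIV (Collect closed)" using B(1) by (simp add: borel_eq_closed)
  then have "set_lebesgue_integral circle (sphere 0 1 \<inter> B) f = 0"
  proof (rule sigma_sets_induct_disjoint[rotated 2])
    show "Int_stable (Collect (closed :: complex set \<Rightarrow> bool))" by (auto simp: Int_stable_def)
  next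
    fix C :: "complex set" assume "C \<in> Collect closed"
    then have "closed (sphere 0 1 \<inter> C)" by auto
    from fourier_null_closed[OF f this] show "set_lebesgue_integral circle (sphere 0 1 \<inter> C) f = 0"
      by (simp add: set_lebesgue_integral_def)
  next
    fix X assume X: "X \<in> sigma_sets UNIV (Collect closed)"
      "set_lebesgue_integral circle (sphere 0 1 \<inter> X) f = 0"
    have "set_lebesgue_integral circle (sphere 0 1 \<inter> (UNIV - X)) f
        = integral\<^sup>L circle (\<lambda>\<tau>. f \<tau> - indicator (sphere 0 1 \<inter> X) \<tau> *\<^sub>R f \<tau>)"
      unfolding set_lebesgue_integral_def
      by (intro Bochner_Integration.integral_cong) (auto simp: indicator_def)
    also have "\<dots> = integral\<^sup>L circle f - set_lebesgue_integral circle (sphere 0 1 \<inter> X) f"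
      using int_on[OF sets[OF X(1)]] int
      by (simp add: set_lebesgue_integral_def set_integrable_def)
    also have "\<dots> = 0" using f X(2) by (auto simp: fourier_null_def dest: spec[of _ 0])
    finally show "set_lebesgue_integral circle (sphere 0 1 \<inter> (UNIV - X)) f = 0" .
  next
    fix X :: "nat \<Rightarrow> complex set"
    assume X: "disjoint_family X" "range X \<subseteq> sigma_sets UNIV (Collect closed)"
      "\<And>i. set_lebesgue_integral circle (sphere 0 1 \<inter> X i) f = 0"
    have Xs: "sphere 0 1 \<inter> X i \<in> sets circle" for i using X(2) by (intro sets) auto
    have eq: "sphere 0 1 \<inter> (\<Union>i. X i) = (\<Union>i. sphere 0 1 \<inter> X i)" by auto
    have "set_lebesgue_integral circle (\<Union>i. sphere 0 1 \<inter> X i) f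
        = (\<Sum>i. set_lebesgue_integral circle (sphere 0 1 \<inter> X i) f)"
    proof (rule lebesgue_integral_countable_add[OF Xs])
      show "(sphere 0 1 \<inter> X i) \<inter> (sphere 0 1 \<inter> X j) = {}" if "i \<noteq> j" for i j
      proof -
        have "X i \<inter> X j = {}" using X(1) that unfolding disjoint_family_on_def by blast
        then show ?thesis by blast
      qed
      show "set_integrable circle (\<Union>i. sphere 0 1 \<inter> X i) f"
        by (intro int_on sets.countable_UN image_subsetI Xs)
    qed
    then show "set_lebesgue_integral circle (sphere 0 1 \<inter> (\<Union>i. X i)) f = 0"
      unfolding eq X(3) by simp
  qed (auto simp: set_lebesgue_integral_def)
  then show "set_lebesgue_integral circle A f = 0" by (simp add: B(2))
qed

section \<open>The sesquilinear inner product\<close>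

text \<open>The complex inner product of \<open>L\<^sup>2\<close>, on representatives; \<open>inner\<close> is its real part.\<close>

definition cinner :: "(complex \<Rightarrow> complex) \<Rightarrow> (complex \<Rightarrow> complex) \<Rightarrow> complex" where
  "cinner f g = integral\<^sup>L circle (\<lambda>\<tau>. f \<tau> * cnj (g \<tau>))"

lemma inner_abs_circle_L2:
  assumes "square_integrable f" "square_integrable g"
  shows "inner (abs_circle_L2 f) (abs_circle_L2 g) = Re (cinner f g)"
  using assms by (simp add: inner_circle_L2.abs_eq L2_eq_def cinner_def)

lemma abs_circle_L2_eq_iff:
  assumes "square_integrable f" "square_integrable g"
  shows "abs_circle_L2 f = abs_circle_L2 g \<longleftrightarrow> (AE \<tau> in circle. f \<tau> = g \<tau>)"
  using Quotient3_rel[OF Quotient3_circle_L2, of f g] assms by (simp add: L2_eq_def)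

lemma scaleC_abs_circle_L2:
  "square_integrable f \<Longrightarrow> c *\<^sub>C abs_circle_L2 f = abs_circle_L2 (\<lambda>\<tau>. c * f \<tau>)"
  by (simp add: scaleC_circle_L2.abs_eq L2_eq_def)

lemma add_abs_circle_L2:
  assumes "square_integrable f" "square_integrable g"
  shows "abs_circle_L2 f + abs_circle_L2 g = abs_circle_L2 (\<lambda>\<tau>. f \<tau> + g \<tau>)"
  using assms by (intro plus_circle_L2.abs_eq) (auto simp: L2_eq_def)

lemma zero_abs_circle_L2: "0 = abs_circle_L2 (\<lambda>_. 0)"
  using norm_circle_L2[OF square_integrable_0] by simp

lemma cinner_cong:
  "(\<And>\<tau>. cmod \<tau> = 1 \<Longrightarrow> f \<tau> * cnj (g \<tau>) = f' \<tau> * cnj (g' \<tau>)) \<Longrightarrow> cinner f g = cinner f' g'"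
  unfolding cinner_def by (intro Bochner_Integration.integral_cong) auto

lemma cinner_diff_left:
  "square_integrable f \<Longrightarrow> square_integrable g \<Longrightarrow> square_integrable h \<Longrightarrow>
    cinner (\<lambda>\<tau>. f \<tau> - g \<tau>) h = cinner f h - cinner g h"
  by (simp add: cinner_def left_diff_distrib integrable_mult_cnj)

lemma cinner_cmult_right: "cinner f (\<lambda>\<tau>. c * g \<tau>) = cnj c * cinner f g"
proof -
  have eq: "f \<tau> * cnj (c * g \<tau>) = cnj c * (f \<tau> * cnj (g \<tau>))" for \<tau> by simp
  show ?thesis unfolding cinner_def eq by (rule integral_mult_right_zero)
qed

lemma cinner_cmult_left: "cinner (\<lambda>\<tau>. c * f \<tau>) g = c * cinner f g"
  unfolding cinner_def by (simp add: mult.assoc)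

lemma cinner_cnj: "cnj (cinner f g) = cinner g f"
  unfolding cinner_def by (subst Bochner_Integration.integral_cnj[symmetric]) (simp add: mult.commute)

lemma square_integrable_powi_mult:
  assumes "square_integrable f"
  shows "square_integrable (\<lambda>\<tau>. \<tau> powi n * f \<tau>)"
proof (rule square_integrable_dominated[OF _ assms, where C=1])
  show "(\<lambda>\<tau>. \<tau> powi n * f \<tau>) \<in> borel_measurable circle"
    using assms by (intro borel_measurable_times borel_measurable_circle_powi) (simp add: square_integrable_def)
qed (auto simp: norm_mult norm_power_int)

lemma square_integrable_powi: "square_integrable (\<lambda>\<tau>. \<tau> powi n)"
  using square_integrable_powi_mult[of "\<lambda>_. 1" n] by (simp add: square_integrable_def)

lemma cnj_powi_circle: "cmod \<tau> = 1 \<Longrightarrow> cnj (\<tau> powi n) = \<tau> powi (- n)"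
  by (simp add: cnj_circle power_int_minus power_int_inverse)

lemma cinner_powi_shift: "cinner (\<lambda>\<tau>. \<tau> powi n * f \<tau>) g = cinner f (\<lambda>\<tau>. \<tau> powi (- n) * g \<tau>)"
  by (rule cinner_cong) (simp add: cnj_powi_circle del: complex_cnj_power_int)

lemma powi_mult_powi: "cmod \<tau> = 1 \<Longrightarrow> \<tau> powi m * (\<tau> powi n * z) = \<tau> powi (m + n) * z"
  by (simp add: power_int_add circle_nonzero)

lemma fourier_coeff_abs_cinner:
  assumes "square_integrable f"
  shows "fourier_coeff (abs_circle_L2 f) n = cinner f (\<lambda>\<tau>. \<tau> powi n)"
  unfolding fourier_coeff_abs[OF assms] cinner_def
  by (intro Bochner_Integration.integral_cong)
     (simp_all add: cnj_powi_circle del: complex_cnj_power_int)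

lemma fourier_coeff_powi_mult:
  assumes "square_integrable f"
  shows "fourier_coeff (abs_circle_L2 (\<lambda>\<tau>. \<tau> powi k * f \<tau>)) n = fourier_coeff (abs_circle_L2 f) (n - k)"
  unfolding fourier_coeff_abs_cinner[OF assms] fourier_coeff_abs_cinner[OF square_integrable_powi_mult[OF assms]]
    cinner_powi_shift
  by (rule cinner_cong) (simp add: circle_nonzero flip: power_int_add)

text \<open>This recovers statements about the complex inner product from its real part, by varying a scalar
  factor.\<close>

lemma Re_mult_all_eq_0:
  assumes "\<And>c. Re (c * w) = 0"
  shows "w = 0"
  using assms[of 1] assms[of \<i>] by (simp add: complex_eq_iff)

lemma fourier_coeff_zero_imp:
  assumes "\<And>n. fourier_coeff u n = 0"
  shows "u = 0"
proof (cases u rule: abs_circle_L2_cases)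
  case (1 f)
  have "fourier_null f"
    unfolding fourier_null_def
  proof (intro conjI allI)
    show "integrable circle f" by (rule integrable_square_integrable[OF 1(1)])
    show "integral\<^sup>L circle (\<lambda>\<tau>. f \<tau> * \<tau> powi n) = 0" for n
      using assms[of "- n"] by (simp only: 1(2) fourier_coeff_abs[OF 1(1)] minus_minus)
  qed
  then have "AE \<tau> in circle. f \<tau> = 0" by (rule fourier_null_imp_AE_0)
  then show ?thesis
    using abs_circle_L2_eq_iff[OF 1(1) square_integrable_0] by (simp add: 1(2) zero_abs_circle_L2)
qed

lemma fourier_coeff_diff: "fourier_coeff (f - g) n = fourier_coeff f n - fourier_coeff g n"
  by (simp add: linear_diff[OF bounded_linear.linear[OF bounded_linear_fourier_coeff]])

lemma fourier_coeff_eqI: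
  assumes "\<And>n. fourier_coeff u n = fourier_coeff v n"
  shows "u = v"
  using fourier_coeff_zero_imp[of "u - v"] assms by (simp add: fourier_coeff_diff)

section \<open>Hardy functions vanish almost nowhere\<close>

text \<open>The argument of Helson and Lowdenslager. Let \<open>N\<close> be the orthogonal complement of the functions
  \<open>z\<^sup>m f\<close> with \<open>m \<ge> 1\<close>, and let \<open>g\<close> be the projection of \<open>f\<close> to \<open>N\<close>. For \<open>n \<ge> 1\<close> the function \<open>z\<^bsup>- n\<^esup> g\<close> is again
  in \<open>N\<close>, which gives \<open>\<langle>g, z\<^bsup>- n\<^esup> g\<rangle> = \<langle>f, z\<^bsup>- n\<^esup> g\<rangle> = \<langle>z\<^sup>n f, g\<rangle> = 0\<close>; hence \<open>\<bar>g\<bar>\<^sup>2\<close> has no Fourier coefficients besides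
  the constant one and is constant. The constant is not 0, since \<open>f\<close> is not orthogonal to \<open>N\<close>: the
  monomial of lowest degree occurring in \<open>f\<close> lies in \<open>N\<close>. But the restriction of \<open>g\<close> to the zero set of
  \<open>f\<close> lies in \<open>N\<close> as well and is orthogonal to \<open>f\<close>, hence to \<open>g\<close>. So \<open>g\<close> vanishes on that set, and the
  set is null.\<close>

theorem hardy_nonzero_AE:
  assumes f: "square_integrable f"
    and hardy: "\<And>n. n < 0 \<Longrightarrow> fourier_coeff (abs_circle_L2 f) n = 0"
    and nz: "abs_circle_L2 f \<noteq> 0"
  shows "AE \<tau> in circle. f \<tau> \<noteq> 0"
proof -
  define F where "F m = (\<lambda>\<tau>. \<tau> powi int m * f \<tau>)" for m
  have F: "square_integrable (F m)" for m
    unfolding F_def by (rule square_integrable_powi_mult[OF f])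
  define N where "N = {u. \<forall>m\<ge>1. \<forall>c. inner u (c *\<^sub>C abs_circle_L2 (F m)) = 0}"
  have N_iff: "abs_circle_L2 U \<in> N \<longleftrightarrow> (\<forall>m\<ge>1. cinner U (F m) = 0)" if U: "square_integrable U" for U
  proof
    assume "abs_circle_L2 U \<in> N"
    then have *: "Re (cnj c * cinner U (F m)) = 0" if "m \<ge> 1" for c m
      using that U F by (simp add: N_def scaleC_abs_circle_L2 inner_abs_circle_L2
          square_integrable_cmult cinner_cmult_right)
    show "\<forall>m\<ge>1. cinner U (F m) = 0"
    proof (intro allI impI Re_mult_all_eq_0)
      show "Re (c * cinner U (F m)) = 0" if "1 \<le> m" for c m
        using *[OF that, of "cnj c"] by simp
    qed
  next
    assume "\<forall>m\<ge>1. cinner U (F m) = 0"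
    then show "abs_circle_L2 U \<in> N"
      using U F by (simp add: N_def scaleC_abs_circle_L2 inner_abs_circle_L2
          square_integrable_cmult cinner_cmult_right)
  qed
  have subN: "subspace N"
    unfolding N_def by (auto simp: subspace_def inner_add_left)
  have closedN: "closed N"
  proof -
    have "N = (\<Inter>m\<in>{1..}. \<Inter>c. {u. inner u (c *\<^sub>C abs_circle_L2 (F m)) = 0})"
      by (auto simp: N_def)
    also have "closed \<dots>"
      by (intro closed_INT ballI closed_Collect_eq continuous_intros)
    finally show ?thesis .
  qed
  obtain g where g: "g \<in> N" "\<And>u. u \<in> N \<Longrightarrow> inner (abs_circle_L2 f - g) u = 0"
    using orthogonal_projection_exists[OF subN closedN, of "abs_circle_L2 f"] by blast
  obtain G where G: "square_integrable G" "g = abs_circle_L2 G"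
    by (rule abs_circle_L2_cases)
  have GF: "cinner G (F m) = 0" if "m \<ge> 1" for m
    using g(1) that by (simp add: G N_iff[OF G(1)])
  have proj: "cinner f U = cinner G U" if U: "square_integrable U" and N: "\<And>m. m \<ge> 1 \<Longrightarrow> cinner U (F m) = 0" for U
  proof -
    have "Re (cnj c * (cinner f U - cinner G U)) = 0" for c
    proof -
      have cU: "square_integrable (\<lambda>\<tau>. c * U \<tau>)" by (rule square_integrable_cmult[OF U])
      have "abs_circle_L2 (\<lambda>\<tau>. c * U \<tau>) \<in> N"
        using N by (simp add: N_iff[OF cU] cinner_cmult_left)
      from g(2)[OF this] show ?thesis
        by (simp add: G abs_circle_L2_diff[OF f G(1)] inner_abs_circle_L2 square_integrable_diff f cU
            cinner_cmult_right cinner_diff_left U)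
    qed
    then have "Re (c * (cinner f U - cinner G U)) = 0" for c
      by (metis complex_cnj_cnj)
    then have "cinner f U - cinner G U = 0" by (rule Re_mult_all_eq_0)
    then show ?thesis by simp
  qed
  have GG: "cinner G (\<lambda>\<tau>. \<tau> powi (- int n) * G \<tau>) = 0" if n: "n \<ge> 1" for n
  proof -
    have "cinner f (\<lambda>\<tau>. \<tau> powi (- int n) * G \<tau>) = cinner G (\<lambda>\<tau>. \<tau> powi (- int n) * G \<tau>)"
    proof (rule proj)
      show "square_integrable (\<lambda>\<tau>. \<tau> powi (- int n) * G \<tau>)" by (rule square_integrable_powi_mult[OF G(1)])
      fix m :: nat assume "m \<ge> 1"
      have "cinner (\<lambda>\<tau>. \<tau> powi (- int n) * G \<tau>) (F m) = cinner G (F (n + m))"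
        unfolding cinner_powi_shift by (rule cinner_cong) (simp only: F_def powi_mult_powi minus_minus of_nat_add)
      then show "cinner (\<lambda>\<tau>. \<tau> powi (- int n) * G \<tau>) (F m) = 0" using GF[of "n + m"] n by simp
    qed
    moreover have "cinner f (\<lambda>\<tau>. \<tau> powi (- int n) * G \<tau>) = cnj (cinner G (F n))"
      unfolding cinner_cnj F_def cinner_powi_shift ..
    ultimately show ?thesis using GF[OF n] by simp
  qed
  define \<kappa> where "\<kappa> = cinner G G"
  have "fourier_null (\<lambda>\<tau>. G \<tau> * cnj (G \<tau>) - \<kappa>)"
    unfolding fourier_null_def
  proof (intro conjI allI)
    have iG: "integrable circle (\<lambda>\<tau>. G \<tau> * cnj (G \<tau>))" by (rule integrable_mult_cnj[OF G(1) G(1)])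
    then show "integrable circle (\<lambda>\<tau>. G \<tau> * cnj (G \<tau>) - \<kappa>)" by simp
    fix n
    have pw: "integral\<^sup>L circle (\<lambda>\<tau>. G \<tau> * cnj (G \<tau>) * \<tau> powi n) = cinner G (\<lambda>\<tau>. \<tau> powi (- n) * G \<tau>)"
      unfolding cinner_def by (intro Bochner_Integration.integral_cong)
        (simp_all add: cnj_powi_circle mult_ac del: complex_cnj_power_int)
    have "cinner G (\<lambda>\<tau>. \<tau> powi (- n) * G \<tau>) = (if n = 0 then \<kappa> else 0)"
    proof (cases n "0::int" rule: linorder_cases)
      case less
      have "cinner G (\<lambda>\<tau>. \<tau> powi (- n) * G \<tau>) = cnj (cinner G (\<lambda>\<tau>. \<tau> powi n * G \<tau>))"
        unfolding cinner_cnj cinner_powi_shift ..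
      then show ?thesis using GG[of "nat (- n)"] less by simp
    next
      case greater
      then show ?thesis using GG[of "nat n"] by simp
    qed (simp add: \<kappa>_def)
    then show "integral\<^sup>L circle (\<lambda>\<tau>. (G \<tau> * cnj (G \<tau>) - \<kappa>) * \<tau> powi n) = 0"
      using integrable_circle_powi[OF iG, of n] integrable_circle_powi[of "\<lambda>_. 1" n]
      by (simp add: left_diff_distrib pw integral_circle_powi)
  qed
  then have const: "AE \<tau> in circle. G \<tau> * cnj (G \<tau>) = \<kappa>"
    using fourier_null_imp_AE_0 by fastforce
  have \<kappa>0: "\<kappa> \<noteq> 0"
  proof
    assume "\<kappa> = 0"
    with const have "AE \<tau> in circle. G \<tau> = 0" by simp
    then have g0: "cinner G U = 0" for U
      unfolding cinner_def by (intro integral_eq_zero_AE) auto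
    have "\<exists>k. fourier_coeff (abs_circle_L2 f) (int k) \<noteq> 0"
    proof (rule ccontr)
      assume "\<nexists>k. fourier_coeff (abs_circle_L2 f) (int k) \<noteq> 0"
      then have "fourier_coeff (abs_circle_L2 f) n = 0" for n
        using hardy[of n] by (cases "n < 0") (simp, metis int_nat_eq not_less)
      then show False using fourier_coeff_zero_imp nz by blast
    qed
    then obtain k where k: "fourier_coeff (abs_circle_L2 f) (int k) \<noteq> 0"
      and min: "\<And>j. j < k \<Longrightarrow> fourier_coeff (abs_circle_L2 f) (int j) = 0"
      unfolding exists_least_iff[of "\<lambda>k. fourier_coeff (abs_circle_L2 f) (int k) \<noteq> 0"] by blast
    have "cinner f (\<lambda>\<tau>. \<tau> powi int k) = cinner G (\<lambda>\<tau>. \<tau> powi int k)"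
    proof (rule proj[OF square_integrable_powi])
      fix m :: nat assume m: "m \<ge> 1"
      have "cinner (\<lambda>\<tau>. \<tau> powi int k) (F m) = cnj (fourier_coeff (abs_circle_L2 (F m)) (int k))"
        by (simp add: fourier_coeff_abs_cinner[OF F] cinner_cnj)
      also have "\<dots> = cnj (fourier_coeff (abs_circle_L2 f) (int k - int m))"
        unfolding F_def fourier_coeff_powi_mult[OF f] ..
      also have "fourier_coeff (abs_circle_L2 f) (int k - int m) = 0"
      proof (cases "m \<le> k")
        case True
        then show ?thesis using min[of "k - m"] m by (simp add: of_nat_diff)
      qed (intro hardy, simp)
      finally show "cinner (\<lambda>\<tau>. \<tau> powi int k) (F m) = 0" by simp
    qed
    then show False using k by (simp add: g0 fourier_coeff_abs_cinner[OF f])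
  qed
  define U where "U \<tau> = (if f \<tau> = 0 then G \<tau> else 0)" for \<tau>
  have fm: "f \<in> borel_measurable circle" and Gm: "G \<in> borel_measurable circle"
    using f G(1) by (simp_all add: square_integrable_def)
  have Um: "U \<in> borel_measurable circle"
    unfolding U_def[abs_def] using fm Gm by measurable
  have U: "square_integrable U"
    by (rule square_integrable_dominated[OF Um G(1), where C=1]) (simp add: U_def)
  have "cinner f U = cinner G U"
  proof (rule proj[OF U])
    have "cinner U (F m) = cinner (\<lambda>_. 0) (F m)" for m
      by (rule cinner_cong) (simp add: U_def F_def)
    then show "cinner U (F m) = 0" for m by (simp add: cinner_def)
  qed
  moreover have "cinner f U = cinner (\<lambda>_. 0) U"
    by (rule cinner_cong) (simp add: U_def)
  moreover have "cinner G U = cinner U U"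
    by (rule cinner_cong) (simp add: U_def)
  ultimately have "cinner U U = 0" by (simp add: cinner_def)
  then have "abs_circle_L2 U = 0"
    using inner_abs_circle_L2[OF U U] by simp
  then have "AE \<tau> in circle. U \<tau> = 0"
    using abs_circle_L2_eq_iff[OF U square_integrable_0] by (simp add: zero_abs_circle_L2)
  with const show ?thesis
  proof eventually_elim
    case (elim \<tau>)
    then show ?case using \<kappa>0 by (auto simp: U_def)
  qed
qed

section \<open>Toeplitz operators\<close>

lemma riesz_sum_hardy:
  assumes "\<And>n. n < 0 \<Longrightarrow> fourier_coeff h n = 0"
  shows "riesz_sum h = h"
  by (rule fourier_coeff_eqI) (use assms in \<open>simp add: fourier_coeff_riesz_sum\<close>)

text \<open>The difference \<open>g - riesz_sum g\<close> has no Fourier coefficients of nonnegative index, while \<open>h\<close> is the sum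
  of its monomials of nonnegative degree.\<close>

lemma inner_riesz_sum:
  assumes h: "\<And>n. n < 0 \<Longrightarrow> fourier_coeff h n = 0"
  shows "inner (riesz_sum g) h = inner g h"
proof -
  have "inner (g - riesz_sum g) h = inner (g - riesz_sum g) (riesz_sum h)"
    by (simp add: riesz_sum_hardy[OF h])
  also have "\<dots> = (\<Sum>n. inner (g - riesz_sum g) (fourier_coeff h (int n) *\<^sub>C monomial_L2 n))"
    unfolding riesz_sum_def[of h]
    by (rule bounded_linear.suminf[OF bounded_linear_inner_right summable_riesz])
  also have "\<dots> = 0"
    by (simp add: inner_monomial fourier_coeff_diff fourier_coeff_riesz_sum)
  finally show ?thesis by (simp add: inner_diff_left)
qed

lemma norm_riesz_sum_le: "norm (riesz_sum g) \<le> norm g"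
proof -
  have "(norm (riesz_sum g))\<^sup>2 = inner g (riesz_sum g)"
    unfolding power2_norm_eq_inner by (rule inner_riesz_sum) (simp add: fourier_coeff_riesz_sum)
  also have "\<dots> \<le> norm g * norm (riesz_sum g)" by (rule norm_cauchy_schwarz)
  finally show ?thesis
    by (cases "riesz_sum g = 0") (simp_all add: power2_eq_square)
qed

lemma riesz_sum_add: "riesz_sum (f + g) = riesz_sum f + riesz_sum g"
  by (rule fourier_coeff_eqI) (simp add: fourier_coeff_riesz_sum fourier_coeff_add)

lemma riesz_sum_scaleC: "riesz_sum (c *\<^sub>C f) = c *\<^sub>C riesz_sum f"
  by (rule fourier_coeff_eqI) (simp add: fourier_coeff_riesz_sum fourier_coeff_scaleC)

lemma mult_L2_add:
  assumes F: "F \<in> circle_Linf"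
  shows "mult_L2 F (u + v) = mult_L2 F u + mult_L2 F v"
proof -
  obtain f g where fg: "square_integrable f" "u = abs_circle_L2 f" "square_integrable g" "v = abs_circle_L2 g"
    by (metis abs_circle_L2_cases)
  then show ?thesis
    by (simp add: add_abs_circle_L2 mult_L2_abs[OF F] square_integrable_add square_integrable_mult[OF F]
        distrib_left)
qed

lemma mult_L2_scaleC:
  assumes F: "F \<in> circle_Linf"
  shows "mult_L2 F (c *\<^sub>C u) = c *\<^sub>C mult_L2 F u"
proof (cases u rule: abs_circle_L2_cases)
  case (1 f)
  then show ?thesis
    by (simp add: scaleC_abs_circle_L2 mult_L2_abs[OF F] square_integrable_cmult square_integrable_mult[OF F]
        mult.left_commute)
qed

lemma norm_mult_L2_le:
  assumes F: "F \<in> circle_Linf"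
  obtains C where "\<And>u. norm (mult_L2 F u) \<le> norm u * C"
proof -
  obtain C0 where C0: "AE \<tau> in circle. cmod (F \<tau>) \<le> C0"
    using F by (auto simp: circle_Linf_def)
  define C where "C = max C0 0"
  have C: "AE \<tau> in circle. cmod (F \<tau>) \<le> C" using C0 by eventually_elim (simp add: C_def)
  have C_nn: "C \<ge> 0" by (simp add: C_def)
  have "norm (mult_L2 F u) \<le> norm u * C" for u
  proof (cases u rule: abs_circle_L2_cases)
    case (1 f)
    note Ff = square_integrable_mult[OF F 1(1)]
    have "integral\<^sup>L circle (\<lambda>\<tau>. (cmod (F \<tau> * f \<tau>))\<^sup>2) \<le> integral\<^sup>L circle (\<lambda>\<tau>. C\<^sup>2 * (cmod (f \<tau>))\<^sup>2)"
    proof (rule integral_mono_AE)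
      show "integrable circle (\<lambda>\<tau>. (cmod (F \<tau> * f \<tau>))\<^sup>2)"
        using Ff by (simp add: square_integrable_def)
      show "integrable circle (\<lambda>\<tau>. C\<^sup>2 * (cmod (f \<tau>))\<^sup>2)"
        using 1(1) by (simp add: square_integrable_def)
      show "AE \<tau> in circle. (cmod (F \<tau> * f \<tau>))\<^sup>2 \<le> C\<^sup>2 * (cmod (f \<tau>))\<^sup>2"
        using C
      proof eventually_elim
        case (elim \<tau>)
        then have "(cmod (F \<tau> * f \<tau>))\<^sup>2 \<le> (C * cmod (f \<tau>))\<^sup>2"
          unfolding norm_mult by (intro power_mono mult_right_mono) auto
        then show ?case by (simp add: power_mult_distrib)
      qed
    qed
    then have "sqrt (integral\<^sup>L circle (\<lambda>\<tau>. (cmod (F \<tau> * f \<tau>))\<^sup>2))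
        \<le> sqrt (C\<^sup>2 * integral\<^sup>L circle (\<lambda>\<tau>. (cmod (f \<tau>))\<^sup>2))"
      by (intro real_sqrt_le_mono) simp
    also have "\<dots> = C * sqrt (integral\<^sup>L circle (\<lambda>\<tau>. (cmod (f \<tau>))\<^sup>2))"
      using C_nn by (simp add: real_sqrt_mult)
    finally show ?thesis
      unfolding 1(2) mult_L2_abs[OF F 1(1)] norm_circle_L2[OF Ff] norm_circle_L2[OF 1(1)]
      by (simp only: mult.commute)
  qed
  then show ?thesis by (rule that)
qed

lemma Rep_toeplitz: "Rep_hardy2 (toeplitz F f) = riesz_sum (mult_L2 F (Rep_hardy2 f))"
  by (simp add: toeplitz_def riesz_proj.rep_eq)

lemma hardy2_fourier_coeff: "n < 0 \<Longrightarrow> fourier_coeff (Rep_hardy2 f) n = 0"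
  using Rep_hardy2[of f] by simp

lemma toeplitz_bounded_clinear:
  assumes F: "F \<in> circle_Linf"
  shows "bounded_clinear (toeplitz F)"
proof -
  have sc: "toeplitz F (c *\<^sub>C f) = c *\<^sub>C toeplitz F f" for c f
    by (simp add: Rep_hardy2_inject[symmetric] scaleC_hardy2.rep_eq Rep_toeplitz mult_L2_scaleC[OF F]
        riesz_sum_scaleC)
  obtain C where C: "\<And>u. norm (mult_L2 F u) \<le> norm u * C"
    using norm_mult_L2_le[OF F] by blast
  have "bounded_linear (toeplitz F)"
  proof (rule bounded_linear_intro)
    show "toeplitz F (f + g) = toeplitz F f + toeplitz F g" for f g
      by (simp add: Rep_hardy2_inject[symmetric] plus_hardy2.rep_eq Rep_toeplitz mult_L2_add[OF F]
          riesz_sum_add)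
    show "toeplitz F (r *\<^sub>R f) = r *\<^sub>R toeplitz F f" for r f
      by (simp add: scaleR_scaleC sc)
    show "norm (toeplitz F f) \<le> norm f * C" for f
      unfolding norm_hardy2.rep_eq Rep_toeplitz
      by (rule order_trans[OF norm_riesz_sum_le C])
  qed
  with sc show ?thesis by (simp add: bounded_clinear_def)
qed

lemma inner_toeplitz:
  assumes F: "F \<in> circle_Linf"
    and f: "square_integrable f" "Rep_hardy2 u = abs_circle_L2 f"
    and g: "square_integrable g" "Rep_hardy2 v = abs_circle_L2 g"
  shows "inner (toeplitz F u) v = Re (cinner (\<lambda>\<tau>. F \<tau> * f \<tau>) g)"
proof -
  have "inner (toeplitz F u) v = inner (mult_L2 F (Rep_hardy2 u)) (Rep_hardy2 v)"
    unfolding inner_hardy2.rep_eq Rep_toeplitz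
    by (rule inner_riesz_sum) (rule hardy2_fourier_coeff)
  then show ?thesis
    by (simp add: f g mult_L2_abs[OF F f(1)] inner_abs_circle_L2 square_integrable_mult[OF F])
qed

lemma toeplitz_accretive:
  assumes F: "F \<in> circle_Linf" and pos: "AE \<tau> in circle. 0 \<le> Re (F \<tau>)"
  shows "0 \<le> inner (toeplitz F u) u"
proof -
  obtain f where f: "square_integrable f" "Rep_hardy2 u = abs_circle_L2 f"
    by (rule abs_circle_L2_cases)
  have "integrable circle (\<lambda>\<tau>. F \<tau> * f \<tau> * cnj (f \<tau>))"
    by (rule integrable_mult_cnj[OF square_integrable_mult[OF F f(1)] f(1)])
  then have "Re (cinner (\<lambda>\<tau>. F \<tau> * f \<tau>) f) = integral\<^sup>L circle (\<lambda>\<tau>. Re (F \<tau> * f \<tau> * cnj (f \<tau>)))"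
    by (simp only: cinner_def integral_Re)
  also have "\<dots> \<ge> 0"
  proof (rule integral_nonneg_AE)
    show "AE \<tau> in circle. 0 \<le> Re (F \<tau> * f \<tau> * cnj (f \<tau>))"
      using pos
    proof eventually_elim
      case (elim \<tau>)
      have eq: "F \<tau> * f \<tau> * cnj (f \<tau>) = F \<tau> * of_real ((cmod (f \<tau>))\<^sup>2)"
        by (simp only: mult.assoc complex_norm_square)
      have "Re (F \<tau> * of_real ((cmod (f \<tau>))\<^sup>2)) = Re (F \<tau>) * (cmod (f \<tau>))\<^sup>2"
        by (simp del: of_real_power)
      then show ?case unfolding eq using elim by (simp del: of_real_power)
    qed
  qed
  finally show ?thesis by (simp add: inner_toeplitz[OF F f f])
qed

text \<open>Let \<open>n \<ge> 0\<close>. That \<open>T u = 0\<close> is orthogonal to \<open>z\<^sup>n u\<close> says that the Fourier coefficient of \<open>F \<bar>u\<bar>\<^sup>2\<close> at \<open>n\<close>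
  vanishes; that \<open>T (z\<^sup>n u)\<close> is orthogonal to \<open>u\<close> says the same at \<open>- n\<close>. So \<open>F \<bar>u\<bar>\<^sup>2 = 0\<close> almost
  everywhere, while a nonzero \<open>u\<close> would vanish almost nowhere.\<close>

lemma toeplitz_kernel:
  assumes F: "F \<in> circle_Linf" and nz: "\<not> (AE \<tau> in circle. F \<tau> = 0)"
    and ker: "toeplitz F u = 0" and orth: "\<And>v. inner (toeplitz F v) u = 0"
  shows "u = 0"
proof (rule ccontr)
  assume u0: "u \<noteq> 0"
  obtain f where f: "square_integrable f" "Rep_hardy2 u = abs_circle_L2 f"
    by (rule abs_circle_L2_cases)
  note Ff = square_integrable_mult[OF F f(1)]
  have shift: "\<exists>v. Rep_hardy2 v = abs_circle_L2 (\<lambda>\<tau>. c * (\<tau> powi int n * f \<tau>))" for c n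
  proof -
    have "fourier_coeff (abs_circle_L2 (\<lambda>\<tau>. c * (\<tau> powi int n * f \<tau>))) k = 0" if "k < 0" for k
    proof -
      have "fourier_coeff (abs_circle_L2 (\<lambda>\<tau>. c * (\<tau> powi int n * f \<tau>))) k
          = c * fourier_coeff (Rep_hardy2 u) (k - int n)"
        unfolding scaleC_abs_circle_L2[OF square_integrable_powi_mult[OF f(1)], symmetric]
          fourier_coeff_scaleC fourier_coeff_powi_mult[OF f(1)] f(2) ..
      then show ?thesis using that by (simp add: hardy2_fourier_coeff)
    qed
    then show ?thesis using Abs_hardy2_inverse by blast
  qed
  have si: "square_integrable (\<lambda>\<tau>. c * (\<tau> powi int n * f \<tau>))" for c n
    by (intro square_integrable_cmult square_integrable_powi_mult f)
  have 1: "cinner (\<lambda>\<tau>. F \<tau> * f \<tau>) (\<lambda>\<tau>. \<tau> powi int n * f \<tau>) = 0" for n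
  proof (rule Re_mult_all_eq_0)
    fix c
    obtain v where v: "Rep_hardy2 v = abs_circle_L2 (\<lambda>\<tau>. cnj c * (\<tau> powi int n * f \<tau>))"
      using shift by blast
    have "inner (toeplitz F u) v = 0" by (simp add: ker)
    then show "Re (c * cinner (\<lambda>\<tau>. F \<tau> * f \<tau>) (\<lambda>\<tau>. \<tau> powi int n * f \<tau>)) = 0"
      unfolding inner_toeplitz[OF F f si v] cinner_cmult_right by simp
  qed
  have 2: "cinner (\<lambda>\<tau>. F \<tau> * (\<tau> powi int n * f \<tau>)) f = 0" for n
  proof (rule Re_mult_all_eq_0)
    fix c
    obtain v where v: "Rep_hardy2 v = abs_circle_L2 (\<lambda>\<tau>. c * (\<tau> powi int n * f \<tau>))"
      using shift by blast
    have "Re (cinner (\<lambda>\<tau>. F \<tau> * (c * (\<tau> powi int n * f \<tau>))) f) = 0"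
      using orth[of v] by (simp only: inner_toeplitz[OF F si v f])
    also have "(\<lambda>\<tau>. F \<tau> * (c * (\<tau> powi int n * f \<tau>))) = (\<lambda>\<tau>. c * (F \<tau> * (\<tau> powi int n * f \<tau>)))"
      by (simp add: mult.left_commute)
    finally show "Re (c * cinner (\<lambda>\<tau>. F \<tau> * (\<tau> powi int n * f \<tau>)) f) = 0"
      by (simp only: cinner_cmult_left)
  qed
  have "fourier_null (\<lambda>\<tau>. F \<tau> * f \<tau> * cnj (f \<tau>))"
    unfolding fourier_null_def
  proof (intro conjI allI)
    show "integrable circle (\<lambda>\<tau>. F \<tau> * f \<tau> * cnj (f \<tau>))"
      by (rule integrable_mult_cnj[OF Ff f(1)])
    fix n :: int
    show "integral\<^sup>L circle (\<lambda>\<tau>. F \<tau> * f \<tau> * cnj (f \<tau>) * \<tau> powi n) = 0"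
    proof (cases "n \<ge> 0")
      case True
      have "integral\<^sup>L circle (\<lambda>\<tau>. F \<tau> * f \<tau> * cnj (f \<tau>) * \<tau> powi n)
          = cinner (\<lambda>\<tau>. F \<tau> * (\<tau> powi int (nat n) * f \<tau>)) f"
        unfolding cinner_def using True by (simp add: mult_ac)
      then show ?thesis by (simp only: 2)
    next
      case False
      have "integral\<^sup>L circle (\<lambda>\<tau>. F \<tau> * f \<tau> * cnj (f \<tau>) * \<tau> powi n)
          = cinner (\<lambda>\<tau>. F \<tau> * f \<tau>) (\<lambda>\<tau>. \<tau> powi int (nat (- n)) * f \<tau>)"
        unfolding cinner_def
      proof (intro Bochner_Integration.integral_cong refl)
        fix \<tau> assume "\<tau> \<in> space circle"
        then have "cnj (\<tau> powi int (nat (- n))) = \<tau> powi n"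
          using cnj_powi_circle[of \<tau> "- n"] False by simp
        then show "F \<tau> * f \<tau> * cnj (f \<tau>) * \<tau> powi n
            = F \<tau> * f \<tau> * cnj (\<tau> powi int (nat (- n)) * f \<tau>)"
          by (simp only: complex_cnj_mult) (simp only: mult_ac)
      qed
      then show ?thesis by (simp only: 1)
    qed
  qed
  then have "AE \<tau> in circle. F \<tau> * f \<tau> * cnj (f \<tau>) = 0" by (rule fourier_null_imp_AE_0)
  moreover have "AE \<tau> in circle. f \<tau> \<noteq> 0"
  proof (rule hardy_nonzero_AE[OF f(1)])
    show "fourier_coeff (abs_circle_L2 f) n = 0" if "n < 0" for n
      using hardy2_fourier_coeff[OF that, of u] by (simp add: f(2))
    show "abs_circle_L2 f \<noteq> 0"
      using u0 by (simp add: f(2)[symmetric] Rep_hardy2_inject[symmetric] zero_hardy2.rep_eq)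
  qed
  ultimately have "AE \<tau> in circle. F \<tau> = 0" by eventually_elim simp
  with nz show False ..
qed

section \<open>A nilpotent semigroup\<close>

subsection \<open>Truncated rotations of the circle\<close>

lemma nn_integral_circle:
  assumes h: "h \<in> borel_measurable circle"
  shows "(\<integral>\<^sup>+\<tau>. h \<tau> \<partial>circle)
    = (\<integral>\<^sup>+\<theta>. h (cis \<theta>) * indicator {0..2 * pi} \<theta> \<partial>lborel) / ennreal (2 * pi)"
proof -
  have hc: "h \<in> borel_measurable (restrict_space borel (sphere 0 1))"
    using h by (simp add: measurable_cong_sets[OF sets_circle refl])
  have m: "(\<lambda>\<theta>. h (cis \<theta>)) \<in> borel_measurable lborel"
    using measurable_compose[OF measurable_cis_circle hc]
    by (subst (asm) measurable_cong_sets[OF sets_uniform_measure refl])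
  have "(\<integral>\<^sup>+\<tau>. h \<tau> \<partial>circle) = (\<integral>\<^sup>+\<theta>. h (cis \<theta>) \<partial>uniform_measure lborel {0..2 * pi})"
    unfolding circle_def by (rule nn_integral_distr[OF measurable_cis_circle h[unfolded circle_def]])
  also have "\<dots> = (\<integral>\<^sup>+\<theta>. h (cis \<theta>) * indicator {0..2 * pi} \<theta> \<partial>lborel) / emeasure lborel {0..2 * pi}"
    by (rule nn_integral_uniform_measure) (use m in simp_all)
  finally show ?thesis by simp
qed

lemma ennreal_norm_abs_circle_L2:
  assumes "square_integrable f"
  shows "ennreal ((norm (abs_circle_L2 f))\<^sup>2) = (\<integral>\<^sup>+\<tau>. ennreal ((cmod (f \<tau>))\<^sup>2) \<partial>circle)"
proof -
  have "(\<integral>\<^sup>+\<tau>. ennreal ((cmod (f \<tau>))\<^sup>2) \<partial>circle) = ennreal (integral\<^sup>L circle (\<lambda>\<tau>. (cmod (f \<tau>))\<^sup>2))"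
    using assms by (intro nn_integral_eq_integral) (auto simp: square_integrable_def)
  then show ?thesis by (simp add: norm_circle_L2[OF assms])
qed

lemma Arg2pi_cis: "0 \<le> \<theta> \<Longrightarrow> \<theta> < 2 * pi \<Longrightarrow> Arg2pi (cis \<theta>) = \<theta>"
  by (rule Arg2pi_unique[of 1]) (simp_all add: cis_conv_exp)

lemma cis_Arg2pi: "cmod \<tau> = 1 \<Longrightarrow> cis (Arg2pi \<tau>) = \<tau>"
  using complex_norm_eq_1_exp[of \<tau>] by (simp add: cis_conv_exp)

text \<open>In terms of the angle in \<open>[0, 2\<pi>)\<close> this is the shift by \<open>a\<close> to the right: what leaves the interval is
  discarded, and the gap on the left is filled with 0.\<close>

definition trunc_rot :: "real \<Rightarrow> (complex \<Rightarrow> complex) \<Rightarrow> complex \<Rightarrow> complex" where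
  "trunc_rot a f \<tau> = (if a < Arg2pi \<tau> then f (\<tau> * cis (- a)) else 0)"

lemma trunc_rot_measurable:
  assumes f: "f \<in> borel_measurable circle"
  shows "trunc_rot a f \<in> borel_measurable circle"
proof -
  have "(\<lambda>\<tau>. \<tau> * cis (- a)) \<in> circle \<rightarrow>\<^sub>M circle"
    unfolding measurable_cong_sets[OF sets_circle sets_circle]
    by (intro measurable_restrict_space2 measurable_restrict_space1)
       (auto simp: norm_mult space_restrict_space intro!: borel_measurable_continuous_onI continuous_intros)
  from measurable_compose[OF this f]
  have 1: "(\<lambda>\<tau>. f (\<tau> * cis (- a))) \<in> borel_measurable circle" .
  have "{\<tau>. a < Arg2pi \<tau>} \<in> sets borel" by (rule borel_open[OF open_Arg2pi2pi_gt])
  then have "{\<tau> \<in> space circle. a < Arg2pi \<tau>} \<in> sets circle"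
    by (auto simp: sets_circle sets_restrict_space space_circle)
  then show ?thesis
    unfolding trunc_rot_def[abs_def] by (intro measurable_If 1) simp_all
qed

text \<open>Translation invariance of Lebesgue measure, applied to the angle.\<close>

lemma nn_integral_trunc_rot_le:
  assumes f: "f \<in> borel_measurable circle" and a: "a \<ge> 0"
  shows "(\<integral>\<^sup>+\<tau>. ennreal ((cmod (trunc_rot a f \<tau>))\<^sup>2) \<partial>circle) \<le> (\<integral>\<^sup>+\<tau>. ennreal ((cmod (f \<tau>))\<^sup>2) \<partial>circle)"
proof -
  define g where "g \<theta> = ennreal ((cmod (f (cis \<theta>)))\<^sup>2) * indicator {0..2 * pi} \<theta>" for \<theta>
  have fc: "f \<in> borel_measurable (restrict_space borel (sphere 0 1))"
    using f by (simp add: measurable_cong_sets[OF sets_circle refl])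
  have fcis: "(\<lambda>\<theta>. f (cis \<theta>)) \<in> borel_measurable borel"
    using measurable_compose[OF measurable_cis_circle fc]
    by (subst (asm) measurable_cong_sets[OF sets_uniform_measure refl]) simp
  have gm: "g \<in> borel_measurable borel"
    unfolding g_def[abs_def] using fcis by measurable
  have "ennreal ((cmod (trunc_rot a f (cis \<theta>)))\<^sup>2) * indicator {0..2 * pi} \<theta> \<le> g (- a + 1 * \<theta>)" for \<theta>
  proof (cases "0 \<le> \<theta> \<and> \<theta> < 2 * pi \<and> a < \<theta>")
    case True
    then have "trunc_rot a f (cis \<theta>) = f (cis (\<theta> - a))"
      by (simp add: trunc_rot_def Arg2pi_cis cis_mult)
    then show ?thesis using True a by (simp add: g_def)
  next
    case False
    have "trunc_rot a f (cis \<theta>) = 0" if \<theta>: "0 \<le> \<theta>" "\<theta> \<le> 2 * pi"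
    proof (cases "\<theta> = 2 * pi")
      case True
      then have "Arg2pi (cis \<theta>) = 0" using Arg2pi_cis[of 0] by simp
      then show ?thesis using a by (simp add: trunc_rot_def)
    next
      case False
      with \<theta> \<open>\<not> (0 \<le> \<theta> \<and> \<theta> < 2 * pi \<and> a < \<theta>)\<close> show ?thesis
        by (simp add: trunc_rot_def Arg2pi_cis)
    qed
    then show ?thesis by (auto simp: indicator_def)
  qed
  then have "(\<integral>\<^sup>+\<theta>. ennreal ((cmod (trunc_rot a f (cis \<theta>)))\<^sup>2) * indicator {0..2 * pi} \<theta> \<partial>lborel)
      \<le> (\<integral>\<^sup>+\<theta>. g (- a + 1 * \<theta>) \<partial>lborel)"
    by (intro nn_integral_mono) simp
  also have "\<dots> = (\<integral>\<^sup>+\<theta>. g \<theta> \<partial>lborel)"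
    by (subst nn_integral_real_affine[OF gm, of 1 "- a"]) simp_all
  finally have *: "(\<integral>\<^sup>+\<theta>. ennreal ((cmod (trunc_rot a f (cis \<theta>)))\<^sup>2) * indicator {0..2 * pi} \<theta> \<partial>lborel)
      \<le> (\<integral>\<^sup>+\<theta>. g \<theta> \<partial>lborel)" .
  have m1: "(\<lambda>\<tau>. ennreal ((cmod (trunc_rot a f \<tau>))\<^sup>2)) \<in> borel_measurable circle"
    using trunc_rot_measurable[OF f] by measurable
  have m2: "(\<lambda>\<tau>. ennreal ((cmod (f \<tau>))\<^sup>2)) \<in> borel_measurable circle"
    using f by measurable
  show ?thesis
    unfolding nn_integral_circle[OF m1] nn_integral_circle[OF m2] g_def[symmetric]
    by (rule divide_right_mono_ennreal[OF *])
qed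

lemma square_integrable_trunc_rot:
  assumes f: "square_integrable f" and a: "a \<ge> 0"
  shows "square_integrable (trunc_rot a f)"
proof -
  have fm: "f \<in> borel_measurable circle" using f by (simp add: square_integrable_def)
  note m = trunc_rot_measurable[OF fm, of a]
  have "(\<integral>\<^sup>+\<tau>. ennreal ((cmod (trunc_rot a f \<tau>))\<^sup>2) \<partial>circle) < \<infinity>"
    using nn_integral_trunc_rot_le[OF fm a]
    unfolding ennreal_norm_abs_circle_L2[OF f, symmetric]
    by (rule le_less_trans) simp
  then have "integrable circle (\<lambda>\<tau>. (cmod (trunc_rot a f \<tau>))\<^sup>2)"
    using m by (intro integrableI_nonneg) auto
  with m show ?thesis by (simp add: square_integrable_def)
qed

lemma norm_trunc_rot_le:
  assumes f: "square_integrable f" and a: "a \<ge> 0"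
  shows "norm (abs_circle_L2 (trunc_rot a f)) \<le> norm (abs_circle_L2 f)"
proof -
  have "f \<in> borel_measurable circle" using f by (simp add: square_integrable_def)
  from nn_integral_trunc_rot_le[OF this a]
  have "(norm (abs_circle_L2 (trunc_rot a f)))\<^sup>2 \<le> (norm (abs_circle_L2 f))\<^sup>2"
    unfolding ennreal_norm_abs_circle_L2[OF f, symmetric]
      ennreal_norm_abs_circle_L2[OF square_integrable_trunc_rot[OF f a], symmetric]
    by (subst (asm) ennreal_le_iff) simp_all
  then show ?thesis by (rule power2_le_imp_le) simp
qed

lemma trunc_rot_trunc_rot:
  assumes \<tau>: "cmod \<tau> = 1" and a: "a \<ge> 0" and b: "b \<ge> 0"
  shows "trunc_rot a (trunc_rot b f) \<tau> = trunc_rot (a + b) f \<tau>"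
proof (cases "a < Arg2pi \<tau>")
  case True
  have "\<tau> * cis (- a) = cis (Arg2pi \<tau> - a)"
    using cis_mult[of "Arg2pi \<tau>" "- a"] cis_Arg2pi[OF \<tau>] by simp
  then have A: "Arg2pi (\<tau> * cis (- a)) = Arg2pi \<tau> - a"
    using True a Arg2pi_lt_2pi[of \<tau>] by (simp add: Arg2pi_cis)
  have B: "\<tau> * cis (- a) * cis (- b) = \<tau> * cis (- (a + b))"
    by (simp add: mult.assoc cis_mult)
  show ?thesis unfolding trunc_rot_def A B using True by auto
qed (use b in \<open>simp add: trunc_rot_def\<close>)

text \<open>The parameter counts full turns, so that everything has been shifted out at time 1.\<close>

definition nil_shift :: "real \<Rightarrow> circle_L2 \<Rightarrow> circle_L2" where
  "nil_shift t u = abs_circle_L2 (trunc_rot (2 * pi * t) (rep_circle_L2 u))"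

text \<open>That the representative does not matter follows from the norm bound, applied to the difference of two
  representatives.\<close>

lemma nil_shift_abs:
  assumes f: "square_integrable f" and t: "t \<ge> 0"
  shows "nil_shift t (abs_circle_L2 f) = abs_circle_L2 (trunc_rot (2 * pi * t) f)"
proof -
  define r where "r = rep_circle_L2 (abs_circle_L2 f)"
  have "L2_eq r f"
    unfolding r_def using f
    by (intro Quotient3_rep_abs[OF Quotient3_circle_L2]) (simp add: L2_eq_def)
  then have r: "square_integrable r" "abs_circle_L2 r = abs_circle_L2 f"
    using abs_circle_L2_eq_iff by (auto simp: L2_eq_def)
  have a: "2 * pi * t \<ge> 0" using t by simp
  have "trunc_rot (2 * pi * t) (\<lambda>\<tau>. r \<tau> - f \<tau>)
      = (\<lambda>\<tau>. trunc_rot (2 * pi * t) r \<tau> - trunc_rot (2 * pi * t) f \<tau>)"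
    by (auto simp: trunc_rot_def)
  then have "abs_circle_L2 (trunc_rot (2 * pi * t) r) - abs_circle_L2 (trunc_rot (2 * pi * t) f)
      = abs_circle_L2 (trunc_rot (2 * pi * t) (\<lambda>\<tau>. r \<tau> - f \<tau>))"
    by (simp add: abs_circle_L2_diff square_integrable_trunc_rot r(1) f a)
  moreover have "norm (abs_circle_L2 (trunc_rot (2 * pi * t) (\<lambda>\<tau>. r \<tau> - f \<tau>))) \<le> 0"
    using norm_trunc_rot_le[OF square_integrable_diff[OF r(1) f] a]
    by (simp add: r(2) flip: abs_circle_L2_diff[OF r(1) f])
  ultimately show ?thesis by (simp add: nil_shift_def r_def)
qed

lemma norm_nil_shift_le: "t \<ge> 0 \<Longrightarrow> norm (nil_shift t u) \<le> norm u"
  by (cases u rule: abs_circle_L2_cases) (simp add: nil_shift_abs norm_trunc_rot_le)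

lemma nil_shift_add:
  assumes t: "t \<ge> 0"
  shows "nil_shift t (u + v) = nil_shift t u + nil_shift t v"
proof -
  obtain f g where fg: "square_integrable f" "u = abs_circle_L2 f" "square_integrable g" "v = abs_circle_L2 g"
    by (metis abs_circle_L2_cases)
  have "trunc_rot a (\<lambda>\<tau>. f \<tau> + g \<tau>) = (\<lambda>\<tau>. trunc_rot a f \<tau> + trunc_rot a g \<tau>)" for a
    by (auto simp: trunc_rot_def)
  then show ?thesis
    using t by (simp add: fg add_abs_circle_L2 square_integrable_add nil_shift_abs square_integrable_trunc_rot)
qed

lemma nil_shift_scaleC:
  assumes t: "t \<ge> 0"
  shows "nil_shift t (c *\<^sub>C u) = c *\<^sub>C nil_shift t u"
proof (cases u rule: abs_circle_L2_cases)
  case (1 f)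
  have "trunc_rot a (\<lambda>\<tau>. c * f \<tau>) = (\<lambda>\<tau>. c * trunc_rot a f \<tau>)" for a
    by (auto simp: trunc_rot_def)
  then show ?thesis
    using t 1 by (simp add: scaleC_abs_circle_L2 square_integrable_cmult nil_shift_abs square_integrable_trunc_rot)
qed

lemma nil_shift_nil_shift:
  assumes "t \<ge> 0" "s \<ge> 0"
  shows "nil_shift t (nil_shift s u) = nil_shift (t + s) u"
proof (cases u rule: abs_circle_L2_cases)
  case (1 f)
  have "AE \<tau> in circle. trunc_rot (2 * pi * t) (trunc_rot (2 * pi * s) f) \<tau> = trunc_rot (2 * pi * (t + s)) f \<tau>"
    using assms by (intro AE_I2) (simp add: trunc_rot_trunc_rot distrib_left)
  then show ?thesis
    using assms 1 by (simp add: nil_shift_abs square_integrable_trunc_rot abs_circle_L2_eq_iff)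
qed

lemma nil_shift_1: "nil_shift 1 u = 0"
proof -
  have "trunc_rot (2 * pi) f = (\<lambda>_. 0)" for f
  proof -
    have "\<not> 2 * pi < Arg2pi \<tau>" for \<tau>
      using Arg2pi_lt_2pi[of \<tau>] by linarith
    then show ?thesis by (simp add: trunc_rot_def fun_eq_iff)
  qed
  then show ?thesis by (simp add: nil_shift_def zero_abs_circle_L2)
qed

lemma nn_integral_small_arc:
  assumes a: "a \<ge> 0"
  shows "(\<integral>\<^sup>+\<tau>. indicator {\<tau>. Arg2pi \<tau> \<le> a} \<tau> \<partial>circle) \<le> ennreal (a / (2 * pi))"
proof -
  have m: "(indicator {\<tau>. Arg2pi \<tau> \<le> a} :: complex \<Rightarrow> ennreal) \<in> borel_measurable circle"
    by (subst measurable_cong_sets[OF sets_circle refl])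
       (intro measurable_restrict_space1 borel_measurable_indicator borel_closed closed_Arg2pi2pi_le)
  have "(\<integral>\<^sup>+\<theta>. indicator {\<tau>. Arg2pi \<tau> \<le> a} (cis \<theta>) * indicator {0..2 * pi} \<theta> \<partial>lborel)
      \<le> (\<integral>\<^sup>+\<theta>. indicator ({0..a} \<union> {2 * pi}) \<theta> \<partial>lborel)"
  proof (rule nn_integral_mono)
    fix \<theta> :: real
    show "indicator {\<tau>. Arg2pi \<tau> \<le> a} (cis \<theta>) * indicator {0..2 * pi} \<theta>
        \<le> (indicator ({0..a} \<union> {2 * pi}) \<theta> :: ennreal)"
    proof (cases "0 \<le> \<theta> \<and> \<theta> < 2 * pi")
      case True
      then show ?thesis by (auto simp: indicator_def Arg2pi_cis)
    qed (auto simp: indicator_def)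
  qed
  also have "\<dots> = emeasure lborel ({0..a} \<union> {2 * pi})" by simp
  also have "\<dots> \<le> emeasure lborel {0..a} + emeasure lborel {2 * pi}"
    by (rule emeasure_subadditive) auto
  also have "\<dots> = ennreal a" using a by simp
  finally have "(\<integral>\<^sup>+\<theta>. indicator {\<tau>. Arg2pi \<tau> \<le> a} (cis \<theta>) * indicator {0..2 * pi} \<theta> \<partial>lborel) \<le> ennreal a" .
  from divide_right_mono_ennreal[OF this, of "ennreal (2 * pi)"] show ?thesis
    unfolding nn_integral_circle[OF m] using a by (simp add: divide_ennreal)
qed

text \<open>Off a short arc the shift multiplies \<open>\<tau>\<^sup>n\<close> by a constant close to 1.\<close>

lemma nil_shift_powi_tendsto:
  "((\<lambda>t. norm (nil_shift t (abs_circle_L2 (\<lambda>\<tau>. c * \<tau> powi n)) - abs_circle_L2 (\<lambda>\<tau>. c * \<tau> powi n)))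
    \<longlongrightarrow> 0) (at_right 0)"
proof -
  define e where "e = (\<lambda>\<tau>::complex. c * \<tau> powi n)"
  have e: "square_integrable e"
    unfolding e_def by (intro square_integrable_cmult square_integrable_powi)
  define B where "B t = cmod c ^ 2 * ((cmod (cis (- (2 * pi * t)) powi n - 1))\<^sup>2 + t)" for t
  have bound: "norm (nil_shift t (abs_circle_L2 e) - abs_circle_L2 e) \<le> sqrt (B t)" if t: "t > 0" for t
  proof -
    define a where "a = 2 * pi * t"
    have a: "a \<ge> 0" using t by (simp add: a_def)
    define k where "k = (cmod c)\<^sup>2 * (cmod (cis (- a) powi n - 1))\<^sup>2"
    have k: "k \<ge> 0" by (simp add: k_def)
    note si = square_integrable_diff[OF square_integrable_trunc_rot[OF e a] e]
    have pt: "(cmod (trunc_rot a e \<tau> - e \<tau>))\<^sup>2 \<le> k + (cmod c)\<^sup>2 * indicator {\<tau>. Arg2pi \<tau> \<le> a} \<tau>"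
      if "cmod \<tau> = 1" for \<tau>
    proof (cases "a < Arg2pi \<tau>")
      case True
      then have "trunc_rot a e \<tau> - e \<tau> = c * \<tau> powi n * (cis (- a) powi n - 1)"
        by (simp add: trunc_rot_def e_def power_int_mult_distrib algebra_simps)
      then show ?thesis
        using that True by (simp add: k_def norm_mult norm_power_int power_mult_distrib)
    next
      case False
      then show ?thesis
        using that k by (simp add: trunc_rot_def e_def norm_mult norm_power_int)
    qed
    have "ennreal ((norm (nil_shift t (abs_circle_L2 e) - abs_circle_L2 e))\<^sup>2)
        = (\<integral>\<^sup>+\<tau>. ennreal ((cmod (trunc_rot a e \<tau> - e \<tau>))\<^sup>2) \<partial>circle)"
      using t by (simp add: nil_shift_abs[OF e] a_def[symmetric]
          abs_circle_L2_diff[OF square_integrable_trunc_rot[OF e a] e] ennreal_norm_abs_circle_L2[OF si])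
    also have "\<dots> \<le> (\<integral>\<^sup>+\<tau>. ennreal k + ennreal ((cmod c)\<^sup>2) * indicator {\<tau>. Arg2pi \<tau> \<le> a} \<tau> \<partial>circle)"
    proof (rule nn_integral_mono)
      fix \<tau> assume "\<tau> \<in> space circle"
      then have "cmod \<tau> = 1" by simp
      from ennreal_leI[OF pt[OF this]]
      show "ennreal ((cmod (trunc_rot a e \<tau> - e \<tau>))\<^sup>2)
          \<le> ennreal k + ennreal ((cmod c)\<^sup>2) * indicator {\<tau>. Arg2pi \<tau> \<le> a} \<tau>"
        using k by (auto simp: indicator_def)
    qed
    also have "\<dots> = ennreal k + ennreal ((cmod c)\<^sup>2) * (\<integral>\<^sup>+\<tau>. indicator {\<tau>. Arg2pi \<tau> \<le> a} \<tau> \<partial>circle)"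
    proof -
      have m: "(indicator {\<tau>. Arg2pi \<tau> \<le> a} :: complex \<Rightarrow> ennreal) \<in> borel_measurable circle"
        by (subst measurable_cong_sets[OF sets_circle refl])
           (intro measurable_restrict_space1 borel_measurable_indicator borel_closed closed_Arg2pi2pi_le)
      show ?thesis
        using m emeasure_circle by (subst nn_integral_add) (simp_all add: nn_integral_cmult)
    qed
    also have "\<dots> \<le> ennreal k + ennreal ((cmod c)\<^sup>2) * ennreal (a / (2 * pi))"
      by (intro add_left_mono mult_left_mono nn_integral_small_arc[OF a]) simp
    also have "\<dots> = ennreal (B t)"
      using k t by (simp add: a_def B_def k_def ennreal_plus[symmetric] ennreal_mult[symmetric] distrib_left
          del: ennreal_plus)
    finally have "(norm (nil_shift t (abs_circle_L2 e) - abs_circle_L2 e))\<^sup>2 \<le> B t"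
      using t by (subst (asm) ennreal_le_iff) (auto simp: B_def)
    then show ?thesis by (rule real_le_rsqrt)
  qed
  have "((\<lambda>t. sqrt (B t)) \<longlongrightarrow> sqrt (B 0)) (at_right 0)"
  proof -
    have "continuous_on UNIV B"
      unfolding B_def[abs_def] by (intro continuous_intros) auto
    then have "isCont (\<lambda>t. sqrt (B t)) 0"
      by (intro isCont_real_sqrt[THEN isCont_o2[rotated]])
         (simp add: continuous_on_eq_continuous_at)
    then show ?thesis
      unfolding isCont_def by (rule filterlim_mono[OF _ order_refl at_le]) simp
  qed
  then have L: "((\<lambda>t. sqrt (B t)) \<longlongrightarrow> 0) (at_right 0)" by (simp add: B_def)
  have "((\<lambda>t. norm (nil_shift t (abs_circle_L2 e) - abs_circle_L2 e)) \<longlongrightarrow> 0) (at_right 0)"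
  proof (rule tendsto_sandwich[OF _ _ tendsto_const L])
    show "\<forall>\<^sub>F t in at_right 0. norm (nil_shift t (abs_circle_L2 e) - abs_circle_L2 e) \<le> sqrt (B t)"
      using bound unfolding eventually_at_right_field by (intro exI[of _ 1]) simp
  qed simp
  then show ?thesis by (simp add: e_def)
qed

lemma linear_nil_shift:
  assumes "t \<ge> 0" shows "linear (nil_shift t)"
proof (rule linearI)
  show "nil_shift t (r *\<^sub>R u) = r *\<^sub>R nil_shift t u" for r u
    unfolding scaleR_scaleC by (rule nil_shift_scaleC[OF assms])
qed (rule nil_shift_add[OF assms])

text \<open>The vectors at which the convergence holds form a closed subspace containing all multiples of the
  functions \<open>\<tau>\<^sup>n\<close>. A vector orthogonal to it has no Fourier coefficients.\<close>

lemma nil_shift_tendsto: "((\<lambda>t. norm (nil_shift t u - u)) \<longlongrightarrow> 0) (at_right 0)"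
proof -
  define D where "D = {u. ((\<lambda>t. norm (nil_shift t u - u)) \<longlongrightarrow> 0) (at_right 0)}"
  have D_iff: "u \<in> D \<longleftrightarrow> ((\<lambda>t. nil_shift t u) \<longlongrightarrow> u) (at_right 0)" for u
    unfolding D_def mem_Collect_eq tendsto_norm_zero_iff LIM_zero_iff ..
  have pos: "\<forall>\<^sub>F t::real in at_right 0. 0 < t" by (simp add: eventually_at_right_less)
  have sub: "subspace D"
  proof (rule subspaceI)
    show "0 \<in> D"
      unfolding D_iff
      by (rule tendsto_eventually, use pos in eventually_elim) (simp add: linear_0[OF linear_nil_shift])
    show "u + v \<in> D" if "u \<in> D" "v \<in> D" for u v
    proof -
      have "((\<lambda>t. nil_shift t u + nil_shift t v) \<longlongrightarrow> u + v) (at_right 0)"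
        using that unfolding D_iff by (rule tendsto_add)
      moreover have "\<forall>\<^sub>F t in at_right 0. nil_shift t u + nil_shift t v = nil_shift t (u + v)"
        using pos by eventually_elim (simp add: nil_shift_add)
      ultimately show ?thesis unfolding D_iff by (rule Lim_transform_eventually)
    qed
    show "r *\<^sub>R u \<in> D" if "u \<in> D" for r u
    proof -
      have "((\<lambda>t. r *\<^sub>R nil_shift t u) \<longlongrightarrow> r *\<^sub>R u) (at_right 0)"
        using that unfolding D_iff by (intro tendsto_scaleR tendsto_const)
      moreover have "\<forall>\<^sub>F t in at_right 0. r *\<^sub>R nil_shift t u = nil_shift t (r *\<^sub>R u)"
        using pos by eventually_elim (simp add: nil_shift_scaleC scaleR_scaleC)
      ultimately show ?thesis unfolding D_iff by (rule Lim_transform_eventually)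
    qed
  qed
  have "closed D"
    unfolding D_def
  proof (rule closed_strong_convergence[where K=1])
    show "norm (nil_shift t u - nil_shift t v) \<le> 1 * norm (u - v)" if "0 < t" for t u v
      using that norm_nil_shift_le[of t "u - v"] by (simp add: linear_diff[OF linear_nil_shift])
  qed
  from orthogonal_projection_exists[OF sub this, of u]
  obtain g where g: "g \<in> D" "\<And>v. v \<in> D \<Longrightarrow> inner (u - g) v = 0" by blast
  obtain h where h: "square_integrable h" "u - g = abs_circle_L2 h" by (rule abs_circle_L2_cases)
  have "fourier_coeff (u - g) n = 0" for n
  proof (rule Re_mult_all_eq_0)
    fix c
    have "abs_circle_L2 (\<lambda>\<tau>. cnj c * \<tau> powi n) \<in> D"
      unfolding D_def using nil_shift_powi_tendsto by blast
    from g(2)[OF this] show "Re (c * fourier_coeff (u - g) n) = 0"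
      unfolding h(2) fourier_coeff_abs_cinner[OF h(1)]
        inner_abs_circle_L2[OF h(1) square_integrable_cmult[OF square_integrable_powi]] cinner_cmult_right
      by simp
  qed
  then have "u - g = 0" by (rule fourier_coeff_zero_imp)
  then show ?thesis using g(1) by (simp add: D_def)
qed

subsection \<open>Relabelling Fourier coefficients\<close>

definition powi_L2 :: "int \<Rightarrow> circle_L2" where
  "powi_L2 n = abs_circle_L2 (\<lambda>\<tau>. \<tau> powi n)"

lemma fourier_coeff_powi_L2: "fourier_coeff (powi_L2 k) n = (if n = k then 1 else 0)"
proof -
  have "fourier_coeff (powi_L2 k) n = integral\<^sup>L circle (\<lambda>\<tau>. \<tau> powi k * \<tau> powi (- n))"
    unfolding powi_L2_def by (rule fourier_coeff_abs[OF square_integrable_powi])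
  also have "\<dots> = integral\<^sup>L circle (\<lambda>\<tau>. \<tau> powi (k - n))"
    by (intro Bochner_Integration.integral_cong refl)
       (simp add: circle_nonzero power_int_diff power_int_minus divide_inverse)
  finally show ?thesis by (simp add: integral_circle_powi)
qed

lemma inner_powi_L2: "inner f (c *\<^sub>C powi_L2 k) = Re (cnj c * fourier_coeff f k)"
proof (cases f rule: abs_circle_L2_cases)
  case (1 h)
  show ?thesis
    unfolding 1(2) powi_L2_def scaleC_abs_circle_L2[OF square_integrable_powi]
      inner_abs_circle_L2[OF 1(1) square_integrable_cmult[OF square_integrable_powi]] cinner_cmult_right
      fourier_coeff_abs_cinner[OF 1(1)] ..
qed

lemma norm_powi_L2_sum:
  assumes "inj \<rho>" "finite A"
  shows "(norm (\<Sum>k\<in>A. a k *\<^sub>C powi_L2 (\<rho> k)))\<^sup>2 = (\<Sum>k\<in>A. (cmod (a k))\<^sup>2)"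
proof -
  have "inner (a j *\<^sub>C powi_L2 (\<rho> j)) (a k *\<^sub>C powi_L2 (\<rho> k)) = (if j = k then (cmod (a k))\<^sup>2 else 0)" for j k
    unfolding inner_powi_L2 fourier_coeff_scaleC fourier_coeff_powi_L2
    using assms(1) by (auto simp: Re_cnj_mult_self inj_eq)
  then show ?thesis
    using assms(2) by (simp add: power2_norm_eq_inner inner_sum_left inner_sum_right)
qed

lemma bessel_inj:
  assumes \<sigma>: "inj \<sigma>" and A: "finite A"
  shows "(\<Sum>k\<in>A. (cmod (fourier_coeff f (\<sigma> k)))\<^sup>2) \<le> (norm f)\<^sup>2"
proof -
  define s where "s = (\<Sum>k\<in>A. fourier_coeff f (\<sigma> k) *\<^sub>C powi_L2 (\<sigma> k))"
  have "inner f s = (\<Sum>k\<in>A. (cmod (fourier_coeff f (\<sigma> k)))\<^sup>2)"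
    unfolding s_def inner_sum_right inner_powi_L2 by (simp add: Re_cnj_mult_self)
  moreover have "(norm s)\<^sup>2 = (\<Sum>k\<in>A. (cmod (fourier_coeff f (\<sigma> k)))\<^sup>2)"
    unfolding s_def by (rule norm_powi_L2_sum[OF \<sigma> A])
  moreover have "0 \<le> (norm (f - s))\<^sup>2" by simp
  ultimately show ?thesis
    unfolding power2_norm_eq_inner by (simp add: inner_diff_left inner_diff_right inner_commute)
qed

text \<open>This moves the Fourier coefficient at \<open>\<sigma> k\<close> to \<open>\<rho> k\<close>. With the inclusion of the natural numbers on one
  side and an enumeration of the integers on the other it identifies the Hardy space with all
  of \<open>L\<^sup>2\<close>.\<close>

definition relabel :: "(nat \<Rightarrow> int) \<Rightarrow> (nat \<Rightarrow> int) \<Rightarrow> circle_L2 \<Rightarrow> circle_L2" where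
  "relabel \<sigma> \<rho> f = (\<Sum>k. fourier_coeff f (\<sigma> k) *\<^sub>C powi_L2 (\<rho> k))"

lemma summable_relabel:
  assumes \<sigma>: "inj \<sigma>" and \<rho>: "inj \<rho>"
  shows "summable (\<lambda>k. fourier_coeff f (\<sigma> k) *\<^sub>C powi_L2 (\<rho> k))"
  unfolding summable_Cauchy
proof (intro allI impI)
  let ?a = "\<lambda>k. (cmod (fourier_coeff f (\<sigma> k)))\<^sup>2"
  have "summable ?a"
    by (rule summableI_nonneg_bounded[OF _ bessel_inj[OF \<sigma>]]) simp_all
  fix \<epsilon> :: real assume "\<epsilon> > 0"
  then have "\<epsilon>\<^sup>2 > 0" by simp
  with \<open>summable ?a\<close> obtain N where N: "\<And>m n. m \<ge> N \<Longrightarrow> norm (sum ?a {m..<n}) < \<epsilon>\<^sup>2"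
    unfolding summable_Cauchy by meson
  have "norm (\<Sum>k\<in>{m..<n}. fourier_coeff f (\<sigma> k) *\<^sub>C powi_L2 (\<rho> k)) < \<epsilon>" if "m \<ge> N" for m n
  proof (rule power_less_imp_less_base)
    show "(norm (\<Sum>k\<in>{m..<n}. fourier_coeff f (\<sigma> k) *\<^sub>C powi_L2 (\<rho> k)))\<^sup>2 < \<epsilon>\<^sup>2"
      using N[OF that, of n] by (simp add: norm_powi_L2_sum[OF \<rho>])
  qed (use \<open>\<epsilon> > 0\<close> in simp)
  then show "\<exists>N. \<forall>m\<ge>N. \<forall>n. norm (\<Sum>k\<in>{m..<n}. fourier_coeff f (\<sigma> k) *\<^sub>C powi_L2 (\<rho> k)) < \<epsilon>" by blast
qed

lemma fourier_coeff_relabel_eq_suminf: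
  assumes "inj \<sigma>" "inj \<rho>"
  shows "fourier_coeff (relabel \<sigma> \<rho> f) n = (\<Sum>k. fourier_coeff f (\<sigma> k) * (if n = \<rho> k then 1 else 0))"
  unfolding relabel_def
    bounded_linear.suminf[OF bounded_linear_fourier_coeff[of n] summable_relabel[OF assms]]
  by (simp add: fourier_coeff_scaleC fourier_coeff_powi_L2)

lemma fourier_coeff_relabel:
  assumes "inj \<sigma>" "inj \<rho>"
  shows "fourier_coeff (relabel \<sigma> \<rho> f) (\<rho> n) = fourier_coeff f (\<sigma> n)"
proof -
  have "fourier_coeff (relabel \<sigma> \<rho> f) (\<rho> n)
      = (\<Sum>k\<in>{n}. fourier_coeff f (\<sigma> k) * (if \<rho> n = \<rho> k then 1 else 0))"
    unfolding fourier_coeff_relabel_eq_suminf[OF assms]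
    using assms(2) by (intro suminf_finite) (auto simp: inj_eq)
  then show ?thesis by simp
qed

lemma fourier_coeff_relabel_0:
  assumes "inj \<sigma>" "inj \<rho>" "n \<notin> range \<rho>"
  shows "fourier_coeff (relabel \<sigma> \<rho> f) n = 0"
proof -
  have "n \<noteq> \<rho> k" for k using assms(3) by blast
  then show ?thesis unfolding fourier_coeff_relabel_eq_suminf[OF assms(1,2)] by simp
qed

lemma relabel_add:
  assumes "inj \<sigma>" "inj \<rho>"
  shows "relabel \<sigma> \<rho> (f + g) = relabel \<sigma> \<rho> f + relabel \<sigma> \<rho> g"
  unfolding relabel_def suminf_add[OF summable_relabel[OF assms] summable_relabel[OF assms]]
  by (simp add: fourier_coeff_add scaleC_add_left)

lemma relabel_scaleC:
  assumes "inj \<sigma>" "inj \<rho>"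
  shows "relabel \<sigma> \<rho> (c *\<^sub>C f) = c *\<^sub>C relabel \<sigma> \<rho> f"
  unfolding relabel_def bounded_linear.suminf[OF bounded_linear_scaleC summable_relabel[OF assms]]
  by (simp add: fourier_coeff_scaleC scaleC_scaleC)

lemma norm_relabel_le:
  assumes "inj \<sigma>" "inj \<rho>"
  shows "norm (relabel \<sigma> \<rho> f) \<le> norm f"
proof (rule LIMSEQ_le_const2)
  show "(\<lambda>n. norm (\<Sum>k<n. fourier_coeff f (\<sigma> k) *\<^sub>C powi_L2 (\<rho> k))) \<longlonglongrightarrow> norm (relabel \<sigma> \<rho> f)"
    unfolding relabel_def by (intro tendsto_norm summable_LIMSEQ summable_relabel assms)
  have "norm (\<Sum>k<n. fourier_coeff f (\<sigma> k) *\<^sub>C powi_L2 (\<rho> k)) \<le> norm f" for n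
    by (rule power2_le_imp_le) (simp_all add: norm_powi_L2_sum[OF assms(2)] bessel_inj[OF assms(1)])
  then show "\<exists>N. \<forall>n\<ge>N. norm (\<Sum>k<n. fourier_coeff f (\<sigma> k) *\<^sub>C powi_L2 (\<rho> k)) \<le> norm f" by blast
qed

text \<open>The shifts form a semigroup on \<open>L\<^sup>2\<close> that is 0 at time 1. It is conjugated by the relabelling \<open>U\<close>
  from the Hardy space onto \<open>L\<^sup>2\<close> and its inverse \<open>W\<close>.\<close>

lemma C0_embeddable_zero_hardy2: "C0_embeddable (\<lambda>_::hardy2. 0)"
proof -
  have inj: "inj int" "inj int_decode" by (simp_all add: inj_int_decode)
  define U where "U f = relabel int int_decode (Rep_hardy2 f)" for f
  define W where "W g = Abs_hardy2 (relabel int_decode int g)" for g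
  have Rep_W: "Rep_hardy2 (W g) = relabel int_decode int g" for g
  proof -
    have "fourier_coeff (relabel int_decode int g) n = 0" if "n < 0" for n
      using that by (intro fourier_coeff_relabel_0[OF inj(2,1)]) auto
    then show ?thesis unfolding W_def by (intro Abs_hardy2_inverse) simp
  qed
  have WU: "W (U f) = f" for f
  proof -
    have "fourier_coeff (Rep_hardy2 (W (U f))) n = fourier_coeff (Rep_hardy2 f) n" for n
    proof (cases "n < 0")
      case False
      then obtain k where "n = int k" by (metis nonneg_int_cases not_less)
      then show ?thesis
        by (simp only: Rep_W U_def fourier_coeff_relabel[OF inj(2,1)] fourier_coeff_relabel[OF inj])
    qed (simp add: hardy2_fourier_coeff)
    then have "Rep_hardy2 (W (U f)) = Rep_hardy2 f" by (rule fourier_coeff_eqI)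
    then show ?thesis by (simp add: Rep_hardy2_inject)
  qed
  have UW: "U (W g) = g" for g
  proof (rule fourier_coeff_eqI)
    fix n
    obtain k where "n = int_decode k" using int_encode_inverse by metis
    then show "fourier_coeff (U (W g)) n = fourier_coeff g n"
      by (simp only: Rep_W U_def fourier_coeff_relabel[OF inj(2,1)] fourier_coeff_relabel[OF inj])
  qed
  have U_add: "U (f + g) = U f + U g" and U_scaleC: "U (c *\<^sub>C f) = c *\<^sub>C U f" and U_norm: "norm (U f) \<le> norm f"
    for f g c
    by (simp_all add: U_def plus_hardy2.rep_eq scaleC_hardy2.rep_eq norm_hardy2.rep_eq
        relabel_add[OF inj] relabel_scaleC[OF inj] norm_relabel_le[OF inj])
  have W_add: "W (u + v) = W u + W v" and W_scaleC: "W (c *\<^sub>C u) = c *\<^sub>C W u" and W_norm: "norm (W u) \<le> norm u"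
    for u v c
    by (simp_all add: Rep_hardy2_inject[symmetric] Rep_W plus_hardy2.rep_eq scaleC_hardy2.rep_eq
        norm_hardy2.rep_eq relabel_add[OF inj(2,1)] relabel_scaleC[OF inj(2,1)] norm_relabel_le[OF inj(2,1)])
  have W_diff: "W (u - v) = W u - W v" for u v
    using W_add[of "u - v" v] by (simp add: algebra_simps)
  define S where "S t f = W (nil_shift t (U f))" for t f
  have "C0_semigroup S"
    unfolding C0_semigroup_def
  proof (intro conjI allI impI)
    fix t :: real assume t: "t > 0"
    have "bounded_linear (S t)"
    proof (rule bounded_linear_intro[where K=1])
      show "S t (f + g) = S t f + S t g" for f g
        using t by (simp add: S_def U_add W_add nil_shift_add)
      show "S t (r *\<^sub>R f) = r *\<^sub>R S t f" for r f
        using t by (simp add: scaleR_scaleC S_def U_scaleC W_scaleC nil_shift_scaleC)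
      show "norm (S t f) \<le> norm f * 1" for f
        unfolding S_def mult_1_right using t
        by (intro order_trans[OF W_norm] order_trans[OF norm_nil_shift_le U_norm]) simp
    qed
    then show "bounded_clinear (S t)"
      using t by (simp add: bounded_clinear_def S_def U_scaleC W_scaleC nil_shift_scaleC)
    fix s :: real assume "s > 0"
    with t show "S t \<circ> S s = S (t + s)"
      by (simp add: fun_eq_iff S_def UW nil_shift_nil_shift)
  next
    fix f
    show "((\<lambda>t. norm (S t f - f)) \<longlongrightarrow> 0) (at_right 0)"
    proof (rule tendsto_sandwich[OF _ _ tendsto_const nil_shift_tendsto[of "U f"]])
      have "S t f - f = W (nil_shift t (U f) - U f)" for t
        by (simp add: W_diff WU S_def)
      then show "\<forall>\<^sub>F t in at_right 0. norm (S t f - f) \<le> norm (nil_shift t (U f) - U f)"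
        by (simp add: W_norm)
    qed simp
  qed
  moreover have "S 1 = (\<lambda>_. 0)"
    using W_diff[of 0 0] by (simp add: S_def nil_shift_1 fun_eq_iff)
  ultimately show ?thesis unfolding C0_embeddable_def by blast
qed

section \<open>Embedding the Toeplitz operator\<close>

lemma toeplitz_AE_zero:
  assumes F: "F \<in> circle_Linf" and zero: "AE \<tau> in circle. F \<tau> = 0"
  shows "toeplitz F u = 0"
proof -
  have "mult_L2 F v = 0" for v
  proof (cases v rule: abs_circle_L2_cases)
    case (1 f)
    have "AE \<tau> in circle. F \<tau> * f \<tau> = 0" using zero by eventually_elim simp
    then show ?thesis
      using abs_circle_L2_eq_iff[OF square_integrable_mult[OF F 1(1)] square_integrable_0]
      by (simp add: 1(2) mult_L2_abs[OF F 1(1)] zero_abs_circle_L2)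
  qed
  then show ?thesis
    using norm_riesz_sum_le[of 0] by (simp add: Rep_hardy2_inject[symmetric] Rep_toeplitz zero_hardy2.rep_eq)
qed

lemma toeplitz_cmult:
  assumes F: "F \<in> circle_Linf" and G: "(\<lambda>\<tau>. a * F \<tau>) \<in> circle_Linf"
  shows "toeplitz (\<lambda>\<tau>. a * F \<tau>) u = a *\<^sub>C toeplitz F u"
proof -
  have "mult_L2 (\<lambda>\<tau>. a * F \<tau>) v = a *\<^sub>C mult_L2 F v" for v
  proof (cases v rule: abs_circle_L2_cases)
    case (1 f)
    then show ?thesis
      by (simp add: mult_L2_abs[OF F] mult_L2_abs[OF G] scaleC_abs_circle_L2
          square_integrable_mult[OF F] mult.assoc)
  qed
  then show ?thesis
    by (simp add: Rep_hardy2_inject[symmetric] scaleC_hardy2.rep_eq Rep_toeplitz riesz_sum_scaleC)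
qed

theorem corollary8p6:
  fixes F :: "complex \<Rightarrow> complex"
  assumes "F \<in> circle_Linf"
    and "\<exists>a::complex. a \<noteq> 0 \<and> (AE \<tau> in circle. Re (a * F \<tau>) \<ge> 0)"
  shows "C0_embeddable (toeplitz F)"
proof (cases "AE \<tau> in circle. F \<tau> = 0")
  case True
  then have "toeplitz F = (\<lambda>_. 0)"
    using toeplitz_AE_zero[OF assms(1)] by (simp add: fun_eq_iff)
  then show ?thesis using C0_embeddable_zero_hardy2 by simp
next
  case nonzero: False
  obtain a :: complex where a: "a \<noteq> 0" and pos: "AE \<tau> in circle. 0 \<le> Re (a * F \<tau>)"
    using assms(2) by blast
  define G where "G \<tau> = a * F \<tau>" for \<tau>
  have G: "G \<in> circle_Linf"
  proof -
    obtain C where "AE \<tau> in circle. cmod (F \<tau>) \<le> C"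
      using assms(1) by (auto simp: circle_Linf_def)
    then have "AE \<tau> in circle. cmod (G \<tau>) \<le> cmod a * C"
      by eventually_elim (simp add: G_def norm_mult mult_left_mono)
    moreover have "G \<in> borel_measurable circle"
      using assms(1) unfolding G_def[abs_def] circle_Linf_def
      by (intro borel_measurable_times borel_measurable_const) blast
    ultimately show ?thesis by (auto simp: circle_Linf_def)
  qed
  have "\<not> (AE \<tau> in circle. G \<tau> = 0)"
    using nonzero a by (simp add: G_def)
  moreover have "AE \<tau> in circle. 0 \<le> Re (G \<tau>)"
    using pos by (simp only: G_def)
  ultimately have "C0_embeddable (toeplitz G)"
    using toeplitz_bounded_clinear[OF G] toeplitz_accretive[OF G] toeplitz_kernel[OF G]
    by (intro accretive_C0_embeddable) blast+
  then have "C0_embeddable (\<lambda>u. inverse a *\<^sub>C toeplitz G u)"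
    by (rule C0_embeddable_scaleC) (use a in simp)
  also have "(\<lambda>u. inverse a *\<^sub>C toeplitz G u) = toeplitz F"
  proof
    fix u
    have "toeplitz G u = a *\<^sub>C toeplitz F u"
      using toeplitz_cmult[OF assms(1)] G unfolding G_def[abs_def] by blast
    then show "inverse a *\<^sub>C toeplitz G u = toeplitz F u"
      using a scaleR_scaleC[of 1 "toeplitz F u"] by (simp add: scaleC_scaleC)
  qed
  finally show ?thesis .
qed

end
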